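(* Let $\hat\theta^{C=1}:=\hat\theta_{C}+\hat\omega^{C=1}\big(\hat\theta^f_{\pi(X)}-\hat\theta^f_{C}\big)$, with the components and influence functions $\phi,\phi^f$ defined in the context. Assume the data $(X_i,C_i,Y_i)_{i=1}^{n+N}$ are i.i.d. from $\mathbb Q^*$, that $C$ is conditionally independent of $Y$ given $X$, that $\epsilon<\pi(X)<1-\epsilon$ for some $\epsilon>0$, and that $\hat\omega^{C=1}\xrightarrow{p}\omega^{C=1}$, where $$\omega^{C=1}:=\frac{\operatorname{Cov}\Big(C_i\phi(X_i,Y_i),\ [C_i-\pi(X_i)]\,\phi^f(X_i)\Big)}{\operatorname{Var}\Big([\pi(X_i)-C_i]\,\phi^f(X_i)\Big)}.$$ Then, as $n+N\to\infty$, $\sqrt{n+N}\,(\hat\theta^{C=1}-\theta_0^{C=1})\xrightarrow{d}N(0,\sigma^2_{C=1})$, where $$\sigma^2_{C=1}=\frac{\operatorname{Var}\big(C_i\phi(X_i,Y_i)\big)}{\Pr(C=1)^2}-\frac{\operatorname{Cov}\Big(C_i\phi(X_i,Y_i),\ [\pi(X_i)-C_i]\,\phi^f(X_i)\Big)^2}{\Pr(C=1)^2\,\operatorname{Var}\Big([\pi(X_i)-C_i]\,\phi^f(X_i)\Big)}.$$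
   Context: Setting: $(X,C,Y)\sim\mathbb Q^*$ with $X$ a real vector, $Y$ real, $C\in\{0,1\}$ the indicator that $Y$ is observed; observed data are $(X_i,C_i,C_iY_i)_{i=1}^{n+N}$. $\pi(X)=\Pr(C=1\mid X)$ is known, and $f$ is a fixed deterministic real-valued function of $X$. Inequalities between vectors are componentwise. $\Phi$ is a real-valued functional on cumulative distribution functions (CDFs), Hadamard differentiable with respect to the supremum norm (at the CDFs $F_0^{C=1}$ and $F_0^{C=1,f}$ below), with Gateaux derivative $\dot\Phi(F;h)$ at $F$ in direction $h$, linear in $h$. Let $F_0^{C=1}(x,y)=\mathbb Q^*(X\le x,Y\le y\mid C=1)$ and $F_0^{C=1,f}(x,y)=\mathbb Q^*(X\le x,f(X)\le y\mid C=1)$. The target is $\theta_0^{C=1}:=\Phi(F_0^{C=1})$ (labeled data distribution). With $\delta_{x,y}(u_1,u_2)=I(x\le u_1,y\le u_2)$, set $$\phi(x,y):=\dot\Phi(F_0^{C=1};\delta_{x,y}-F_0^{C=1}),\qquad \phi^f(x):=\dot\Phi(F_0^{C=1,f};\delta_{x,f(x)}-F_0^{C=1,f})$$ ($\phi^f(x)$ is written $\phi(x,f(x))$ in the paper). The estimators are $$\hat\theta_{C}:=\Phi\big(F^{C=1}_{C}\big),\quad F^{C=1}_{C}(x,y):=\frac{\sum_{i=1}^{n+N}C_iI(X_i\le x,Y_i\le y)}{\sum_{i=1}^{n+N}C_i},$$ $$\hat\theta^f_{C}:=\Phi\big(F^{C=1,f}_{C}\big),\quad F^{C=1,f}_{C}(x,y):=\frac{\sum_{i=1}^{n+N}C_iI(X_i\le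 x,f(X_i)\le y)}{\sum_{i=1}^{n+N}C_i},$$ $$\hat\theta^f_{\pi(X)}:=\Phi\big(F^{C=1,f}_{\pi(X)}\big),\quad F^{C=1,f}_{\pi(X)}(x,y):=\frac{\sum_{i=1}^{n+N}\pi(X_i)I(X_i\le x,f(X_i)\le y)}{\sum_{i=1}^{n+N}\pi(X_i)}.$$ The variance in the denominator of $\omega^{C=1}$ is assumed positive. All covariances and variances are under $\mathbb Q^*$. *)

theory Defs
  imports "HOL-Probability.Probability"
begin

section \<open>Observations\<close>

text \<open>An observation is a triple (X, C, Y); C is real-valued and takes the values 0 and 1.\<close>

type_synonym 'd obs = "(real^'d) \<times> real \<times> real"

abbreviation obsX :: "'d obs \<Rightarrow> real^'d" where "obsX z \<equiv> fst z"
abbreviation obsC :: "'d::finite obs \<Rightarrow> real" where "obsC z \<equiv> fst (snd z)"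
abbreviation obsY :: "'d::finite obs \<Rightarrow> real" where "obsY z \<equiv> snd (snd z)"

definition cond_indep_given :: "'a measure \<Rightarrow> 'a measure \<Rightarrow> ('a \<Rightarrow> real) \<Rightarrow> ('a \<Rightarrow> real) \<Rightarrow> bool" where
  "cond_indep_given M G U V \<longleftrightarrow>
     (\<forall>A\<in>sets borel. \<forall>B\<in>sets borel. AE z in M.
        real_cond_exp M G (\<lambda>w. indicator A (U w) * indicator B (V w)) z =
        real_cond_exp M G (\<lambda>w. indicator A (U w)) z * real_cond_exp M G (\<lambda>w. indicator B (V w)) z)"

definition sigmaX :: "'d::finite obs measure \<Rightarrow> 'd obs measure" where
  "sigmaX Q = vimage_algebra (space Q) obsX borel"

definition is_propensity :: "'d::finite obs measure \<Rightarrow> (real^'d \<Rightarrow> real) \<Rightarrow> bool" where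
  "is_propensity Q \<pi> \<longleftrightarrow>
     \<pi> \<in> borel_measurable borel \<and>
     (AE z in Q. real_cond_exp Q (sigmaX Q) (indicator {w. obsC w = 1}) z = \<pi> (obsX z))"

section \<open>Distribution functions and functionals of them\<close>

text \<open>Distribution functions on R^d x R are functions of a pair; the order on real^'d is
  componentwise.\<close>

type_synonym 'd dfun = "(real^'d) \<times> real \<Rightarrow> real"

definition is_cdf :: "'d::finite dfun \<Rightarrow> bool" where
  "is_cdf F \<longleftrightarrow>
     (\<exists>\<mu>. prob_space \<mu> \<and> sets \<mu> = sets borel \<and>
          F = (\<lambda>u. measure \<mu> {p. fst p \<le> fst u \<and> snd p \<le> snd u}))"

definition delta :: "(real^'d) \<times> real \<Rightarrow> 'd::finite dfun" where
  "delta p u = of_bool (fst p \<le> fst u \<and> snd p \<le> snd u)"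

text \<open>Hadamard differentiability at F, with respect to the supremum norm, of a functional whose
  domain is the set of distribution functions (values of \<open>\<Phi>\<close> elsewhere play no role). The
  derivative D is a continuous linear functional on the space of all bounded functions. As \<open>\<Phi>\<close>
  is real-valued, this is no restriction compared to requiring D on a smaller subspace
  containing the relevant directions (Hahn-Banach).\<close>

definition has_hadamard_derivative ::
  "('d::finite dfun \<Rightarrow> real) \<Rightarrow> ('d dfun \<Rightarrow> real) \<Rightarrow> 'd dfun \<Rightarrow> bool" where
  "has_hadamard_derivative \<Phi> D F \<longleftrightarrow>
     is_cdf F \<and>
     (\<forall>h k a b. bounded (range h) \<longrightarrow> bounded (range k) \<longrightarrow>
        D (\<lambda>u. a * h u + b * k u) = a * D h + b * D k) \<and>
     (\<exists>K. \<forall>h. bounded (range h) \<longrightarrow> \<bar>D h\<bar> \<le> K * (SUP u. \<bar>h u\<bar>)) \<and>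
     (\<forall>h H t. bounded (range h) \<longrightarrow> uniform_limit UNIV H h sequentially \<longrightarrow>
        (\<forall>n. 0 < t n) \<longrightarrow> t \<longlonglongrightarrow> 0 \<longrightarrow>
        (\<forall>n. is_cdf (\<lambda>u. F u + t n * H n u)) \<longrightarrow>
        (\<lambda>n. (\<Phi> (\<lambda>u. F u + t n * H n u) - \<Phi> F) / t n) \<longlonglongrightarrow> D h)"

definition F0 :: "'d::finite obs measure \<Rightarrow> 'd dfun" where
  "F0 Q u = \<P>(z in Q. obsX z \<le> fst u \<and> obsY z \<le> snd u \<bar> obsC z = 1)"

definition F0f :: "'d::finite obs measure \<Rightarrow> (real^'d \<Rightarrow> real) \<Rightarrow> 'd dfun" where
  "F0f Q f u = \<P>(z in Q. obsX z \<le> fst u \<and> f (obsX z) \<le> snd u \<bar> obsC z = 1)"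

text \<open>Throughout, \<open>d\<Phi> F h\<close> is the derivative of \<open>\<Phi>\<close> at F in direction h.\<close>

definition phi :: "('d::finite dfun \<Rightarrow> 'd dfun \<Rightarrow> real) \<Rightarrow> 'd obs measure \<Rightarrow>
    (real^'d) \<times> real \<Rightarrow> real" where
  "phi d\<Phi> Q p = d\<Phi> (F0 Q) (\<lambda>u. delta p u - F0 Q u)"

definition phif :: "('d::finite dfun \<Rightarrow> 'd dfun \<Rightarrow> real) \<Rightarrow> 'd obs measure \<Rightarrow>
    (real^'d \<Rightarrow> real) \<Rightarrow> real^'d \<Rightarrow> real" where
  "phif d\<Phi> Q f x = d\<Phi> (F0f Q f) (\<lambda>u. delta (x, f x) u - F0f Q f u)"

section \<open>Estimators\<close>

text \<open>All estimators use the first m data points z 0, ..., z (m - 1); m is the total sample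
  size n + N.\<close>

definition FC :: "nat \<Rightarrow> (nat \<Rightarrow> 'd::finite obs) \<Rightarrow> 'd dfun" where
  "FC m z u = (\<Sum>i<m. obsC (z i) * delta (obsX (z i), obsY (z i)) u) / (\<Sum>i<m. obsC (z i))"

definition FCf :: "(real^'d \<Rightarrow> real) \<Rightarrow> nat \<Rightarrow> (nat \<Rightarrow> 'd::finite obs) \<Rightarrow> 'd dfun" where
  "FCf f m z u =
     (\<Sum>i<m. obsC (z i) * delta (obsX (z i), f (obsX (z i))) u) / (\<Sum>i<m. obsC (z i))"

definition F\<pi>f :: "(real^'d \<Rightarrow> real) \<Rightarrow> (real^'d \<Rightarrow> real) \<Rightarrow> nat \<Rightarrow> (nat \<Rightarrow> 'd::finite obs) \<Rightarrow> 'd dfun"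
  where
  "F\<pi>f \<pi> f m z u =
     (\<Sum>i<m. \<pi> (obsX (z i)) * delta (obsX (z i), f (obsX (z i))) u) / (\<Sum>i<m. \<pi> (obsX (z i)))"

definition theta_hat ::
  "('d::finite dfun \<Rightarrow> real) \<Rightarrow> (real^'d \<Rightarrow> real) \<Rightarrow> (real^'d \<Rightarrow> real) \<Rightarrow> real \<Rightarrow>
   nat \<Rightarrow> (nat \<Rightarrow> 'd obs) \<Rightarrow> real" where
  "theta_hat \<Phi> \<pi> f w m z = \<Phi> (FC m z) + w * (\<Phi> (F\<pi>f \<pi> f m z) - \<Phi> (FCf f m z))"

section \<open>Moments and modes of convergence\<close>

definition covariance :: "'a measure \<Rightarrow> ('a \<Rightarrow> real) \<Rightarrow> ('a \<Rightarrow> real) \<Rightarrow> real" where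
  "covariance M U V = (\<integral>z. (U z - (\<integral>w. U w \<partial>M)) * (V z - (\<integral>w. V w \<partial>M)) \<partial>M)"

definition omegaC :: "('d::finite dfun \<Rightarrow> 'd dfun \<Rightarrow> real) \<Rightarrow> 'd obs measure \<Rightarrow>
    (real^'d \<Rightarrow> real) \<Rightarrow> (real^'d \<Rightarrow> real) \<Rightarrow> real" where
  "omegaC d\<Phi> Q \<pi> f =
     covariance Q (\<lambda>z. obsC z * phi d\<Phi> Q (obsX z, obsY z))
                  (\<lambda>z. (obsC z - \<pi> (obsX z)) * phif d\<Phi> Q f (obsX z))
     / prob_space.variance Q (\<lambda>z. (\<pi> (obsX z) - obsC z) * phif d\<Phi> Q f (obsX z))"

definition sigma2C :: "('d::finite dfun \<Rightarrow> 'd dfun \<Rightarrow> real) \<Rightarrow> 'd obs measure \<Rightarrow>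
    (real^'d \<Rightarrow> real) \<Rightarrow> (real^'d \<Rightarrow> real) \<Rightarrow> real" where
  "sigma2C d\<Phi> Q \<pi> f =
     prob_space.variance Q (\<lambda>z. obsC z * phi d\<Phi> Q (obsX z, obsY z))
       / \<P>(z in Q. obsC z = 1)\<^sup>2
     - (covariance Q (\<lambda>z. obsC z * phi d\<Phi> Q (obsX z, obsY z))
                     (\<lambda>z. (\<pi> (obsX z) - obsC z) * phif d\<Phi> Q f (obsX z)))\<^sup>2
       / (\<P>(z in Q. obsC z = 1)\<^sup>2 *
          prob_space.variance Q (\<lambda>z. (\<pi> (obsX z) - obsC z) * phif d\<Phi> Q f (obsX z)))"

definition tendsto_in_prob :: "'w measure \<Rightarrow> (nat \<Rightarrow> 'w \<Rightarrow> real) \<Rightarrow> real \<Rightarrow> bool" where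
  "tendsto_in_prob M W c \<longleftrightarrow> (\<forall>e>0. (\<lambda>m. \<P>(\<omega> in M. \<bar>W m \<omega> - c\<bar> > e)) \<longlonglongrightarrow> 0)"

text \<open>The second parameter is the variance. The degenerate case is needed because
  \<open>normal_density \<mu> 0\<close> is identically zero.\<close>

definition normal_law :: "real \<Rightarrow> real \<Rightarrow> real measure" where
  "normal_law \<mu> v =
     (if v = 0 then return borel \<mu> else density lborel (normal_density \<mu> (sqrt v)))"

end

theory Submission
  imports Defs "HOL-Complex_Analysis.Great_Picard"
begin

text \<open>Each of the three estimators is \<open>\<Phi>\<close> at a weighted empirical distribution function
  \<open>F\<^sub>m\<close>, so the functional delta method linearises it: \<open>sqrt m * (\<Phi> F\<^sub>m - \<Phi> F)\<close> is, up to a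
  term vanishing in probability, the derivative of \<open>\<Phi>\<close> at \<open>F\<close> in direction \<open>sqrt m * (F\<^sub>m - F)\<close>,
  which is a normalised sum of influence functions divided by \<open>Pr(C = 1)\<close>. Differentiability is
  only assumed along uniformly convergent directions, so this needs asymptotic tightness of the
  empirical process of orthants in supremum norm; that follows from bracketing by the marginal
  distribution functions and a chaining argument with a Bernstein-type exponential bound. The
  estimator is then asymptotically the normalised i.i.d. sum of
  \<open>(C \<phi> + \<omega> (\<pi>(X) - C) \<phi>\<^sup>f) / Pr(C = 1)\<close>, and the central limit theorem applies; \<open>\<omega>\<close> is minus a
  regression coefficient, which turns the variance into the stated one.\<close>

section \<open>Stochastic order calculus\<close>

text \<open>No limit process is constructed and no weak convergence in a function space is used.
  Tightness alone removes the nonlinear remainder of \<open>\<Phi>\<close>; after that, linearity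
  turns the derivative at the rescaled empirical distribution function into a finite sum of
  influence functions, so the central limit theorem is needed for real variables only. Since the
  derivative is bounded and the directions \<open>delta - F\<close> lie in [-1, 1], the influence
  functions are bounded and all moments exist.

  The propensity enters through \<open>E(C | X) = \<pi>(X)\<close>: weighting by \<open>C\<close> or
  by \<open>\<pi>(X)\<close> gives the same limiting distribution function of
  \<open>(X, f(X))\<close>. The added difference is therefore centred at zero, and an error in the
  estimated weight only multiplies a term that is already of order 1 / sqrt m. The random
  denominators of the distribution functions are handled by an exact identity rather than by an
  expansion. Labels and propensities lie in [0, 1] only almost everywhere, so everywhere bounded
  versions stand in for them.\<close>

context prob_space
begin

text \<open>Inner probability at least \<open>1 - \<eta>\<close>; suprema of empirical processes need not be
  measurable, so no measurability is asked of \<open>P\<close>.\<close>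

definition likely :: "real \<Rightarrow> ('a \<Rightarrow> bool) \<Rightarrow> bool" where
  "likely \<eta> P \<longleftrightarrow> (\<exists>E\<in>events. 1 - \<eta> \<le> prob E \<and> (\<forall>\<omega>\<in>E. P \<omega>))"

definition whp :: "(nat \<Rightarrow> 'a \<Rightarrow> bool) \<Rightarrow> bool" where
  "whp P \<longleftrightarrow> (\<forall>\<eta>>0. \<forall>\<^sub>F m in sequentially. likely \<eta> (P m))"

text \<open>Together with \<open>big_Op\<close> this is the o_P(1) and O_P(1) calculus, read with
  the outer probability of the failure event. The bound in \<open>big_Op\<close> may depend on the
  tolerated failure probability and has to hold only for large \<open>m\<close>.\<close>

definition small_op :: "(nat \<Rightarrow> 'a \<Rightarrow> real) \<Rightarrow> bool" where
  "small_op X \<longleftrightarrow> (\<forall>e>0. whp (\<lambda>m \<omega>. \<bar>X m \<omega>\<bar> \<le> e))"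

definition big_Op :: "(nat \<Rightarrow> 'a \<Rightarrow> real) \<Rightarrow> bool" where
  "big_Op X \<longleftrightarrow> (\<forall>\<eta>>0. \<exists>B>0. \<forall>\<^sub>F m in sequentially. likely \<eta> (\<lambda>\<omega>. \<bar>X m \<omega>\<bar> \<le> B))"

lemma likely_mono: "likely \<eta> P \<Longrightarrow> \<eta> \<le> \<eta>' \<Longrightarrow> (\<And>\<omega>. \<omega> \<in> space M \<Longrightarrow> P \<omega> \<Longrightarrow> P' \<omega>) \<Longrightarrow> likely \<eta>' P'"
  unfolding likely_def by (meson diff_left_mono order_trans sets.sets_into_space subsetD)

lemma likely_conj:
  assumes "likely a P" "likely b P'"
  shows "likely (a + b) (\<lambda>\<omega>. P \<omega> \<and> P' \<omega>)"
proof -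
  obtain E E' where E: "E \<in> events" "1 - a \<le> prob E" "\<forall>\<omega>\<in>E. P \<omega>"
    and E': "E' \<in> events" "1 - b \<le> prob E'" "\<forall>\<omega>\<in>E'. P' \<omega>"
    using assms unfolding likely_def by blast
  have "prob E + prob E' = prob (E \<union> E') + prob (E \<inter> E')"
    using E(1) E'(1) by (simp add: finite_measure_Union' finite_measure_Diff' Int_commute Un_commute)
  moreover have "prob (E \<union> E') \<le> 1" by simp
  ultimately have "1 - (a + b) \<le> prob (E \<inter> E')" using E(2) E'(2) by linarith
  then show ?thesis unfolding likely_def using E E' by (intro bexI[of _ "E \<inter> E'"]) auto
qed

lemma likely_AE:
  assumes "AE \<omega> in M. P \<omega>" "0 \<le> \<eta>"
  shows "likely \<eta> P"
proof -
  obtain N where N: "{\<omega>\<in>space M. \<not> P \<omega>} \<subseteq> N" "N \<in> events" "emeasure M N = 0"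
    using assms(1) by (auto elim!: AE_E)
  then have "prob N = 0" by (simp add: measure_def)
  then have "prob (space M - N) = 1" using N(2) by (simp add: prob_compl)
  then show ?thesis unfolding likely_def using N assms(2)
    by (intro bexI[of _ "space M - N"]) auto
qed

lemma likely_nonempty:
  assumes "likely \<eta> P" "\<eta> < 1"
  shows "\<exists>\<omega>\<in>space M. P \<omega>"
proof -
  obtain E where E: "E \<in> events" "1 - \<eta> \<le> prob E" "\<forall>\<omega>\<in>E. P \<omega>"
    using assms(1) unfolding likely_def by blast
  then have "E \<noteq> {}" using assms(2) by auto
  then show ?thesis using E sets.sets_into_space by blast
qed

lemma likely_finite_conj:
  assumes "\<And>n. n \<le> (j::nat) \<Longrightarrow> likely (a n) (P n)"
  shows "likely (\<Sum>n\<le>j. a n) (\<lambda>\<omega>. \<forall>n\<le>j. P n \<omega>)"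
  using assms
proof (induction j)
  case 0
  then show ?case by simp
next
  case (Suc j)
  have "likely ((\<Sum>n\<le>j. a n) + a (Suc j)) (\<lambda>\<omega>. (\<forall>n\<le>j. P n \<omega>) \<and> P (Suc j) \<omega>)"
    using Suc by (intro likely_conj) auto
  then show ?case by (rule likely_mono) (auto simp: le_Suc_eq)
qed

lemma likely_Collect:
  assumes "{\<omega>\<in>space M. P \<omega>} \<in> events" "prob {\<omega>\<in>space M. \<not> P \<omega>} \<le> \<eta>"
  shows "likely \<eta> P"
proof -
  have "{\<omega>\<in>space M. \<not> P \<omega>} = space M - {\<omega>\<in>space M. P \<omega>}" by auto
  then have "prob {\<omega>\<in>space M. \<not> P \<omega>} = 1 - prob {\<omega>\<in>space M. P \<omega>}"
    using assms(1) by (simp add: prob_compl)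
  then show ?thesis unfolding likely_def using assms
    by (intro bexI[of _ "{\<omega>\<in>space M. P \<omega>}"]) auto
qed

lemma whpD: "whp P \<Longrightarrow> \<eta> > 0 \<Longrightarrow> \<forall>\<^sub>F m in sequentially. likely \<eta> (P m)"
  by (simp add: whp_def)

lemma whp_mono:
  assumes "whp P" "\<And>m \<omega>. \<omega> \<in> space M \<Longrightarrow> P m \<omega> \<Longrightarrow> P' m \<omega>"
  shows "whp P'"
  unfolding whp_def
proof safe
  fix \<eta> :: real assume "\<eta> > 0"
  from whpD[OF assms(1) this] show "\<forall>\<^sub>F m in sequentially. likely \<eta> (P' m)"
    by (rule eventually_mono) (use assms(2) likely_mono in blast)
qed

lemma whp_conj:
  assumes "whp P" "whp P'"
  shows "whp (\<lambda>m \<omega>. P m \<omega> \<and> P' m \<omega>)"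
  unfolding whp_def
proof safe
  fix \<eta> :: real assume "\<eta> > 0"
  then have "\<eta> / 2 > 0" by simp
  show "\<forall>\<^sub>F m in sequentially. likely \<eta> (\<lambda>\<omega>. P m \<omega> \<and> P' m \<omega>)"
    using whpD[OF assms(1) \<open>\<eta> / 2 > 0\<close>] whpD[OF assms(2) \<open>\<eta> / 2 > 0\<close>]
  proof eventually_elim
    case (elim m)
    from likely_conj[OF this] show ?case by simp
  qed
qed

lemma whp_eventually:
  assumes "whp P" "\<forall>\<^sub>F m in sequentially. \<forall>\<omega>\<in>space M. P m \<omega> \<longrightarrow> P' m \<omega>"
  shows "whp P'"
  unfolding whp_def
proof safe
  fix \<eta> :: real assume "\<eta> > 0"
  from whpD[OF assms(1) this] assms(2) show "\<forall>\<^sub>F m in sequentially. likely \<eta> (P' m)"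
    by eventually_elim (use likely_mono in blast)
qed

lemma whp_AE: "(\<And>m. AE \<omega> in M. P m \<omega>) \<Longrightarrow> whp P"
  unfolding whp_def by (simp add: likely_AE)

lemma small_opD: "small_op X \<Longrightarrow> e > 0 \<Longrightarrow> whp (\<lambda>m \<omega>. \<bar>X m \<omega>\<bar> \<le> e)"
  by (simp add: small_op_def)

lemma small_op_cong:
  assumes "small_op X" "whp (\<lambda>m \<omega>. X m \<omega> = Y m \<omega>)"
  shows "small_op Y"
  unfolding small_op_def
proof safe
  fix e :: real assume "e > 0"
  from whp_conj[OF small_opD[OF assms(1) this] assms(2)]
  show "whp (\<lambda>m \<omega>. \<bar>Y m \<omega>\<bar> \<le> e)" by (rule whp_mono) auto
qed

lemma small_op_add:
  assumes "small_op X" "small_op Y"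
  shows "small_op (\<lambda>m \<omega>. X m \<omega> + Y m \<omega>)"
  unfolding small_op_def
proof safe
  fix e :: real assume "e > 0"
  then have e: "e / 2 > 0" by simp
  from whp_conj[OF small_opD[OF assms(1) e] small_opD[OF assms(2) e]]
  show "whp (\<lambda>m \<omega>. \<bar>X m \<omega> + Y m \<omega>\<bar> \<le> e)"
    by (rule whp_mono) linarith
qed

lemma small_op_imp_big_Op: "small_op X \<Longrightarrow> big_Op X"
  unfolding big_Op_def using whpD[OF small_opD[of X 1]] by (intro allI impI exI[of _ 1]) simp

lemma big_Op_add:
  assumes "big_Op X" "big_Op Y"
  shows "big_Op (\<lambda>m \<omega>. X m \<omega> + Y m \<omega>)"
  unfolding big_Op_def
proof safe
  fix \<eta> :: real assume "\<eta> > 0"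
  then have \<eta>: "\<eta> / 2 > 0" by simp
  obtain B C where B: "B > 0" "\<forall>\<^sub>F m in sequentially. likely (\<eta>/2) (\<lambda>\<omega>. \<bar>X m \<omega>\<bar> \<le> B)"
    and C: "C > 0" "\<forall>\<^sub>F m in sequentially. likely (\<eta>/2) (\<lambda>\<omega>. \<bar>Y m \<omega>\<bar> \<le> C)"
    using assms \<eta> unfolding big_Op_def by blast
  have "\<forall>\<^sub>F m in sequentially. likely \<eta> (\<lambda>\<omega>. \<bar>X m \<omega> + Y m \<omega>\<bar> \<le> B + C)"
    using B(2) C(2)
  proof eventually_elim
    case (elim m)
    from likely_conj[OF this] show ?case by (rule likely_mono) auto
  qed
  then show "\<exists>B>0. \<forall>\<^sub>F m in sequentially. likely \<eta> (\<lambda>\<omega>. \<bar>X m \<omega> + Y m \<omega>\<bar> \<le> B)"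
    using B(1) C(1) by (intro exI[of _ "B + C"]) auto
qed

lemma big_Op_const: "big_Op (\<lambda>_ _. c)"
  unfolding big_Op_def by (intro allI impI exI[of _ "\<bar>c\<bar> + 1"]) (simp add: likely_AE)

lemma small_op_mult:
  assumes "small_op X" "big_Op Y"
  shows "small_op (\<lambda>m \<omega>. X m \<omega> * Y m \<omega>)"
  unfolding small_op_def whp_def
proof safe
  fix e \<eta> :: real assume "e > 0" "\<eta> > 0"
  then have \<eta>: "\<eta> / 2 > 0" by simp
  obtain B where B: "B > 0" "\<forall>\<^sub>F m in sequentially. likely (\<eta>/2) (\<lambda>\<omega>. \<bar>Y m \<omega>\<bar> \<le> B)"
    using assms(2) \<eta> unfolding big_Op_def by blast
  have "e / B > 0" using \<open>e > 0\<close> B(1) by simp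
  show "\<forall>\<^sub>F m in sequentially. likely \<eta> (\<lambda>\<omega>. \<bar>X m \<omega> * Y m \<omega>\<bar> \<le> e)"
    using B(2) whpD[OF small_opD[OF assms(1) \<open>e / B > 0\<close>] \<eta>]
  proof eventually_elim
    case (elim m)
    from likely_conj[OF this] show ?case
    proof (rule likely_mono)
      fix \<omega> assume "\<bar>Y m \<omega>\<bar> \<le> B \<and> \<bar>X m \<omega>\<bar> \<le> e / B"
      then have "\<bar>X m \<omega>\<bar> * \<bar>Y m \<omega>\<bar> \<le> (e / B) * B" by (intro mult_mono) auto
      then show "\<bar>X m \<omega> * Y m \<omega>\<bar> \<le> e" using B(1) by (simp add: abs_mult)
    qed auto
  qed
qed

lemma small_op_seq:
  assumes "c \<longlonglongrightarrow> 0"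
  shows "small_op (\<lambda>m _. c m)"
  unfolding small_op_def whp_def
proof safe
  fix e \<eta> :: real assume "e > 0" "\<eta> > 0"
  from tendstoD[OF assms \<open>e > 0\<close>]
  show "\<forall>\<^sub>F m in sequentially. likely \<eta> (\<lambda>\<omega>. \<bar>c m\<bar> \<le> e)"
    by eventually_elim (use \<open>\<eta> > 0\<close> in \<open>simp add: likely_AE\<close>)
qed

lemma small_op_continuous:
  assumes "small_op (\<lambda>m \<omega>. X m \<omega> - c)" "isCont g c"
  shows "small_op (\<lambda>m \<omega>. g (X m \<omega>) - g c)"
  unfolding small_op_def
proof safe
  fix e :: real assume "e > 0"
  then obtain d where d: "d > 0" "\<And>x. \<bar>x - c\<bar> < d \<Longrightarrow> \<bar>g x - g c\<bar> < e"
    using assms(2) unfolding continuous_at_eps_delta dist_real_def by blast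
  have "d / 2 > 0" using d by simp
  from small_opD[OF assms(1) this]
  show "whp (\<lambda>m \<omega>. \<bar>g (X m \<omega>) - g c\<bar> \<le> e)"
  proof (rule whp_mono)
    fix m \<omega> assume "\<bar>X m \<omega> - c\<bar> \<le> d / 2"
    then have "\<bar>X m \<omega> - c\<bar> < d" using d(1) by linarith
    then show "\<bar>g (X m \<omega>) - g c\<bar> \<le> e" using d(2) by (simp add: less_imp_le)
  qed
qed

text \<open>Deduces a deterministic identity from a probabilistic one: an event of positive inner
  probability has a point. The vanishing mean of the influence function is obtained this
  way.\<close>

lemma small_op_const_zero:
  assumes "small_op (\<lambda>_ _. c)"
  shows "c = 0"
proof (rule ccontr)
  assume "c \<noteq> 0"
  then have "\<forall>\<^sub>F m in sequentially. likely (1/2) (\<lambda>\<omega>. \<bar>c\<bar> \<le> \<bar>c\<bar> / 2)"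
    using whpD[OF small_opD[OF assms, of "\<bar>c\<bar> / 2"], of "1/2"] by simp
  then have "likely (1/2) (\<lambda>\<omega>. \<bar>c\<bar> \<le> \<bar>c\<bar> / 2)" by simp
  from likely_nonempty[OF this] show False using \<open>c \<noteq> 0\<close> by simp
qed

lemma tendsto_in_prob_imp_small_op:
  assumes "tendsto_in_prob M W c" and [measurable]: "\<And>m. W m \<in> borel_measurable M"
  shows "small_op (\<lambda>m \<omega>. W m \<omega> - c)"
  unfolding small_op_def whp_def
proof safe
  fix e \<eta> :: real assume "e > 0" "\<eta> > 0"
  have "(\<lambda>m. prob {\<omega>\<in>space M. \<bar>W m \<omega> - c\<bar> > e}) \<longlonglongrightarrow> 0"
    using assms(1) \<open>e > 0\<close> by (simp add: tendsto_in_prob_def)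
  from tendstoD[OF this \<open>\<eta> > 0\<close>]
  show "\<forall>\<^sub>F m in sequentially. likely \<eta> (\<lambda>\<omega>. \<bar>W m \<omega> - c\<bar> \<le> e)"
  proof eventually_elim
    case (elim m)
    have "{\<omega>\<in>space M. \<not> \<bar>W m \<omega> - c\<bar> \<le> e} = {\<omega>\<in>space M. \<bar>W m \<omega> - c\<bar> > e}" by auto
    then show ?case using elim by (intro likely_Collect) auto
  qed
qed

text \<open>Slutsky's lemma: characteristic functions turn a perturbation of the random variable into
  a bounded perturbation of an expectation.\<close>

lemma weak_conv_small_op:
  assumes [measurable]: "\<And>m. S m \<in> borel_measurable M" "\<And>m. T m \<in> borel_measurable M"
    and diff: "small_op (\<lambda>m \<omega>. S m \<omega> - T m \<omega>)"
    and L: "real_distribution L"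
    and conv: "weak_conv_m (\<lambda>m. distr M borel (T m)) L"
  shows "weak_conv_m (\<lambda>m. distr M borel (S m)) L"
proof (rule levy_continuity[OF _ L])
  show rdS: "\<And>m. real_distribution (distr M borel (S m))" by (rule real_distribution_distr) simp
  fix t :: real
  have rdT: "\<And>m. real_distribution (distr M borel (T m))" by (rule real_distribution_distr) simp
  have T: "(\<lambda>m. char (distr M borel (T m)) t) \<longlonglongrightarrow> char L t"
    by (rule levy_continuity1[OF rdT L conv])
  have "(\<lambda>m. char (distr M borel (S m)) t - char (distr M borel (T m)) t) \<longlonglongrightarrow> 0"
  proof (rule tendstoI)
    fix e :: real assume "e > 0"
    \<comment> \<open>On the good event the exponentials differ by at most
      \<open>\<bar>t\<bar> * e'\<close>, which is at most \<open>e / 4\<close>; the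
      \<open>+ 1\<close> covers \<open>t = 0\<close>. Off it they differ by at most 2 on a set of
      mass at most \<open>e / 8\<close>, which costs another \<open>e / 4\<close>.\<close>
    define e' where "e' = e / (4 * (\<bar>t\<bar> + 1))"
    have "e' > 0" using \<open>e > 0\<close> by (simp add: e'_def)
    have te: "\<bar>t\<bar> * e' < e / 2"
    proof -
      have "\<bar>t\<bar> * e' = (e / 4) * (\<bar>t\<bar> / (\<bar>t\<bar> + 1))" by (simp add: e'_def field_simps)
      also have "\<dots> \<le> (e / 4) * 1" using \<open>e > 0\<close> by (intro mult_left_mono) (auto simp: field_simps)
      finally show ?thesis using \<open>e > 0\<close> by simp
    qed
    have "e / 8 > 0" using \<open>e > 0\<close> by simp
    from whpD[OF small_opD[OF diff \<open>e' > 0\<close>] this]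
    show "\<forall>\<^sub>F m in sequentially.
        dist (char (distr M borel (S m)) t - char (distr M borel (T m)) t) 0 < e"
    proof eventually_elim
      case (elim m)
      then obtain E where E[measurable]: "E \<in> events" and pE: "1 - e / 8 \<le> prob E"
        and dE: "\<And>\<omega>. \<omega> \<in> E \<Longrightarrow> \<bar>S m \<omega> - T m \<omega>\<bar> \<le> e'"
        unfolding likely_def by blast
      have int: "integrable M (\<lambda>\<omega>. iexp (t * X \<omega>))" if [measurable]: "X \<in> borel_measurable M"
        for X :: "'a \<Rightarrow> real"
        by (rule integrable_const_bound[where B = 1]) auto
      have indE: "integrable M (indicat_real (space M - E))"
        by (intro integrable_real_indicator) (auto simp: less_top[symmetric])
      have pw: "norm (iexp (t * S m \<omega>) - iexp (t * T m \<omega>))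
          \<le> \<bar>t\<bar> * e' + 2 * indicator (space M - E) \<omega>" if "\<omega> \<in> space M" for \<omega>
      proof (cases "\<omega> \<in> E")
        case True
        have "norm (iexp (t * S m \<omega>) - iexp (t * T m \<omega>)) \<le> \<bar>t * S m \<omega> - t * T m \<omega>\<bar>"
        proof -
          \<comment> \<open>Factoring out a number of modulus one reduces the Lipschitz bound for
            the exponential to the Taylor estimate at 0.\<close>
          have eq: "iexp (t * S m \<omega>) - iexp (t * T m \<omega>)
              = iexp (t * T m \<omega>) * (iexp (t * S m \<omega> - t * T m \<omega>) - 1)"
            by (simp add: algebra_simps flip: exp_add)
          have "norm (iexp (t * S m \<omega> - t * T m \<omega>) - 1) \<le> \<bar>t * S m \<omega> - t * T m \<omega>\<bar>"
            using iexp_approx1[of "t * S m \<omega> - t * T m \<omega>" 0] by simp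
          then show ?thesis unfolding eq norm_mult by simp
        qed
        also have "\<dots> = \<bar>t\<bar> * \<bar>S m \<omega> - T m \<omega>\<bar>" by (simp flip: abs_mult right_diff_distrib)
        also have "\<dots> \<le> \<bar>t\<bar> * e'" using dE[OF True] by (intro mult_left_mono) auto
        finally show ?thesis by (simp add: indicator_def)
      next
        case False
        have "norm (iexp (t * S m \<omega>) - iexp (t * T m \<omega>)) \<le> 1 + 1"
          by (intro order_trans[OF norm_triangle_ineq4] add_mono) auto
        then show ?thesis using False that \<open>e' > 0\<close> by (simp add: indicator_def add_increasing)
      qed
      have "norm (char (distr M borel (S m)) t - char (distr M borel (T m)) t)
          = norm (\<integral>\<omega>. iexp (t * S m \<omega>) - iexp (t * T m \<omega>) \<partial>M)"
        using Bochner_Integration.integral_diff[OF int[of "S m"] int[of "T m"]]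
        by (simp add: char_def integral_distr)
      also have "\<dots> \<le> (\<integral>\<omega>. norm (iexp (t * S m \<omega>) - iexp (t * T m \<omega>)) \<partial>M)"
        by (rule integral_norm_bound)
      also have "\<dots> \<le> (\<integral>\<omega>. \<bar>t\<bar> * e' + 2 * indicator (space M - E) \<omega> \<partial>M)"
        by (intro integral_mono Bochner_Integration.integrable_add integrable_mult_right indE pw
            integrable_norm Bochner_Integration.integrable_diff int) auto
      also have "\<dots> = \<bar>t\<bar> * e' + 2 * (1 - prob E)"
        by (subst Bochner_Integration.integral_add) (simp_all add: prob_space prob_compl indE)
      also have "\<dots> < e / 2 + e / 2"
        using pE \<open>e > 0\<close> by (intro add_less_le_mono te) (simp add: field_simps)
      finally show ?case by (simp add: dist_norm)
    qed
  qed
  from tendsto_add[OF this T] show "(\<lambda>m. char (distr M borel (S m)) t) \<longlonglongrightarrow> char L t" by simp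
qed

end

section \<open>Asymptotic tightness and the functional delta method\<close>

context prob_space
begin

text \<open>Asymptotic tightness in the space of bounded functions: up to small probability, each
  \<open>H m\<close> is bounded and, up to \<open>\<eta>\<close>, constant on the cells of a fixed finite partition, which is
  encoded by the fibres of \<open>c\<close>.\<close>

definition tight_process :: "(nat \<Rightarrow> 'a \<Rightarrow> 'u \<Rightarrow> real) \<Rightarrow> bool" where
  "tight_process H \<longleftrightarrow> (\<forall>\<eta>>0. \<exists>(c::'u \<Rightarrow> nat) B. finite (range c) \<and> 0 < B \<and>
     (\<forall>\<^sub>F m in sequentially. likely \<eta> (\<lambda>\<omega>. (\<forall>u. \<bar>H m \<omega> u\<bar> \<le> B) \<and>
        (\<forall>u v. c u = c v \<longrightarrow> \<bar>H m \<omega> u - H m \<omega> v\<bar> \<le> \<eta>))))"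

text \<open>The definition uses a single \<open>\<eta>\<close> for the failure probability and for
  the oscillation; taking the smaller of two tolerances separates them.\<close>

lemma tight_processE:
  assumes "tight_process H" "0 < \<eta>" "0 < e"
  obtains c :: "'u \<Rightarrow> nat" and B where "finite (range c)" "0 < B"
    "\<forall>\<^sub>F m in sequentially. likely \<eta> (\<lambda>\<omega>. (\<forall>u. \<bar>H m \<omega> u\<bar> \<le> B) \<and>
        (\<forall>u v. c u = c v \<longrightarrow> \<bar>H m \<omega> u - H m \<omega> v\<bar> \<le> e))"
proof -
  define d where "d = min \<eta> e"
  have "d > 0" "d \<le> \<eta>" "d \<le> e" using assms by (auto simp: d_def)
  then obtain c :: "'u \<Rightarrow> nat" and B where "finite (range c)" "0 < B" and
    ev: "\<forall>\<^sub>F m in sequentially. likely d (\<lambda>\<omega>. (\<forall>u. \<bar>H m \<omega> u\<bar> \<le> B) \<and>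
        (\<forall>u v. c u = c v \<longrightarrow> \<bar>H m \<omega> u - H m \<omega> v\<bar> \<le> d))"
    using assms(1) unfolding tight_process_def by blast
  moreover have "\<forall>\<^sub>F m in sequentially. likely \<eta> (\<lambda>\<omega>. (\<forall>u. \<bar>H m \<omega> u\<bar> \<le> B) \<and>
        (\<forall>u v. c u = c v \<longrightarrow> \<bar>H m \<omega> u - H m \<omega> v\<bar> \<le> e))"
    using ev
  proof eventually_elim
    case (elim m)
    then show ?case by (rule likely_mono) (use \<open>d \<le> \<eta>\<close> \<open>d \<le> e\<close> in \<open>auto intro: order_trans\<close>)
  qed
  ultimately show thesis using that by blast
qed

text \<open>Cells are cut by the value of \<open>F\<close>, not by the location of the argument, so
  jumps do no harm. This covers the term that centring a ratio contributes, a random multiple of a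
  fixed distribution function.\<close>

lemma tight_process_const:
  fixes F :: "'u \<Rightarrow> real"
  assumes "\<And>u. 0 \<le> F u" "\<And>u. F u \<le> 1"
  shows "tight_process (\<lambda>_ _. F)"
  unfolding tight_process_def
proof safe
  fix \<eta> :: real assume "\<eta> > 0"
  define c where "c u = nat \<lfloor>F u / \<eta>\<rfloor>" for u
  have "c u \<le> nat \<lfloor>1 / \<eta>\<rfloor>" for u
    unfolding c_def using assms \<open>\<eta> > 0\<close> by (intro nat_mono floor_mono divide_right_mono) auto
  then have "finite (range c)" by (intro finite_subset[of "range c" "{..nat \<lfloor>1 / \<eta>\<rfloor>}"]) auto
  moreover have "\<bar>F u - F v\<bar> \<le> \<eta>" if "c u = c v" for u v
  proof -
    have "\<lfloor>F u / \<eta>\<rfloor> = \<lfloor>F v / \<eta>\<rfloor>"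
      using that assms[of u] assms[of v] \<open>\<eta> > 0\<close> unfolding c_def
      by (metis divide_nonneg_pos eq_nat_nat_iff zero_le_floor)
    then have "\<bar>F u / \<eta> - F v / \<eta>\<bar> < 1" by linarith
    then have "\<bar>F u - F v\<bar> / \<eta> < 1"
      using \<open>\<eta> > 0\<close> by (metis abs_divide abs_of_pos diff_divide_distrib)
    then show ?thesis using \<open>\<eta> > 0\<close> by (simp add: field_simps)
  qed
  moreover have "\<bar>F u\<bar> \<le> 1" for u using assms[of u] by simp
  ultimately show "\<exists>(c::'u \<Rightarrow> nat) B. finite (range c) \<and> 0 < B \<and>
     (\<forall>\<^sub>F m in sequentially. likely \<eta> (\<lambda>\<omega>. (\<forall>u. \<bar>F u\<bar> \<le> B) \<and>
        (\<forall>u v. c u = c v \<longrightarrow> \<bar>F u - F v\<bar> \<le> \<eta>)))"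
    using \<open>\<eta> > 0\<close> by (intro exI[of _ c] exI[of _ 1]) (simp add: likely_AE)
qed

lemma tight_process_scale:
  fixes H :: "nat \<Rightarrow> 'a \<Rightarrow> 'u \<Rightarrow> real"
  assumes "big_Op X" "tight_process H"
  shows "tight_process (\<lambda>m \<omega> u. X m \<omega> * H m \<omega> u)"
  unfolding tight_process_def
proof safe
  fix \<eta> :: real assume "\<eta> > 0"
  then have \<eta>: "\<eta> / 2 > 0" by simp
  obtain A where A: "A > 0" "\<forall>\<^sub>F m in sequentially. likely (\<eta>/2) (\<lambda>\<omega>. \<bar>X m \<omega>\<bar> \<le> A)"
    using assms(1) \<eta> unfolding big_Op_def by blast
  have "\<eta> / A > 0" using A(1) \<open>\<eta> > 0\<close> by simp
  obtain c :: "'u \<Rightarrow> nat" and B where c: "finite (range c)" "0 < B" and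
    ev: "\<forall>\<^sub>F m in sequentially. likely (\<eta>/2) (\<lambda>\<omega>. (\<forall>u. \<bar>H m \<omega> u\<bar> \<le> B) \<and>
        (\<forall>u v. c u = c v \<longrightarrow> \<bar>H m \<omega> u - H m \<omega> v\<bar> \<le> \<eta> / A))"
    by (rule tight_processE[OF assms(2) \<eta> \<open>\<eta> / A > 0\<close>])
  have "\<forall>\<^sub>F m in sequentially. likely \<eta> (\<lambda>\<omega>. (\<forall>u. \<bar>X m \<omega> * H m \<omega> u\<bar> \<le> A * B) \<and>
        (\<forall>u v. c u = c v \<longrightarrow> \<bar>X m \<omega> * H m \<omega> u - X m \<omega> * H m \<omega> v\<bar> \<le> \<eta>))"
    using A(2) ev
  proof eventually_elim
    case (elim m)
    show ?case
    proof (rule likely_mono[OF likely_conj[OF elim]])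
      fix \<omega>
      assume *: "\<bar>X m \<omega>\<bar> \<le> A \<and> (\<forall>u. \<bar>H m \<omega> u\<bar> \<le> B) \<and>
        (\<forall>u v. c u = c v \<longrightarrow> \<bar>H m \<omega> u - H m \<omega> v\<bar> \<le> \<eta> / A)"
      have "\<bar>X m \<omega> * H m \<omega> u\<bar> \<le> A * B" for u
        unfolding abs_mult using * A(1) by (intro mult_mono) auto
      moreover have "\<bar>X m \<omega> * H m \<omega> u - X m \<omega> * H m \<omega> v\<bar> \<le> \<eta>" if "c u = c v" for u v
      proof -
        have "\<bar>X m \<omega>\<bar> * \<bar>H m \<omega> u - H m \<omega> v\<bar> \<le> A * (\<eta> / A)"
          using * A(1) that by (intro mult_mono) auto
        then show ?thesis using A(1) by (simp flip: abs_mult right_diff_distrib)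
      qed
      ultimately show "(\<forall>u. \<bar>X m \<omega> * H m \<omega> u\<bar> \<le> A * B) \<and>
        (\<forall>u v. c u = c v \<longrightarrow> \<bar>X m \<omega> * H m \<omega> u - X m \<omega> * H m \<omega> v\<bar> \<le> \<eta>)" by blast
    qed simp
  qed
  then show "\<exists>(c::'u \<Rightarrow> nat) B. finite (range c) \<and> 0 < B \<and>
     (\<forall>\<^sub>F m in sequentially. likely \<eta> (\<lambda>\<omega>. (\<forall>u. \<bar>X m \<omega> * H m \<omega> u\<bar> \<le> B) \<and>
        (\<forall>u v. c u = c v \<longrightarrow> \<bar>X m \<omega> * H m \<omega> u - X m \<omega> * H m \<omega> v\<bar> \<le> \<eta>)))"
    using c A(1) by (intro exI[of _ c] exI[of _ "A * B"]) simp
qed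

lemma tight_process_diff:
  fixes H H' :: "nat \<Rightarrow> 'a \<Rightarrow> 'u \<Rightarrow> real"
  assumes "tight_process H" "tight_process H'"
  shows "tight_process (\<lambda>m \<omega> u. H m \<omega> u - H' m \<omega> u)"
  unfolding tight_process_def
proof safe
  fix \<eta> :: real assume "\<eta> > 0"
  then have \<eta>: "\<eta> / 2 > 0" by simp
  obtain c :: "'u \<Rightarrow> nat" and B where c: "finite (range c)" "0 < B" and
    ev: "\<forall>\<^sub>F m in sequentially. likely (\<eta>/2) (\<lambda>\<omega>. (\<forall>u. \<bar>H m \<omega> u\<bar> \<le> B) \<and>
        (\<forall>u v. c u = c v \<longrightarrow> \<bar>H m \<omega> u - H m \<omega> v\<bar> \<le> \<eta> / 2))"
    by (rule tight_processE[OF assms(1) \<eta> \<eta>])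
  obtain c' :: "'u \<Rightarrow> nat" and B' where c': "finite (range c')" "0 < B'" and
    ev': "\<forall>\<^sub>F m in sequentially. likely (\<eta>/2) (\<lambda>\<omega>. (\<forall>u. \<bar>H' m \<omega> u\<bar> \<le> B') \<and>
        (\<forall>u v. c' u = c' v \<longrightarrow> \<bar>H' m \<omega> u - H' m \<omega> v\<bar> \<le> \<eta> / 2))"
    by (rule tight_processE[OF assms(2) \<eta> \<eta>])
  \<comment> \<open>Pairing the cell numbers encodes the common refinement of the two
    partitions.\<close>
  define d where "d u = prod_encode (c u, c' u)" for u
  have "range d \<subseteq> prod_encode ` (range c \<times> range c')" by (auto simp: d_def)
  then have "finite (range d)" using c(1) c'(1) by (meson finite_SigmaI finite_imageI finite_subset)
  have d: "c u = c v" "c' u = c' v" if "d u = d v" for u v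
    using that by (auto simp: d_def)
  have "\<forall>\<^sub>F m in sequentially. likely \<eta> (\<lambda>\<omega>. (\<forall>u. \<bar>H m \<omega> u - H' m \<omega> u\<bar> \<le> B + B') \<and>
        (\<forall>u v. d u = d v \<longrightarrow> \<bar>(H m \<omega> u - H' m \<omega> u) - (H m \<omega> v - H' m \<omega> v)\<bar> \<le> \<eta>))"
    using ev ev'
  proof eventually_elim
    case (elim m)
    show ?case
    proof (rule likely_mono[OF likely_conj[OF elim]])
      fix \<omega>
      assume *: "((\<forall>u. \<bar>H m \<omega> u\<bar> \<le> B) \<and>
          (\<forall>u v. c u = c v \<longrightarrow> \<bar>H m \<omega> u - H m \<omega> v\<bar> \<le> \<eta> / 2)) \<and> (\<forall>u. \<bar>H' m \<omega> u\<bar> \<le> B') \<and>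
          (\<forall>u v. c' u = c' v \<longrightarrow> \<bar>H' m \<omega> u - H' m \<omega> v\<bar> \<le> \<eta> / 2)"
      have "\<bar>H m \<omega> u - H' m \<omega> u\<bar> \<le> B + B'" for u
        using *[THEN conjunct1, THEN conjunct1, rule_format, of u]
          *[THEN conjunct2, THEN conjunct1, rule_format, of u] by linarith
      moreover have "\<bar>(H m \<omega> u - H' m \<omega> u) - (H m \<omega> v - H' m \<omega> v)\<bar> \<le> \<eta>" if "d u = d v" for u v
      proof -
        have "\<bar>H m \<omega> u - H m \<omega> v\<bar> \<le> \<eta> / 2" "\<bar>H' m \<omega> u - H' m \<omega> v\<bar> \<le> \<eta> / 2"
          using * d[OF that] by blast+
        then show ?thesis by linarith
      qed
      ultimately show "(\<forall>u. \<bar>H m \<omega> u - H' m \<omega> u\<bar> \<le> B + B') \<and>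
        (\<forall>u v. d u = d v \<longrightarrow> \<bar>(H m \<omega> u - H' m \<omega> u) - (H m \<omega> v - H' m \<omega> v)\<bar> \<le> \<eta>)" by blast
    qed simp
  qed
  then show "\<exists>(c::'u \<Rightarrow> nat) B. finite (range c) \<and> 0 < B \<and>
     (\<forall>\<^sub>F m in sequentially. likely \<eta> (\<lambda>\<omega>. (\<forall>u. \<bar>H m \<omega> u - H' m \<omega> u\<bar> \<le> B) \<and>
        (\<forall>u v. c u = c v \<longrightarrow> \<bar>(H m \<omega> u - H' m \<omega> u) - (H m \<omega> v - H' m \<omega> v)\<bar> \<le> \<eta>)))"
    using \<open>finite (range d)\<close> c c' by (intro exI[of _ d] exI[of _ "B + B'"]) simp
qed

end

text \<open>An Arzela-Ascoli argument in which finite partitions replace equicontinuity. The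
  oscillation bound for the \<open>n\<close>-th partition is asked only from the \<open>n\<close>-th
  function on, which is all that a choice controlling finitely many partitions at a time can offer.
  Convergence at one representative per cell, over all partitions, is a countable demand, so a
  diagonal subsequence meets it.\<close>

lemma uniformly_convergent_subsequence:
  fixes h :: "nat \<Rightarrow> 'u \<Rightarrow> real" and c :: "nat \<Rightarrow> 'u \<Rightarrow> nat"
  assumes fin: "\<And>n. finite (range (c n))"
    and bd: "\<And>j u. \<bar>h j u\<bar> \<le> B"
    and osc: "\<And>j n u v. n \<le> j \<Longrightarrow> c n u = c n v \<Longrightarrow> \<bar>h j u - h j v\<bar> \<le> a n"
    and a: "a \<longlonglongrightarrow> 0"
  obtains r l where "strict_mono (r :: nat \<Rightarrow> nat)" "uniform_limit UNIV (\<lambda>j. h (r j)) l sequentially"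
proof -
  define \<rho> where "\<rho> n u = (SOME v. c n v = c n u)" for n u
  have \<rho>: "c n (\<rho> n u) = c n u" for n u unfolding \<rho>_def by (rule someI) simp
  have "range (\<rho> n) \<subseteq> (\<lambda>i. SOME v. c n v = i) ` range (c n)" for n
    by (auto simp: \<rho>_def)
  from finite_subset[OF this finite_imageI[OF fin]] have fin\<rho>: "finite (range (\<rho> n))" for n .
  have "countable (\<Union>n. range (\<rho> n))"
  proof (rule countable_UN)
    show "countable (range (\<rho> n))" for n using fin\<rho> by (rule countable_finite)
  qed simp
  then obtain r where r: "strict_mono r"
    and conv: "\<And>x. x \<in> (\<Union>n. range (\<rho> n)) \<Longrightarrow> \<exists>l. (\<lambda>j. h (r j) x) \<longlonglongrightarrow> l"
    using function_convergent_subsequence[of "\<Union>n. range (\<rho> n)" h B] bd by auto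
  have "uniformly_Cauchy_on UNIV (\<lambda>j. h (r j))"
  proof (rule uniformly_Cauchy_onI)
    fix e :: real assume "e > 0"
    then have e3: "e / 3 > 0" by simp
    obtain n where "dist (a n) 0 < e / 3"
      using tendstoD[OF a e3] unfolding eventually_sequentially by blast
    then have n: "a n < e / 3" by (simp add: dist_real_def)
    have "\<forall>x\<in>range (\<rho> n). \<exists>N. \<forall>i\<ge>N. \<forall>j\<ge>N. dist (h (r i) x) (h (r j) x) < e / 3"
    proof
      fix x assume "x \<in> range (\<rho> n)"
      then have "Cauchy (\<lambda>j. h (r j) x)" using conv[of x] LIMSEQ_imp_Cauchy by blast
      from metric_CauchyD[OF this e3] show "\<exists>N. \<forall>i\<ge>N. \<forall>j\<ge>N. dist (h (r i) x) (h (r j) x) < e / 3"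
        by blast
    qed
    then obtain N where N: "\<And>x i j. x \<in> range (\<rho> n) \<Longrightarrow> N x \<le> i \<Longrightarrow> N x \<le> j \<Longrightarrow>
        dist (h (r i) x) (h (r j) x) < e / 3" by metis
    define K where "K = max n (Max (N ` range (\<rho> n)))"
    have K: "n \<le> K" "\<And>u. N (\<rho> n u) \<le> K"
      using fin\<rho>[of n] by (auto simp: K_def intro!: max.coboundedI2)
    have "dist (h (r i) u) (h (r j) u) < e" if "K \<le> i" "K \<le> j" for u i j
    proof -
      \<comment> \<open>A subsequence index is at least its position, so the bound for partition
        \<open>n\<close> is available at both \<open>r i\<close> and \<open>r j\<close>.\<close>
      have "i \<le> r i" "j \<le> r j" using r by (auto intro: seq_suble)
      then have "n \<le> r i" "n \<le> r j" using that K(1) by linarith+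
      then have "\<bar>h (r i) u - h (r i) (\<rho> n u)\<bar> \<le> a n" "\<bar>h (r j) u - h (r j) (\<rho> n u)\<bar> \<le> a n"
        using osc \<rho> by metis+
      moreover have "dist (h (r i) (\<rho> n u)) (h (r j) (\<rho> n u)) < e / 3"
        using that K(2)[of u] by (intro N) auto
      ultimately show ?thesis using n unfolding dist_real_def by linarith
    qed
    then show "\<exists>M. \<forall>x\<in>UNIV. \<forall>i\<ge>M. \<forall>j\<ge>M. dist (h (r i) x) (h (r j) x) < e" by blast
  qed
  then obtain l where "uniform_limit UNIV (\<lambda>j. h (r j)) l sequentially"
    using Cauchy_uniformly_convergent unfolding uniformly_convergent_on_def by blast
  then show thesis using that r by blast
qed

section \<open>The Hadamard derivative as a bounded linear functional\<close>

lemma hadamard_derivative_linear: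
  assumes "has_hadamard_derivative \<Phi> D F" "bounded (range h)" "bounded (range k)"
  shows "D (\<lambda>u. a * h u + b * k u) = a * D h + b * D k"
  by (rule assms(1)[unfolded has_hadamard_derivative_def, THEN conjunct2, THEN conjunct1,
      rule_format, OF assms(2,3)])

text \<open>Any pointwise bound replaces the supremum, so later estimates involve no suprema; the
  constant is made strictly positive because it is divided by.\<close>

lemma hadamard_derivative_bound:
  assumes "has_hadamard_derivative \<Phi> D F"
  obtains K where "K > 0" "\<And>h b. (\<And>u. \<bar>h u\<bar> \<le> b) \<Longrightarrow> \<bar>D h\<bar> \<le> K * b"
proof -
  obtain K where K: "\<And>h. bounded (range h) \<Longrightarrow> \<bar>D h\<bar> \<le> K * (SUP u. \<bar>h u\<bar>)"
    using assms[unfolded has_hadamard_derivative_def, THEN conjunct2, THEN conjunct2, THEN conjunct1]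
    by blast
  have "\<bar>D h\<bar> \<le> (\<bar>K\<bar> + 1) * b" if h: "\<And>u. \<bar>h u\<bar> \<le> b" for h b
  proof -
    have "bounded (range h)" using h by (auto simp: bounded_iff intro!: exI[of _ b])
    then have "\<bar>D h\<bar> \<le> K * (SUP u. \<bar>h u\<bar>)" by (rule K)
    moreover have "(SUP u. \<bar>h u\<bar>) \<le> b" using h by (intro cSUP_least) auto
    moreover have "bdd_above (range (\<lambda>u. \<bar>h u\<bar>))" by (rule bdd_aboveI2) (rule h)
    then have "0 \<le> (SUP u. \<bar>h u\<bar>)" by (rule cSUP_upper2[of _ _ undefined]) auto
    moreover from this have "K * (SUP u. \<bar>h u\<bar>) \<le> \<bar>K\<bar> * (SUP u. \<bar>h u\<bar>)"
      by (intro mult_right_mono) auto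
    ultimately have "\<bar>D h\<bar> \<le> \<bar>K\<bar> * b"
      by (meson abs_ge_zero mult_left_mono order_trans)
    moreover have "0 \<le> b" using h[of undefined] by simp
    ultimately show ?thesis by (simp add: algebra_simps)
  qed
  then show thesis by (intro that[of "\<bar>K\<bar> + 1"]) auto
qed

lemma hadamard_derivative_continuous:
  assumes D: "has_hadamard_derivative \<Phi> D F"
    and l: "uniform_limit UNIV h l sequentially" and b: "bounded (range l)"
    and bh: "\<And>j. bounded (range (h j))"
  shows "(\<lambda>j. D (h j)) \<longlonglongrightarrow> D l"
proof (rule tendstoI)
  fix e :: real assume "e > 0"
  obtain K where K: "K > 0" "\<And>h b. (\<And>u. \<bar>h u\<bar> \<le> b) \<Longrightarrow> \<bar>D h\<bar> \<le> K * b"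
    using hadamard_derivative_bound[OF D] by blast
  have "e / (2 * K) > 0" using \<open>e > 0\<close> K by simp
  from uniform_limitD[OF l this]
  show "\<forall>\<^sub>F j in sequentially. dist (D (h j)) (D l) < e"
  proof eventually_elim
    case (elim j)
    have "D (\<lambda>u. 1 * h j u + (-1) * l u) = 1 * D (h j) + (-1) * D l"
      by (rule hadamard_derivative_linear[OF D bh b])
    moreover have "\<bar>D (\<lambda>u. 1 * h j u + (-1) * l u)\<bar> \<le> K * (e / (2 * K))"
      using elim by (intro K(2)) (auto simp: dist_real_def less_imp_le)
    moreover have "K * (e / (2 * K)) < e" using K(1) \<open>e > 0\<close> by simp
    ultimately show ?case by (simp add: dist_real_def)
  qed
qed

context prob_space
begin

text \<open>If the expansion failed, one could pick a sample point for each of infinitely many sample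
  sizes so that the picked paths are totally bounded; a uniformly convergent subsequence
  contradicts differentiability along its limit.\<close>

theorem functional_delta_method:
  fixes H :: "nat \<Rightarrow> 'a \<Rightarrow> 'd::finite dfun"
  assumes D: "has_hadamard_derivative \<Phi> D F"
    and tight: "tight_process H"
    and cdf: "whp (\<lambda>m \<omega>. is_cdf (\<lambda>u. F u + H m \<omega> u / sqrt m))"
  shows "small_op (\<lambda>m \<omega>. sqrt m * (\<Phi> (\<lambda>u. F u + H m \<omega> u / sqrt m) - \<Phi> F) - D (H m \<omega>))"
proof (rule ccontr)
  define R where "R m \<omega> = sqrt m * (\<Phi> (\<lambda>u. F u + H m \<omega> u / sqrt m) - \<Phi> F) - D (H m \<omega>)" for m \<omega>
  assume "\<not> ?thesis"
  then obtain e \<eta> where "e > 0" "\<eta> > 0"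
    and bad: "\<not> (\<forall>\<^sub>F m in sequentially. likely \<eta> (\<lambda>\<omega>. \<bar>R m \<omega>\<bar> \<le> e))"
    unfolding small_op_def whp_def R_def by blast
  \<comment> \<open>\<open>a n\<close> serves both as oscillation tolerance and as failure
    probability of the \<open>n\<close>-th partition. The factor \<open>\<eta> / 4\<close> makes the
    failure probabilities sum to at most \<open>\<eta> / 2\<close>, leaving
    \<open>\<eta> / 2\<close> for the event that the perturbed function is not a distribution
    function.\<close>
  define a where "a n = \<eta> / 4 * (1/2) ^ n" for n :: nat
  have a: "a n > 0" for n using \<open>\<eta> > 0\<close> by (simp add: a_def)
  define T where "T n c b \<longleftrightarrow> finite (range c) \<and>
     (\<forall>\<^sub>F m in sequentially. likely (a n) (\<lambda>\<omega>. (\<forall>u. \<bar>H m \<omega> u\<bar> \<le> b) \<and>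
        (\<forall>u v. c u = c v \<longrightarrow> \<bar>H m \<omega> u - H m \<omega> v\<bar> \<le> a n)))"
    for n b and c :: "(real^'d) \<times> real \<Rightarrow> nat"
  have "\<exists>c b. T n c b" for n
    using tight a[of n] unfolding tight_process_def T_def by blast
  then obtain c B where cB: "\<And>n. T n (c n) (B n)" by metis
  have c: "finite (range (c n))" for n using cB by (simp add: T_def)
  have ev: "\<forall>\<^sub>F m in sequentially. likely (a n) (\<lambda>\<omega>. (\<forall>u. \<bar>H m \<omega> u\<bar> \<le> B n) \<and>
        (\<forall>u v. c n u = c n v \<longrightarrow> \<bar>H m \<omega> u - H m \<omega> v\<bar> \<le> a n))" for n
    using cB by (simp add: T_def)
  \<comment> \<open>A path on which the expansion fails although it obeys the first \<open>j\<close>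
    partitions. Only finitely many partitions can be controlled at one \<open>m\<close>, because
    each holds from its own threshold on.\<close>
  define P where "P j m \<omega> \<longleftrightarrow> \<bar>R m \<omega>\<bar> > e \<and> is_cdf (\<lambda>u. F u + H m \<omega> u / sqrt m) \<and>
      (\<forall>n\<le>j. (\<forall>u. \<bar>H m \<omega> u\<bar> \<le> B n) \<and> (\<forall>u v. c n u = c n v \<longrightarrow> \<bar>H m \<omega> u - H m \<omega> v\<bar> \<le> a n))"
    for j m \<omega>
  have "\<exists>m>j. \<exists>\<omega>. P j m \<omega>" for j
  proof -
    have "\<forall>\<^sub>F m in sequentially. \<forall>n\<in>{..j}. likely (a n) (\<lambda>\<omega>. (\<forall>u. \<bar>H m \<omega> u\<bar> \<le> B n) \<and>
        (\<forall>u v. c n u = c n v \<longrightarrow> \<bar>H m \<omega> u - H m \<omega> v\<bar> \<le> a n))"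
      using ev by (intro eventually_ball_finite) auto
    moreover have "\<forall>\<^sub>F m in sequentially. likely (\<eta> / 2) (\<lambda>\<omega>. is_cdf (\<lambda>u. F u + H m \<omega> u / sqrt m))"
      using whpD[OF cdf, of "\<eta>/2"] \<open>\<eta> > 0\<close> by simp
    moreover note eventually_gt_at_top[of j]
    ultimately have rest: "\<forall>\<^sub>F m in sequentially. j < m \<and>
       likely (\<eta> / 2) (\<lambda>\<omega>. is_cdf (\<lambda>u. F u + H m \<omega> u / sqrt m)) \<and>
       (\<forall>n\<in>{..j}. likely (a n) (\<lambda>\<omega>. (\<forall>u. \<bar>H m \<omega> u\<bar> \<le> B n) \<and>
        (\<forall>u v. c n u = c n v \<longrightarrow> \<bar>H m \<omega> u - H m \<omega> v\<bar> \<le> a n)))"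
      by eventually_elim blast
    obtain m where m: "\<not> likely \<eta> (\<lambda>\<omega>. \<bar>R m \<omega>\<bar> \<le> e)" "j < m"
       "likely (\<eta> / 2) (\<lambda>\<omega>. is_cdf (\<lambda>u. F u + H m \<omega> u / sqrt m))"
       "\<And>n. n \<le> j \<Longrightarrow> likely (a n) (\<lambda>\<omega>. (\<forall>u. \<bar>H m \<omega> u\<bar> \<le> B n) \<and>
        (\<forall>u v. c n u = c n v \<longrightarrow> \<bar>H m \<omega> u - H m \<omega> v\<bar> \<le> a n))"
    \<comment> \<open>An eventual property that fails does so at arbitrarily large \<open>m\<close>,
      hence at one where all the eventual conditions of \<open>rest\<close> hold.\<close>
    proof (rule ccontr)
      assume "\<not> thesis"
      then have "\<forall>\<^sub>F m in sequentially. likely \<eta> (\<lambda>\<omega>. \<bar>R m \<omega>\<bar> \<le> e)"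
        by (intro eventually_mono[OF rest]) (use that in \<open>meson atMost_iff\<close>)
      then show False using bad by simp
    qed
    have "likely (\<eta> / 2 + (\<Sum>n\<le>j. a n)) (\<lambda>\<omega>. is_cdf (\<lambda>u. F u + H m \<omega> u / sqrt m) \<and>
       (\<forall>n\<le>j. (\<forall>u. \<bar>H m \<omega> u\<bar> \<le> B n) \<and> (\<forall>u v. c n u = c n v \<longrightarrow> \<bar>H m \<omega> u - H m \<omega> v\<bar> \<le> a n)))"
      by (intro likely_conj m likely_finite_conj)
    moreover have "(\<Sum>n\<le>j. a n) \<le> \<eta> / 2"
    proof -
      have "(\<Sum>n\<le>j. a n) = \<eta> / 4 * (\<Sum>n<Suc j. (1/2) ^ n)"
        by (simp only: a_def sum_distrib_left lessThan_Suc_atMost)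
      also have "(\<Sum>n<Suc j. (1/2) ^ n) \<le> (2::real)"
        by (subst sum_gp_strict) (simp add: field_simps)
      finally show ?thesis using \<open>\<eta> > 0\<close> by simp
    qed
    ultimately have *: "likely \<eta> (\<lambda>\<omega>. is_cdf (\<lambda>u. F u + H m \<omega> u / sqrt m) \<and>
       (\<forall>n\<le>j. (\<forall>u. \<bar>H m \<omega> u\<bar> \<le> B n) \<and> (\<forall>u v. c n u = c n v \<longrightarrow> \<bar>H m \<omega> u - H m \<omega> v\<bar> \<le> a n)))"
      by (elim likely_mono) auto
    have "\<exists>\<omega>. P j m \<omega>"
    proof (rule ccontr)
      \<comment> \<open>Otherwise the remainder would be small on the whole event of
        \<open>*\<close>, whose probability is large enough to contradict the choice of
        \<open>m\<close>.\<close>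
      assume "\<nexists>\<omega>. P j m \<omega>"
      then have "likely \<eta> (\<lambda>\<omega>. \<bar>R m \<omega>\<bar> \<le> e)"
        by (intro likely_mono[OF *]) (auto simp: P_def not_less)
      then show False using m(1) by simp
    qed
    then show ?thesis using m(2) by blast
  qed
  then obtain m \<omega> where m: "\<And>j. j < m j" and P: "\<And>j. P j (m j) (\<omega> j)" by metis
  define h where "h j = H (m j) (\<omega> j)" for j
  have bd: "\<bar>h j u\<bar> \<le> B 0" for j u using P[of j] le0[of j] unfolding P_def h_def by blast
  have osc: "\<bar>h j u - h j v\<bar> \<le> a n" if "n \<le> j" "c n u = c n v" for j n u v
    using P[of j] that unfolding P_def h_def by blast
  have "a \<longlonglongrightarrow> 0" unfolding a_def by (intro tendsto_mult_right_zero LIMSEQ_realpow_zero) auto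
  obtain r l where r: "strict_mono r" and l: "uniform_limit UNIV (\<lambda>j. h (r j)) l sequentially"
    by (rule uniformly_convergent_subsequence[of c h "B 0" a, OF c bd osc \<open>a \<longlonglongrightarrow> 0\<close>])
  define t where "t j = 1 / sqrt (m (r j))" for j
  have mpos: "m j > 0" for j using m[of j] by simp
  have "\<bar>l u\<bar> \<le> B 0" for u
  proof -
    have "(\<lambda>j. h (r j) u) \<longlonglongrightarrow> l u" using tendsto_uniform_limitI[OF l] by simp
    from tendsto_rabs[OF this] show ?thesis by (rule LIMSEQ_le_const2) (use bd in blast)
  qed
  then have bl: "bounded (range l)" by (auto simp: bounded_iff intro!: exI[of _ "B 0"])
  have bh: "bounded (range (h j))" for j using bd by (auto simp: bounded_iff intro!: exI[of _ "B 0"])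
  have "t \<longlonglongrightarrow> 0"
  proof -
    have "filterlim (\<lambda>j. m (r j)) at_top sequentially"
    proof (rule filterlim_at_top_mono[OF filterlim_ident])
      show "\<forall>\<^sub>F j in sequentially. j \<le> m (r j)"
        by (intro always_eventually allI less_imp_le le_less_trans[OF seq_suble[OF r] m])
    qed
    then have "filterlim (\<lambda>j. sqrt (m (r j))) at_top sequentially"
      by (intro filterlim_compose[OF sqrt_at_top] filterlim_compose[OF filterlim_real_sequentially])
    then show ?thesis unfolding t_def by (intro tendsto_divide_0[OF tendsto_const])
      (rule filterlim_at_top_imp_at_infinity)
  qed
  moreover have "0 < t j" for j using mpos by (simp add: t_def)
  moreover have "is_cdf (\<lambda>u. F u + t j * h (r j) u)" for j
    using P[of "r j"] by (simp add: P_def h_def t_def)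
  ultimately have lim: "(\<lambda>j. (\<Phi> (\<lambda>u. F u + t j * h (r j) u) - \<Phi> F) / t j) \<longlonglongrightarrow> D l"
    using D bl l unfolding has_hadamard_derivative_def by blast
  \<comment> \<open>The difference quotients tend to \<open>D l\<close> by Hadamard
    differentiability and \<open>D (h (r j))\<close> does so by continuity of \<open>D\<close>;
    hence a remainder that was chosen to exceed \<open>e\<close> tends to 0.\<close>
  have "(\<lambda>j. (\<Phi> (\<lambda>u. F u + t j * h (r j) u) - \<Phi> F) / t j - D (h (r j))) \<longlonglongrightarrow> D l - D l"
    by (rule tendsto_diff[OF lim hadamard_derivative_continuous[OF D l bl bh]])
  moreover have "(\<Phi> (\<lambda>u. F u + t j * h (r j) u) - \<Phi> F) / t j - D (h (r j)) = R (m (r j)) (\<omega> (r j))" for j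
    by (simp add: R_def h_def t_def mult.commute)
  ultimately have "(\<lambda>j. R (m (r j)) (\<omega> (r j))) \<longlonglongrightarrow> 0" by simp
  from tendstoD[OF this \<open>e > 0\<close>] obtain j where "\<bar>R (m (r j)) (\<omega> (r j))\<bar> < e"
    by (auto simp: eventually_sequentially)
  then show False using P[of "r j"] by (simp add: P_def)
qed

end

section \<open>The empirical process of an i.i.d. sample\<close>

locale iid_sample = prob_space M for M :: "'w measure" +
  fixes Q :: "'b measure" and Z :: "nat \<Rightarrow> 'w \<Rightarrow> 'b"
  assumes indep_Z: "indep_vars (\<lambda>_. Q) Z UNIV"
    and distr_Z: "\<And>i. distr M Q (Z i) = Q"
begin

lemma measurable_Z [measurable]: "Z i \<in> measurable M Q"
  using indep_Z by (simp add: indep_vars_def2)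

sublocale Q: prob_space Q
  using prob_space_distr[OF measurable_Z[of 0]] distr_Z[of 0] by simp

lemma AE_sample: "AE z in Q. P z \<Longrightarrow> AE \<omega> in M. P (Z i \<omega>)"
  using AE_distrD[OF measurable_Z[of i], of P] by (simp only: distr_Z)

definition emp :: "nat \<Rightarrow> ('b \<Rightarrow> real) \<Rightarrow> 'w \<Rightarrow> real" where
  "emp m g \<omega> = (\<Sum>i<m. g (Z i \<omega>) - (\<integral>z. g z \<partial>Q)) / sqrt m"

lemma measurable_emp [measurable (raw)]:
  assumes [measurable]: "g \<in> borel_measurable Q"
  shows "emp m g \<in> borel_measurable M"
  unfolding emp_def[abs_def] by measurable

lemma emp_add:
  assumes "integrable Q g" "integrable Q h"
  shows "emp m (\<lambda>z. g z + h z) \<omega> = emp m g \<omega> + emp m h \<omega>"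
  using assms by (simp add: emp_def sum.distrib sum_subtractf add_divide_distrib diff_divide_distrib
      algebra_simps)

lemma emp_diff:
  assumes "integrable Q g" "integrable Q h"
  shows "emp m (\<lambda>z. g z - h z) \<omega> = emp m g \<omega> - emp m h \<omega>"
  using assms by (simp add: emp_def sum.distrib sum_subtractf add_divide_distrib diff_divide_distrib
      algebra_simps)

lemma emp_cmult: "emp m (\<lambda>z. c * g z) \<omega> = c * emp m g \<omega>"
  by (simp add: emp_def sum_distrib_left flip: right_diff_distrib)

lemma emp_const: "emp m (\<lambda>_. c) \<omega> = 0"
  by (simp add: emp_def Q.prob_space)

lemma emp_AE_cong:
  assumes "AE z in Q. g z = h z" "g \<in> borel_measurable Q" "h \<in> borel_measurable Q"
  shows "AE \<omega> in M. emp m g \<omega> = emp m h \<omega>"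
proof -
  have "AE \<omega> in M. \<forall>i. g (Z i \<omega>) = h (Z i \<omega>)"
    using AE_sample[OF assms(1)] by (simp add: AE_all_countable)
  moreover have eq: "(\<integral>z. g z \<partial>Q) = (\<integral>z. h z \<partial>Q)" by (rule integral_cong_AE) (use assms in auto)
  ultimately show ?thesis unfolding emp_def eq by (elim eventually_mono) simp
qed

lemma integrable_bounded:
  "h \<in> borel_measurable Q \<Longrightarrow> (\<And>z. \<bar>h z\<bar> \<le> b) \<Longrightarrow> integrable Q (h :: 'b \<Rightarrow> real)"
  by (rule Q.integrable_const_bound[where B = b]) auto

text \<open>The moment generating function bound behind the Bernstein-type inequality. For
  \<open>s\<close> at most 1 the exponent stays in [-1, 1], where \<open>exp x\<close> is at most
  \<open>1 + x + x\<^sup>2\<close>; the linear term integrates to zero, so only the second moment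
  remains and a small variance is rewarded.\<close>

lemma integral_exp_le:
  fixes h :: "'b \<Rightarrow> real"
  assumes [measurable]: "h \<in> borel_measurable Q" and h: "\<And>z. \<bar>h z\<bar> \<le> 1"
    and mean: "(\<integral>z. h z \<partial>Q) = 0" and var: "(\<integral>z. (h z)\<^sup>2 \<partial>Q) \<le> v" and s: "0 \<le> s" "s \<le> 1"
  shows "(\<integral>z. exp (s * h z) \<partial>Q) \<le> exp (s\<^sup>2 * v)"
proof -
  have exp_le: "exp x \<le> 1 + x + x\<^sup>2" if "\<bar>x\<bar> \<le> 1" for x :: real
  proof (cases "0 \<le> x")
    case True
    then show ?thesis using that exp_bound[of x] by simp
  next
    case False
    define y where "y = - x"
    have y: "0 < y" "y \<le> 1" using False that by (auto simp: y_def)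
    have "exp (- y) = 1 / exp y" by (simp add: exp_minus inverse_eq_divide)
    also have "\<dots> \<le> 1 / (1 + y)" using y exp_ge_add_one_self[of y] by (intro divide_left_mono) auto
    also have "\<dots> \<le> 1 - y + y\<^sup>2"
    proof -
      have "(1 - y + y\<^sup>2) * (1 + y) = 1 + y ^ 3" by algebra
      then have "1 \<le> (1 - y + y\<^sup>2) * (1 + y)" using y by simp
      then show ?thesis using y by (simp add: divide_le_eq)
    qed
    finally show ?thesis by (simp add: y_def)
  qed
  have sh: "\<bar>s * h z\<bar> \<le> 1" for z
    unfolding abs_mult using s h[of z] mult_mono[of s 1 "\<bar>h z\<bar>" 1] by simp
  have h2: "\<bar>(h z)\<^sup>2\<bar> \<le> 1" for z using h[of z] by (simp add: abs_square_le_1)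
  have i1: "integrable Q h" by (rule integrable_bounded[OF _ h]) simp
  have i2: "integrable Q (\<lambda>z. (h z)\<^sup>2)" by (rule integrable_bounded[OF _ h2]) simp
  have ie: "integrable Q (\<lambda>z. exp (s * h z))"
  proof (rule integrable_bounded)
    show "\<bar>exp (s * h z)\<bar> \<le> exp 1" for z using sh[of z] by simp
  qed simp
  have "(\<integral>z. exp (s * h z) \<partial>Q) \<le> (\<integral>z. 1 + s * h z + s\<^sup>2 * (h z)\<^sup>2 \<partial>Q)"
    using exp_le[OF sh] by (intro integral_mono) (auto simp: i1 i2 ie power_mult_distrib)
  also have "\<dots> = 1 + s\<^sup>2 * (\<integral>z. (h z)\<^sup>2 \<partial>Q)" using i1 i2 by (simp add: mean Q.prob_space)
  also have "\<dots> \<le> 1 + s\<^sup>2 * v" using var by (intro add_left_mono mult_left_mono) auto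
  also have "\<dots> \<le> exp (s\<^sup>2 * v)" by (rule exp_ge_add_one_self)
  finally show ?thesis .
qed

text \<open>Chernoff's method: the exponential Markov inequality, with independence turning the
  expectation of a product into a product of moment generating functions. The parameter
  \<open>s\<close> stays free to be optimised later.\<close>

lemma prob_sum_ge:
  assumes [measurable]: "h \<in> borel_measurable Q" and h: "\<And>z. \<bar>h z\<bar> \<le> 1"
    and mean: "(\<integral>z. h z \<partial>Q) = 0" and var: "(\<integral>z. (h z)\<^sup>2 \<partial>Q) \<le> v" and s: "0 \<le> s" "s \<le> 1"
  shows "prob {\<omega>\<in>space M. a \<le> (\<Sum>i<m. h (Z i \<omega>))} \<le> exp (m * (s\<^sup>2 * v) - s * a)"
proof -
  have iv: "indep_vars (\<lambda>_. borel) (\<lambda>i \<omega>. exp (s * h (Z i \<omega>))) {..<m}"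
    by (rule indep_vars_compose2[OF indep_vars_subset[OF indep_Z subset_UNIV],
        of _ "\<lambda>_ z. exp (s * h z)"]) simp
  have sh: "s * h z \<le> 1" for z
    using mult_mono[of s 1 "h z" 1] s h[of z] by (cases "0 \<le> h z") (auto intro: order_trans[OF mult_nonneg_nonpos])
  have int: "integrable M (\<lambda>\<omega>. exp (s * h (Z i \<omega>)))" for i
    by (rule integrable_const_bound[where B = "exp 1"]) (auto simp: sh)
  have "{\<omega>\<in>space M. a \<le> (\<Sum>i<m. h (Z i \<omega>))} \<subseteq>
      {\<omega>\<in>space M. exp (s * a) \<le> (\<Prod>i<m. exp (s * h (Z i \<omega>)))}"
    using s by (auto simp flip: exp_sum sum_distrib_left intro: mult_left_mono)
  then have "prob {\<omega>\<in>space M. a \<le> (\<Sum>i<m. h (Z i \<omega>))}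
      \<le> prob {\<omega>\<in>space M. exp (s * a) \<le> (\<Prod>i<m. exp (s * h (Z i \<omega>)))}"
    by (rule finite_measure_mono) measurable
  also have "\<dots> \<le> expectation (\<lambda>\<omega>. \<Prod>i<m. exp (s * h (Z i \<omega>))) / exp (s * a)"
    by (rule integral_Markov_inequality_measure[where A = "space M"])
       (auto intro!: indep_vars_integrable iv int prod_nonneg)
  also have "expectation (\<lambda>\<omega>. \<Prod>i<m. exp (s * h (Z i \<omega>)))
      = (\<Prod>i<m. expectation (\<lambda>\<omega>. exp (s * h (Z i \<omega>))))"
    by (rule indep_vars_lebesgue_integral) (auto intro: iv int)
  also have "\<dots> = (\<Prod>i<m. \<integral>z. exp (s * h z) \<partial>Q)"
  proof (rule prod.cong)
    fix i
    show "expectation (\<lambda>\<omega>. exp (s * h (Z i \<omega>))) = (\<integral>z. exp (s * h z) \<partial>Q)"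
      using integral_distr[OF measurable_Z[of i], of "\<lambda>z. exp (s * h z)"] by (simp add: distr_Z)
  qed simp
  also have "\<dots> \<le> (\<Prod>i<m. exp (s\<^sup>2 * v))"
    by (intro prod_mono conjI integral_exp_le assms) auto
  also have "\<dots> = exp (m * (s\<^sup>2 * v))" by (simp add: exp_of_nat_mult)
  finally show ?thesis by (simp add: exp_diff divide_right_mono)
qed

text \<open>For a function with values in [0, 1] the variance is at most the mean, so indicators of
  small sets have small variance; this makes fine chaining levels affordable. The side condition on
  \<open>x\<close> keeps the Chernoff parameter at most 1, the range in which the tail is
  Gaussian.\<close>

lemma prob_emp_gt:
  assumes [measurable]: "g \<in> borel_measurable Q" and g: "\<And>z. 0 \<le> g z" "\<And>z. g z \<le> 1"
    and v: "(\<integral>z. g z \<partial>Q) \<le> v" "0 < v" and x: "0 < x" "x \<le> 2 * v * sqrt m"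
  shows "prob {\<omega>\<in>space M. \<bar>emp m g \<omega>\<bar> > x} \<le> 2 * exp (- (x\<^sup>2 / (4 * v)))"
proof -
  define \<mu> where "\<mu> = (\<integral>z. g z \<partial>Q)"
  define h where "h z = g z - \<mu>" for z
  have [measurable]: "h \<in> borel_measurable Q" by (simp add: h_def[abs_def])
  have ig: "integrable Q g" using g by (intro integrable_bounded[where b = 1]) auto
  have \<mu>: "0 \<le> \<mu>" "\<mu> \<le> 1"
    unfolding \<mu>_def using g Q.integral_le_const[OF ig, of 1] by (auto intro!: integral_nonneg)
  have h: "\<bar>h z\<bar> \<le> 1" for z using g[of z] \<mu> by (auto simp: h_def abs_le_iff)
  have mean: "(\<integral>z. h z \<partial>Q) = 0" using ig by (simp add: h_def \<mu>_def Q.prob_space)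
  have var: "(\<integral>z. (h z)\<^sup>2 \<partial>Q) \<le> v"
  proof -
    have g2: "(g z)\<^sup>2 \<le> g z" for z using g[of z] by (simp add: power2_eq_square mult_left_le)
    then have "\<bar>(g z)\<^sup>2\<bar> \<le> 1" for z using g[of z] by (auto simp: power_le_one)
    then have ig2: "integrable Q (\<lambda>z. (g z)\<^sup>2)" by (intro integrable_bounded[where b = 1]) auto
    have "(\<integral>z. (h z)\<^sup>2 \<partial>Q) = (\<integral>z. (g z)\<^sup>2 \<partial>Q) - \<mu>\<^sup>2"
      using Q.variance_eq[OF ig ig2] by (simp add: h_def \<mu>_def)
    also have "\<dots> \<le> (\<integral>z. (g z)\<^sup>2 \<partial>Q)" by simp
    also have "\<dots> \<le> (\<integral>z. g z \<partial>Q)" by (intro integral_mono ig ig2 g2)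
    finally show ?thesis using v by simp
  qed
  have m: "m > 0" using x v by (cases m) auto
  \<comment> \<open>Minimiser of \<open>m * s\<^sup>2 * v - s * x * sqrt m\<close>; the minimum is
    \<open>- x\<^sup>2 / (4 * v)\<close>.\<close>
  define s where "s = x / (2 * v * sqrt m)"
  have s: "0 \<le> s" "s \<le> 1" using x v m by (auto simp: s_def divide_le_eq)
  have ex: "m * (s\<^sup>2 * v) - s * (x * sqrt m) = - (x\<^sup>2 / (4 * v))"
  proof -
    have "m * (s\<^sup>2 * v) = x\<^sup>2 / (4 * v)" using m v
      by (simp add: s_def power_divide power_mult_distrib field_simps power2_eq_square)
    moreover have "s * (x * sqrt m) = x\<^sup>2 / (2 * v)" using m v
      by (simp add: s_def field_simps power2_eq_square)
    ultimately show ?thesis using v by (simp add: field_simps)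
  qed
  have emp_eq: "emp m g \<omega> * sqrt m = (\<Sum>i<m. h (Z i \<omega>))" for \<omega>
    using m by (simp add: emp_def h_def \<mu>_def)
  have "{\<omega>\<in>space M. \<bar>emp m g \<omega>\<bar> > x} \<subseteq> {\<omega>\<in>space M. x * sqrt m \<le> (\<Sum>i<m. h (Z i \<omega>))}
      \<union> {\<omega>\<in>space M. x * sqrt m \<le> (\<Sum>i<m. - h (Z i \<omega>))}"
  proof
    fix \<omega> assume "\<omega> \<in> {\<omega>\<in>space M. \<bar>emp m g \<omega>\<bar> > x}"
    then have \<omega>: "\<omega> \<in> space M" and "x \<le> emp m g \<omega> \<or> x \<le> - emp m g \<omega>" by auto
    then have "x * sqrt m \<le> emp m g \<omega> * sqrt m \<or> x * sqrt m \<le> (- emp m g \<omega>) * sqrt m"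
      using mult_right_mono[of x "emp m g \<omega>" "sqrt m"] mult_right_mono[of x "- emp m g \<omega>" "sqrt m"]
      by auto
    then show "\<omega> \<in> {\<omega>\<in>space M. x * sqrt m \<le> (\<Sum>i<m. h (Z i \<omega>))}
      \<union> {\<omega>\<in>space M. x * sqrt m \<le> (\<Sum>i<m. - h (Z i \<omega>))}"
      using \<omega> emp_eq[of \<omega>] by (auto simp: sum_negf)
  qed
  then have "prob {\<omega>\<in>space M. \<bar>emp m g \<omega>\<bar> > x}
      \<le> prob ({\<omega>\<in>space M. x * sqrt m \<le> (\<Sum>i<m. h (Z i \<omega>))}
          \<union> {\<omega>\<in>space M. x * sqrt m \<le> (\<Sum>i<m. - h (Z i \<omega>))})"
    by (rule finite_measure_mono) measurable
  also have "\<dots> \<le> prob {\<omega>\<in>space M. x * sqrt m \<le> (\<Sum>i<m. h (Z i \<omega>))}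
      + prob {\<omega>\<in>space M. x * sqrt m \<le> (\<Sum>i<m. - h (Z i \<omega>))}"
    by (rule measure_Un_le) measurable
  also have "\<dots> \<le> exp (- (x\<^sup>2 / (4 * v))) + exp (- (x\<^sup>2 / (4 * v)))"
    unfolding ex[symmetric]
    by (intro add_mono prob_sum_ge) (use h mean var s in \<open>auto simp: integral_minus\<close>)
  finally show ?thesis by simp
qed

lemma big_Op_emp:
  assumes [measurable]: "g \<in> borel_measurable Q" and b: "\<And>z. \<bar>g z\<bar> \<le> b"
  shows "big_Op (\<lambda>m. emp m g)"
  unfolding big_Op_def
proof safe
  fix \<eta> :: real assume "\<eta> > 0"
  \<comment> \<open>The \<open>+ 1\<close> keeps the scale positive for \<open>b = 0\<close>; the
    affine map sends [-c, c] to [0, 1], where the tail bound with \<open>v = 1\<close>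
    applies.\<close>
  define c where "c = b + 1"
  have c: "c > 0" using b[of undefined] by (simp add: c_def)
  define h where "h z = (g z + c) / (2 * c)" for z
  have [measurable]: "h \<in> borel_measurable Q" by (simp add: h_def[abs_def])
  have h: "0 \<le> h z" "h z \<le> 1" for z
    using b[of z] c by (auto simp: h_def c_def abs_le_iff divide_le_eq)
  have ih: "integrable Q h" using h by (intro integrable_bounded[where b = 1]) auto
  have "g = (\<lambda>z. 2 * c * h z - c)" using c by (simp add: fun_eq_iff h_def)
  then have g: "emp m g \<omega> = 2 * c * emp m h \<omega>" for m \<omega>
    using emp_diff[of "\<lambda>z. 2 * c * h z" "\<lambda>_. c" m \<omega>] ih by (simp add: emp_cmult emp_const)
  \<comment> \<open>Chosen so that the tail \<open>2 * exp (- (2 / \<eta>))\<close> is at most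
    \<open>\<eta>\<close>, because \<open>exp y\<close> is at least \<open>y\<close>. The condition
    on \<open>m\<close> below puts this \<open>x\<close> in the Gaussian range.\<close>
  define x where "x = 2 * sqrt (2 / \<eta>)"
  have x: "x > 0" "x\<^sup>2 / 4 = 2 / \<eta>" using \<open>\<eta> > 0\<close> by (simp_all add: x_def power_mult_distrib)
  have "2 * exp (- (2 / \<eta>)) \<le> 2 * (1 / (2 / \<eta>))"
  proof -
    have "2 / \<eta> \<le> exp (2 / \<eta>)" using exp_ge_add_one_self[of "2 / \<eta>"] by linarith
    then have "1 / exp (2 / \<eta>) \<le> 1 / (2 / \<eta>)" using \<open>\<eta> > 0\<close> by (intro divide_left_mono) auto
    then show ?thesis by (simp add: exp_minus inverse_eq_divide)
  qed
  then have small: "2 * exp (- (x\<^sup>2 / (4 * 1))) \<le> \<eta>" using x(2) by simp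
  have "\<forall>\<^sub>F m in sequentially. likely \<eta> (\<lambda>\<omega>. \<bar>emp m g \<omega>\<bar> \<le> 2 * c * x)"
    using eventually_ge_at_top[of "nat \<lceil>2 / \<eta>\<rceil>"]
  proof eventually_elim
    case (elim m)
    then have "2 / \<eta> \<le> m" by linarith
    then have "x \<le> 2 * 1 * sqrt m" by (simp add: x_def)
    moreover have "(\<integral>z. h z \<partial>Q) \<le> 1" using h by (intro Q.integral_le_const ih) auto
    ultimately have "prob {\<omega>\<in>space M. \<bar>emp m h \<omega>\<bar> > x} \<le> \<eta>"
      using prob_emp_gt[of h 1 x m] h x(1) small by simp
    moreover have "{\<omega>\<in>space M. \<not> \<bar>emp m h \<omega>\<bar> \<le> x} = {\<omega>\<in>space M. \<bar>emp m h \<omega>\<bar> > x}" by auto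
    ultimately have "likely \<eta> (\<lambda>\<omega>. \<bar>emp m h \<omega>\<bar> \<le> x)" by (intro likely_Collect) auto
    then show ?case
      by (rule likely_mono) (use c in \<open>auto simp: g abs_mult intro!: mult_left_mono\<close>)
  qed
  then show "\<exists>B>0. \<forall>\<^sub>F m in sequentially. likely \<eta> (\<lambda>\<omega>. \<bar>emp m g \<omega>\<bar> \<le> B)"
    using c x(1) by (intro exI[of _ "2 * c * x"]) simp
qed

text \<open>The classical theorem divides by the standard deviation, so its conclusion is rescaled
  through characteristic functions. Zero variance is treated apart: there the sums vanish almost
  surely and the limit is a point mass.\<close>

lemma emp_clt:
  assumes [measurable]: "g \<in> borel_measurable Q" and b: "\<And>z. \<bar>g z\<bar> \<le> b"
  shows "weak_conv_m (\<lambda>m. distr M borel (emp m g)) (normal_law 0 (Q.variance g))"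
proof -
  define \<mu> where "\<mu> = (\<integral>z. g z \<partial>Q)"
  define v where "v = Q.variance g"
  define h where "h z = g z - \<mu>" for z
  have [measurable]: "h \<in> borel_measurable Q" by (simp add: h_def[abs_def])
  have ig: "integrable Q g" by (rule integrable_bounded[OF _ b]) simp
  have hb: "\<bar>h z\<bar> \<le> b + \<bar>\<mu>\<bar>" for z using b[of z] by (simp add: h_def)
  have "\<bar>(h z)\<^sup>2\<bar> \<le> (b + \<bar>\<mu>\<bar>)\<^sup>2" for z using power_mono[OF hb, of z 2] by simp
  then have ih2: "integrable Q (\<lambda>z. (h z)\<^sup>2)" by (intro integrable_bounded) auto
  have mean: "(\<integral>z. h z \<partial>Q) = 0" using ig by (simp add: h_def \<mu>_def Q.prob_space)
  have v: "v = (\<integral>z. (h z)\<^sup>2 \<partial>Q)" by (simp add: v_def h_def \<mu>_def)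
  have emp_h: "emp m g \<omega> = (\<Sum>i<m. h (Z i \<omega>)) / sqrt m" for m \<omega>
    by (simp add: emp_def h_def \<mu>_def)
  show ?thesis
  proof (cases "v = 0")
    case True
    have "AE z in Q. (h z)\<^sup>2 = 0"
      using integral_nonneg_eq_0_iff_AE[OF ih2] True v by simp
    then have "AE z in Q. h z = 0" by simp
    then have "AE \<omega> in M. \<forall>i. h (Z i \<omega>) = 0"
      using AE_sample[of "\<lambda>z. h z = 0"] by (simp add: AE_all_countable)
    then have "distr M borel (emp m g) = distr M borel (\<lambda>_. 0)" for m
      by (intro distr_cong_AE) (auto simp: emp_h)
    then show ?thesis using True
      by (simp add: v_def[symmetric] normal_law_def distr_const weak_conv_m_def weak_conv_def)
  next
    case False
    then have "v > 0" using v by (simp add: less_le)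
    define T where "T m \<omega> = (\<Sum>i<m. h (Z i \<omega>)) / sqrt (real m * (sqrt v)\<^sup>2)" for m \<omega>
    have [measurable]: "T m \<in> borel_measurable M" for m unfolding T_def by measurable
    have eT: "emp m g = (\<lambda>\<omega>. sqrt v * T m \<omega>)" for m
      using \<open>v > 0\<close> by (simp add: fun_eq_iff emp_h T_def real_sqrt_mult)
    have exh: "expectation (\<lambda>\<omega>. k (Z i \<omega>)) = (\<integral>z. k z \<partial>Q)" if "k \<in> borel_measurable Q"
      for i and k :: "'b \<Rightarrow> real"
      using integral_distr[OF measurable_Z[of i] that] by (simp add: distr_Z)
    have conv: "weak_conv_m (\<lambda>m. distr M borel (T m)) std_normal_distribution"
      unfolding T_def
    proof (rule central_limit_theorem_zero_mean[where X = "\<lambda>i \<omega>. h (Z i \<omega>)"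
          and \<mu> = "distr Q borel h"])
      show "indep_vars (\<lambda>i. borel) (\<lambda>i \<omega>. h (Z i \<omega>)) UNIV"
        by (rule indep_vars_compose2[OF indep_Z]) simp
      show "expectation (\<lambda>\<omega>. h (Z n \<omega>)) = 0" for n using exh[of h n] mean by simp
      then show "variance (\<lambda>\<omega>. h (Z n \<omega>)) = (sqrt v)\<^sup>2" for n
        using exh[of "\<lambda>z. (h z)\<^sup>2" n] v \<open>v > 0\<close> by simp
      show "integrable M (\<lambda>\<omega>. (h (Z n \<omega>))\<^sup>2)" for n
        using integrable_distr[OF measurable_Z[of n], of "\<lambda>z. (h z)\<^sup>2"] ih2 by (simp add: distr_Z)
      show "distr M borel (\<lambda>\<omega>. h (Z n \<omega>)) = distr Q borel h" for n
        using distr_distr[of h Q borel "Z n" M] by (simp add: distr_Z comp_def)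
    qed (use \<open>v > 0\<close> in simp)
    have law: "normal_law 0 v = distr std_normal_distribution borel (\<lambda>x. sqrt v * x)"
    proof -
      interpret N: real_distribution std_normal_distribution by (rule real_dist_normal_dist)
      have "distributed std_normal_distribution lborel (\<lambda>x. x) std_normal_density"
        by (auto simp: distributed_def distr_id2)
      from N.normal_density_affine[OF this, of "sqrt v" 0] \<open>v > 0\<close>
      have "distr std_normal_distribution lborel (\<lambda>x. sqrt v * x)
          = density lborel (normal_density 0 (sqrt v))"
        by (simp add: distributed_def)
      moreover have "distr std_normal_distribution lborel (\<lambda>x. sqrt v * x)
          = distr std_normal_distribution borel (\<lambda>x. sqrt v * x)"
        by (rule distr_cong) auto
      ultimately show ?thesis using False by (simp add: normal_law_def)
    qed
    have char_scale: "char (distr N borel (\<lambda>x. c * X x)) t = char (distr N borel X) (c * t)"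
      if [measurable]: "X \<in> borel_measurable N" for N :: "'x measure" and X :: "'x \<Rightarrow> real" and c t
      by (simp add: char_def integral_distr mult_ac)
    have char_normal: "char (normal_law 0 v) t = char std_normal_distribution (sqrt v * t)" for t
      using char_scale[of "\<lambda>x. x" std_normal_distribution "sqrt v" t]
      by (simp add: law distr_id2)
    show ?thesis unfolding v_def[symmetric]
    proof (rule levy_continuity)
      show "real_distribution (distr M borel (emp m g))" for m by (rule real_distribution_distr) simp
      interpret N: real_distribution std_normal_distribution by (rule real_dist_normal_dist)
      show "real_distribution (normal_law 0 v)" unfolding law by (rule N.real_distribution_distr) simp
      fix t
      have "(\<lambda>m. char (distr M borel (T m)) (sqrt v * t)) \<longlonglongrightarrow> char std_normal_distribution (sqrt v * t)"
        by (rule levy_continuity1[OF _ N.real_distribution_axioms conv]) (rule real_distribution_distr, simp)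
      then show "(\<lambda>m. char (distr M borel (emp m g)) t) \<longlonglongrightarrow> char (normal_law 0 v) t"
        unfolding eT char_normal by (simp add: char_scale)
    qed
  qed
qed

end

section \<open>Bracketing and chaining for orthants\<close>

text \<open>A distribution function evaluated at its own variable is stochastically at least
  uniform, even with atoms, because the sublevel set is a ray to the left. A closed ray has as mass
  the value at its endpoint, an open ray the left limit there, and an unbounded one is the whole
  line, which forces \<open>s\<close> to be at least 1.\<close>

lemma (in real_distribution) measure_cdf_le:
  assumes "0 \<le> s"
  shows "measure M {x. cdf M x \<le> s} \<le> s"
proof -
  define T where "T = {x. cdf M x \<le> s}"
  have down: "x \<in> T" if "x \<le> y" "y \<in> T" for x y
    using cdf_nondecreasing[OF that(1)] that(2) by (auto simp: T_def)
  consider "T = {}" | "\<not> bdd_above T" | "T \<noteq> {}" "bdd_above T" by argo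
  then have "measure M T \<le> s"
  proof cases
    case 1
    then show ?thesis using assms by simp
  next
    case 2
    then have "\<exists>y\<in>T. real n \<le> y" for n unfolding bdd_above_def by (meson linear)
    then have "real n \<in> T" for n using down by blast
    then have "cdf M (real n) \<le> s" for n by (simp add: T_def)
    with cdf_lim_infty_prob have "1 \<le> s" by (intro LIMSEQ_le_const2) auto
    then show ?thesis using prob_le_1[of T] by linarith
  next
    case 3
    define a where "a = Sup T"
    have le: "x \<le> a" if "x \<in> T" for x using that 3 by (simp add: a_def cSup_upper)
    show ?thesis
    proof (cases "a \<in> T")
      case True
      have "measure M T \<le> measure M {..a}" using le by (intro finite_measure_mono) auto
      then show ?thesis using True by (simp add: T_def cdf_def)
    next
      case False
      have "T \<subseteq> {..<a}" using le False by (auto simp: less_le)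
      then have "measure M T \<le> measure M {..<a}" by (intro finite_measure_mono) auto
      also have "\<dots> \<le> s"
      proof (rule tendsto_upperbound[OF cdf_at_left])
        have "cdf M x \<le> s" if "x < a" for x
        proof -
          obtain y where "y \<in> T" "x < y" using less_cSupD[OF 3(1), of x] \<open>x < a\<close>
            unfolding a_def by blast
          then show ?thesis using down[of x y] by (simp add: T_def)
        qed
        then show "\<forall>\<^sub>F x in at_left a. cdf M x \<le> s"
          by (auto simp: eventually_at_left_field intro!: exI[of _ "a - 1"])
      qed simp
      finally show ?thesis .
    qed
  qed
  then show ?thesis by (simp add: T_def)
qed

lemma (in real_distribution) measure_cdf_less: "0 \<le> s \<Longrightarrow> measure M {x. cdf M x < s} \<le> s"
proof -
  assume "0 \<le> s"
  have "mono (cdf M)" by (simp add: mono_def cdf_nondecreasing)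
  then have [measurable]: "cdf M \<in> borel_measurable borel" by (rule borel_measurable_mono)
  have "measure M {x. cdf M x < s} \<le> measure M {x. cdf M x \<le> s}"
    by (intro finite_measure_mono) auto
  with measure_cdf_le[OF \<open>0 \<le> s\<close>] show ?thesis by simp
qed

text \<open>Reflection at the origin turns the left limit of a distribution function into one minus
  a distribution function, so the complement is a sublevel set of the closed kind at level
  \<open>1 - s\<close>.\<close>

lemma (in real_distribution) measure_left_cdf_less:
  assumes "s \<le> 1"
  shows "s \<le> measure M {x. measure M {..<x} < s}"
proof -
  interpret N: real_distribution "distr M borel uminus" by (rule real_distribution_distr) simp
  have cdf: "cdf (distr M borel uminus) (- x) = 1 - measure M {..<x}" for x
  proof -
    have "cdf (distr M borel uminus) (- x) = measure M (- {..<x})"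
      by (subst cdf_def, subst measure_distr) (auto intro!: arg_cong[where f = "measure M"])
    then show ?thesis using prob_compl[of "{..<x}"] by (simp add: Compl_eq_Diff_UNIV)
  qed
  have "mono (\<lambda>x. measure M {..<x})" by (auto simp: mono_def intro!: finite_measure_mono)
  then have [measurable]: "(\<lambda>x. measure M {..<x}) \<in> borel_measurable borel"
    by (rule borel_measurable_mono)
  have "mono (cdf (distr M borel uminus))" by (simp add: mono_def N.cdf_nondecreasing)
  then have [measurable]: "cdf (distr M borel uminus) \<in> borel_measurable borel"
    by (rule borel_measurable_mono)
  have "measure M {x. \<not> measure M {..<x} < s}
      = measure (distr M borel uminus) {y. cdf (distr M borel uminus) y \<le> 1 - s}"
    by (subst measure_distr) (auto simp: cdf intro!: arg_cong[where f = "measure M"])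
  also have "\<dots> \<le> 1 - s" using assms by (intro N.measure_cdf_le) simp
  finally have "measure M {x. \<not> measure M {..<x} < s} \<le> 1 - s" .
  moreover have "{x. \<not> measure M {..<x} < s} = UNIV - {x. measure M {..<x} < s}" by auto
  ultimately show ?thesis using prob_compl[of "{x. measure M {..<x} < s}"] by simp
qed

text \<open>Geometric growth inside the exponential beats any geometric factor: with
  \<open>a < r ^ n\<close>, bounding \<open>exp (- y)\<close> by \<open>(n / y) ^ n\<close> leaves a
  geometric series of ratio \<open>a / r ^ n\<close>. In the chaining, \<open>a ^ k\<close> is the
  growth of the number of links.\<close>

lemma summable_geometric_exp:
  fixes a b r :: real
  assumes "0 \<le> a" "0 < b" "1 < r"
  shows "summable (\<lambda>k. a ^ k * exp (- (b * r ^ k)))"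
proof -
  obtain n where n: "a < r ^ n" "n > 0"
  proof -
    \<comment> \<open>Exceeding \<open>r\<close> as well as \<open>a\<close> rules out
      \<open>n = 0\<close>.\<close>
    obtain n where "max a r < r ^ n" using real_arch_pow[OF assms(3)] by blast
    then show thesis using that[of n] assms by (cases n) auto
  qed
  have bound: "norm (a ^ k * exp (- (b * r ^ k))) \<le> (n / b) ^ n * (a / r ^ n) ^ k" for k
  proof -
    define y where "y = b * r ^ k"
    have y: "y > 0" using assms by (simp add: y_def)
    have "(y / n) ^ n \<le> (1 + y / n) ^ n" using y n by (intro power_mono) auto
    also have "\<dots> \<le> exp y" using y n(2) by (intro exp_ge_one_plus_x_over_n_power_n) auto
    finally have "1 / exp y \<le> 1 / (y / n) ^ n" using y n(2) by (intro divide_left_mono) auto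
    then have "exp (- y) \<le> (n / y) ^ n" by (simp add: exp_minus inverse_eq_divide power_divide)
    then have "a ^ k * exp (- y) \<le> a ^ k * (n / y) ^ n" using assms by (intro mult_left_mono) auto
    also have "\<dots> = (n / b) ^ n * (a / r ^ n) ^ k"
      using assms by (simp add: y_def power_divide power_mult_distrib mult.commute flip: power_mult)
    finally show ?thesis using assms by (simp add: y_def)
  qed
  have "summable (\<lambda>k. (a / r ^ n) ^ k)" using assms n by (intro summable_geometric) simp
  then have "summable (\<lambda>k. (n / b) ^ n * (a / r ^ n) ^ k)" by (rule summable_mult)
  then show ?thesis by (rule summable_comparison_test_ev[rotated]) (use bound in simp)
qed

text \<open>Closes the chain: what an orthant contains beyond its last lower bracket ranges over
  infinitely many sets, but each is dominated by one of finitely many bracket differences. The price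
  is \<open>sqrt m\<close> times the mass of that difference.\<close>

lemma (in iid_sample) emp_dominated:
  assumes [measurable]: "g \<in> borel_measurable Q" "h \<in> borel_measurable Q"
    and gh: "\<And>z. 0 \<le> g z" "\<And>z. g z \<le> h z" "\<And>z. h z \<le> 1"
  shows "\<bar>emp m g \<omega>\<bar> \<le> \<bar>emp m h \<omega>\<bar> + sqrt m * (\<integral>z. h z \<partial>Q)"
proof (cases "m = 0")
  case False
  then have m: "sqrt m > 0" by simp
  have b: "\<bar>g z\<bar> \<le> 1" "\<bar>h z\<bar> \<le> 1" for z using gh[of z] by auto
  have ig: "integrable Q g" by (rule integrable_bounded[OF _ b(1)]) simp
  have ih: "integrable Q h" by (rule integrable_bounded[OF _ b(2)]) simp
  have Eg: "0 \<le> (\<integral>z. g z \<partial>Q)" "(\<integral>z. g z \<partial>Q) \<le> (\<integral>z. h z \<partial>Q)"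
    using gh by (auto intro!: integral_nonneg integral_mono ig ih)
  have expand: "emp m k \<omega> = (\<Sum>i<m. k (Z i \<omega>)) / sqrt m - sqrt m * (\<integral>z. k z \<partial>Q)" for k
    using m by (simp add: emp_def sum_subtractf diff_divide_distrib real_div_sqrt flip: times_divide_eq_left)
  have S: "0 \<le> (\<Sum>i<m. g (Z i \<omega>)) / sqrt m"
      "(\<Sum>i<m. g (Z i \<omega>)) / sqrt m \<le> (\<Sum>i<m. h (Z i \<omega>)) / sqrt m"
    using gh by (auto intro!: divide_nonneg_nonneg sum_nonneg divide_right_mono sum_mono)
  have "0 \<le> sqrt m * (\<integral>z. g z \<partial>Q)" "sqrt m * (\<integral>z. g z \<partial>Q) \<le> sqrt m * (\<integral>z. h z \<partial>Q)"
    using Eg m by (auto intro: mult_left_mono)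
  then show ?thesis using S unfolding expand by linarith
qed (simp add: emp_def)

text \<open>Orthants \<open>{z. \<forall>j. g j z \<le> u j}\<close> are bracketed through the marginal distribution functions
  \<open>F j\<close>: the level-\<open>k\<close> cell of \<open>u\<close> records each \<open>F j (u j)\<close> up to \<open>1 / 2^k\<close>. Using the left limit
  of \<open>F j\<close> in the lower and \<open>F j\<close> itself in the upper bracket makes this work for marginals with
  atoms.\<close>

locale orthant_sample = iid_sample M Q Z
  for M :: "'w measure" and Q :: "'b measure" and Z +
  fixes g :: "'j::finite \<Rightarrow> 'b \<Rightarrow> real"
  assumes measurable_g [measurable]: "\<And>j. g j \<in> borel_measurable Q"
begin

section \<open>Brackets and links\<close>

definition marginal :: "'j \<Rightarrow> real measure" where "marginal j = distr Q borel (g j)"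

definition cell :: "nat \<Rightarrow> ('j \<Rightarrow> real) \<Rightarrow> 'j \<Rightarrow> nat" where
  "cell k u j = nat \<lfloor>2 ^ k * cdf (marginal j) (u j)\<rfloor>"

definition orthant :: "('j \<Rightarrow> real) \<Rightarrow> 'b set" where
  "orthant u = {z\<in>space Q. \<forall>j. g j z \<le> u j}"

definition lower :: "nat \<Rightarrow> ('j \<Rightarrow> nat) \<Rightarrow> 'b set" where
  "lower k c = {z\<in>space Q. \<forall>j. measure (marginal j) {..<g j z} < c j / 2 ^ k}"

definition upper :: "nat \<Rightarrow> ('j \<Rightarrow> nat) \<Rightarrow> 'b set" where
  "upper k c = {z\<in>space Q. \<forall>j. cdf (marginal j) (g j z) < (real (c j) + 1) / 2 ^ k}"

lemma real_distribution_marginal: "real_distribution (marginal j)"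
  unfolding marginal_def by (rule Q.real_distribution_distr) simp

lemma measurable_cdf_marginal [measurable]: "cdf (marginal j) \<in> borel_measurable borel"
proof -
  interpret D: real_distribution "marginal j" by (rule real_distribution_marginal)
  show ?thesis by (rule borel_measurable_mono) (simp add: mono_def D.cdf_nondecreasing)
qed

lemma measurable_left_cdf_marginal [measurable]:
  "(\<lambda>x. measure (marginal j) {..<x}) \<in> borel_measurable borel"
proof -
  interpret D: real_distribution "marginal j" by (rule real_distribution_marginal)
  show ?thesis by (rule borel_measurable_mono) (auto simp: mono_def intro!: D.finite_measure_mono)
qed

lemma sets_orthant [measurable]: "orthant u \<in> sets Q"
  and sets_lower [measurable]: "lower k c \<in> sets Q"
  and sets_upper [measurable]: "upper k c \<in> sets Q"
  unfolding orthant_def lower_def upper_def by measurable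

lemma cell_bounds:
  "cell k u j / 2 ^ k \<le> cdf (marginal j) (u j)" "cdf (marginal j) (u j) < (real (cell k u j) + 1) / 2 ^ k"
  "cell k u j \<le> 2 ^ k"
proof -
  interpret D: real_distribution "marginal j" by (rule real_distribution_marginal)
  have c: "0 \<le> cdf (marginal j) (u j)" "cdf (marginal j) (u j) \<le> 1"
    by (auto simp: D.cdf_nonneg D.cdf_bounded_prob)
  then have eq: "real (cell k u j) = of_int \<lfloor>2 ^ k * cdf (marginal j) (u j)\<rfloor>"
    by (simp add: cell_def)
  show "cell k u j / 2 ^ k \<le> cdf (marginal j) (u j)"
    using of_int_floor_le[of "2 ^ k * cdf (marginal j) (u j)"]
    by (simp add: eq divide_le_eq mult.commute)
  show "cdf (marginal j) (u j) < (real (cell k u j) + 1) / 2 ^ k"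
    using real_of_int_floor_add_one_gt[of "2 ^ k * cdf (marginal j) (u j)"]
    by (simp add: eq less_divide_eq mult.commute add.commute)
  have "real (cell k u j) \<le> 2 ^ k * cdf (marginal j) (u j)" unfolding eq by (rule of_int_floor_le)
  also have "\<dots> \<le> 2 ^ k * 1" using c by (intro mult_left_mono) auto
  finally show "cell k u j \<le> 2 ^ k" by (metis mult_1_right of_nat_le_iff of_nat_numeral of_nat_power)
qed

lemma left_cdf_less_imp:
  assumes "measure (marginal j) {..<x} < cdf (marginal j) y"
  shows "x \<le> y"
proof (rule ccontr)
  interpret D: real_distribution "marginal j" by (rule real_distribution_marginal)
  assume "\<not> x \<le> y"
  then have "cdf (marginal j) y \<le> measure (marginal j) {..<x}"
    unfolding cdf_def by (intro D.finite_measure_mono) auto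
  with assms show False by simp
qed

lemma lower_subset_orthant: "lower k (cell k u) \<subseteq> orthant u"
proof
  fix z assume z: "z \<in> lower k (cell k u)"
  have "g j z \<le> u j" for j
  proof (rule left_cdf_less_imp)
    have "measure (marginal j) {..<g j z} < cell k u j / 2 ^ k" using z by (simp add: lower_def)
    also note cell_bounds(1)[of k u j]
    finally show "measure (marginal j) {..<g j z} < cdf (marginal j) (u j)" .
  qed
  then show "z \<in> orthant u" using z by (simp add: orthant_def lower_def)
qed

lemma orthant_subset_upper: "orthant u \<subseteq> upper k (cell k u)"
proof
  fix z assume z: "z \<in> orthant u"
  have "cdf (marginal j) (g j z) < (real (cell k u j) + 1) / 2 ^ k" for j
  proof -
    interpret D: real_distribution "marginal j" by (rule real_distribution_marginal)
    have "cdf (marginal j) (g j z) \<le> cdf (marginal j) (u j)"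
      using z by (intro D.cdf_nondecreasing) (simp add: orthant_def)
    also note cell_bounds(2)[of j u k]
    finally show ?thesis .
  qed
  then show "z \<in> upper k (cell k u)" using z by (simp add: upper_def orthant_def)
qed

text \<open>Doubling a nonnegative number at least doubles its floor, so lower brackets increase
  with the level. Nestedness makes each increment of the chain the empirical process at a single
  set.\<close>

lemma lower_subset_lower_Suc: "lower k (cell k u) \<subseteq> lower (Suc k) (cell (Suc k) u)"
proof -
  have "cell k u j / 2 ^ k \<le> cell (Suc k) u j / 2 ^ Suc k" for j
  proof -
    interpret D: real_distribution "marginal j" by (rule real_distribution_marginal)
    define x where "x = 2 ^ k * cdf (marginal j) (u j)"
    have "0 \<le> x" using D.cdf_nonneg by (simp add: x_def)
    have "2 * \<lfloor>x\<rfloor> \<le> \<lfloor>2 * x\<rfloor>" by linarith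
    then have "2 * nat \<lfloor>x\<rfloor> \<le> nat \<lfloor>2 * x\<rfloor>" using \<open>0 \<le> x\<close> by linarith
    then have "2 * cell k u j \<le> cell (Suc k) u j" by (simp add: cell_def x_def mult.assoc)
    then show ?thesis by (simp add: field_simps)
  qed
  then show ?thesis unfolding lower_def by (auto intro: less_le_trans)
qed

text \<open>A point between the brackets violates one coordinate condition of the lower one while
  meeting that of the upper one. Per coordinate, the level-set bounds for the distribution function
  and for its left limit leave mass \<open>1 / 2 ^ k\<close>; the union bound supplies the factor
  \<open>CARD('j)\<close>.\<close>

lemma measure_bracket: "measure Q (upper k (cell k u) - lower k (cell k u)) \<le> CARD('j) / 2 ^ k"
proof -
  define c where "c = cell k u"
  define A where "A j = {x. measure (marginal j) {..<x} < c j / 2 ^ k}" for j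
  define B where "B j = {x. cdf (marginal j) x < (real (c j) + 1) / 2 ^ k}" for j
  have [measurable]: "A j \<in> sets borel" "B j \<in> sets borel" for j
    unfolding A_def B_def by measurable
  have one: "measure Q (g j -` (B j - A j) \<inter> space Q) \<le> 1 / 2 ^ k" for j
  proof -
    interpret D: real_distribution "marginal j" by (rule real_distribution_marginal)
    have "A j \<subseteq> B j"
    proof
      fix x assume "x \<in> A j"
      then have "measure (marginal j) {..<x} < cdf (marginal j) (u j)"
        using cell_bounds(1)[of k u j] by (simp add: A_def c_def)
      then have "cdf (marginal j) x \<le> cdf (marginal j) (u j)"
        by (intro D.cdf_nondecreasing left_cdf_less_imp)
      also note cell_bounds(2)[of j u k]
      finally show "x \<in> B j" by (simp add: B_def c_def)
    qed
    have "measure Q (g j -` (B j - A j) \<inter> space Q) = measure (marginal j) (B j - A j)"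
      unfolding marginal_def by (subst measure_distr) auto
    also have "\<dots> = measure (marginal j) (B j) - measure (marginal j) (A j)"
      by (rule D.finite_measure_Diff) (use \<open>A j \<subseteq> B j\<close> in auto)
    also have "\<dots> \<le> (real (c j) + 1) / 2 ^ k - c j / 2 ^ k"
    proof (rule diff_mono)
      show "measure (marginal j) (B j) \<le> (real (c j) + 1) / 2 ^ k"
        using D.measure_cdf_less[of "(real (c j) + 1) / 2 ^ k"] by (simp add: B_def)
      \<comment> \<open>The mass bound for left limits requires a level of at most 1, which is the
        upper bound on cell numbers.\<close>
      have "real (c j) \<le> real (2 ^ k)" unfolding c_def of_nat_le_iff by (rule cell_bounds(3))
      then show "c j / 2 ^ k \<le> measure (marginal j) (A j)"
        using D.measure_left_cdf_less[of "c j / 2 ^ k"] by (simp add: A_def)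
    qed
    finally show ?thesis by (simp flip: diff_divide_distrib)
  qed
  have "upper k c - lower k c \<subseteq> (\<Union>j. g j -` (B j - A j) \<inter> space Q)"
    unfolding upper_def lower_def A_def B_def by auto
  then have "measure Q (upper k c - lower k c) \<le> measure Q (\<Union>j\<in>UNIV. g j -` (B j - A j) \<inter> space Q)"
    by (intro Q.finite_measure_mono) auto
  also have "\<dots> \<le> (\<Sum>j\<in>UNIV. measure Q (g j -` (B j - A j) \<inter> space Q))"
    by (rule measure_UNION_le) auto
  also have "\<dots> \<le> (\<Sum>j\<in>(UNIV::'j set). 1 / 2 ^ k)" by (intro sum_mono one)
  finally show ?thesis by (simp add: c_def)
qed

lemma finite_range_cell: "finite (range (cell k))"
  and card_range_cell: "card (range (cell k)) \<le> (2 ^ k + 1) ^ CARD('j)"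
proof -
  have sub: "range (cell k) \<subseteq> PiE UNIV (\<lambda>_. {..2 ^ k})"
    using cell_bounds(3) by (auto simp: PiE_def extensional_def)
  have fin: "finite (PiE (UNIV::'j set) (\<lambda>_. {..(2::nat) ^ k}))" by (intro finite_PiE) auto
  show "finite (range (cell k))" by (rule finite_subset[OF sub fin])
  have "card (range (cell k)) \<le> card (PiE (UNIV::'j set) (\<lambda>_. {..(2::nat) ^ k}))"
    by (rule card_mono[OF fin sub])
  then show "card (range (cell k)) \<le> (2 ^ k + 1) ^ CARD('j)" by (simp add: card_PiE)
qed

text \<open>The sets at which the process has to be controlled at level \<open>k\<close>: increments
  of the lower brackets along the chain, and full bracket differences for its end.\<close>

definition links :: "nat \<Rightarrow> 'b set set" where
  "links k = (\<lambda>u. lower (Suc k) (cell (Suc k) u) - lower k (cell k u)) ` UNIV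
     \<union> (\<lambda>u. upper k (cell k u) - lower k (cell k u)) ` UNIV"

lemma sets_links: "T \<in> links k \<Longrightarrow> T \<in> sets Q"
  by (auto simp: links_def)

text \<open>Both kinds sit inside one bracket of level \<open>k\<close>: the finer lower bracket
  lies in the orthant, hence in the coarser upper one.\<close>

lemma measure_links:
  assumes "T \<in> links k"
  shows "measure Q T \<le> CARD('j) / 2 ^ k"
proof -
  obtain u where "T \<subseteq> upper k (cell k u) - lower k (cell k u)"
    using assms lower_subset_orthant orthant_subset_upper unfolding links_def by fastforce
  then have "measure Q T \<le> measure Q (upper k (cell k u) - lower k (cell k u))"
    by (intro Q.finite_measure_mono) auto
  with measure_bracket[of k u] show ?thesis by simp
qed

lemma finite_links: "finite (links k)"
  and card_links: "real (card (links k)) \<le> 2 * 16 ^ CARD('j) * (4 ^ CARD('j)) ^ k"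
proof -
  define A where "A = (\<lambda>(c', c). lower (Suc k) c' - lower k c) ` (range (cell (Suc k)) \<times> range (cell k))"
  define B where "B = (\<lambda>c. upper k c - lower k c) ` range (cell k)"
  have sub: "links k \<subseteq> A \<union> B" unfolding links_def A_def B_def by auto
  have fin: "finite A" "finite B" unfolding A_def B_def using finite_range_cell by auto
  show "finite (links k)" using sub fin by (meson finite_UnI finite_subset)
  \<comment> \<open>One bound for the number of cells at both levels: \<open>2 ^ (k + 2)\<close>
    exceeds \<open>2 ^ k + 1\<close> and \<open>2 ^ Suc k + 1\<close>. Squaring it yields the factor
    16 and the growth rate 4 per coordinate.\<close>
  define N where "N = ((2::nat) ^ (k + 2)) ^ CARD('j)"
  have N: "card (range (cell k)) \<le> N" "card (range (cell (Suc k))) \<le> N" "1 \<le> N"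
  proof -
    have "(2 ^ k + 1 :: nat) \<le> 2 ^ (k + 2)" "(2 ^ Suc k + 1 :: nat) \<le> 2 ^ (k + 2)"
      using one_le_power[of "2::nat" k] by auto
    then show "card (range (cell k)) \<le> N" "card (range (cell (Suc k))) \<le> N"
      unfolding N_def using card_range_cell by (meson order_trans power_mono zero_le)+
  qed (simp add: N_def)
  have "card A \<le> card (range (cell (Suc k)) \<times> range (cell k))"
    unfolding A_def by (rule card_image_le) (auto simp: finite_range_cell)
  also have "\<dots> \<le> N * N" unfolding card_cartesian_product using N by (intro mult_mono) auto
  finally have "card A \<le> N * N" .
  moreover have "card B \<le> N"
    unfolding B_def using N(1) card_image_le[OF finite_range_cell] order_trans by blast
  moreover have "card (links k) \<le> card A + card B"
    using card_mono[OF _ sub] fin card_Un_le[of A B] by (meson finite_UnI order_trans)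
  moreover have "N \<le> N * N" using N(3) by simp
  ultimately have "card (links k) \<le> 2 * (N * N)" by linarith
  also have "N * N = 16 ^ CARD('j) * (4 ^ CARD('j)) ^ k"
  proof -
    have "N * N = (2 ^ (k + 2) * 2 ^ (k + 2)) ^ CARD('j)"
      by (simp only: N_def power_mult_distrib)
    also have "2 ^ (k + 2) * 2 ^ (k + 2) = 16 * (4::nat) ^ k"
      by (simp add: power_add flip: power_mult_distrib)
    also have "(16 * 4 ^ k) ^ CARD('j) = 16 ^ CARD('j) * ((4::nat) ^ k) ^ CARD('j)"
      by (rule power_mult_distrib)
    also have "((4::nat) ^ k) ^ CARD('j) = (4 ^ CARD('j)) ^ k"
      by (metis power_mult mult.commute)
    finally show ?thesis .
  qed
  finally have "real (card (links k)) \<le> real (2 * (16 ^ CARD('j) * (4 ^ CARD('j)) ^ k))"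
    by (simp only: of_nat_le_iff)
  then show "real (card (links k)) \<le> 2 * 16 ^ CARD('j) * (4 ^ CARD('j)) ^ k" by simp
qed

end

lemma (in prob_space) big_Op_finite:
  assumes "finite I" "\<And>i. i \<in> I \<Longrightarrow> big_Op (X i)" "0 < \<eta>"
  shows "\<exists>B>0. \<forall>\<^sub>F m in sequentially. likely \<eta> (\<lambda>\<omega>. \<forall>i\<in>I. \<bar>X i m \<omega>\<bar> \<le> B)"
  using assms
proof (induction I arbitrary: \<eta> rule: finite_induct)
  case empty
  then show ?case by (intro exI[of _ 1]) (simp add: likely_AE)
next
  case (insert i I)
  have \<eta>: "\<eta> / 2 > 0" using insert.prems by simp
  obtain B where B: "B > 0" "\<forall>\<^sub>F m in sequentially. likely (\<eta>/2) (\<lambda>\<omega>. \<forall>i\<in>I. \<bar>X i m \<omega>\<bar> \<le> B)"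
    using insert.IH[OF _ \<eta>] insert.prems by auto
  obtain C where C: "C > 0" "\<forall>\<^sub>F m in sequentially. likely (\<eta>/2) (\<lambda>\<omega>. \<bar>X i m \<omega>\<bar> \<le> C)"
  proof -
    have "big_Op (X i)" using insert.prems(1) by simp
    then show thesis using that \<eta> unfolding big_Op_def by blast
  qed
  have "\<forall>\<^sub>F m in sequentially. likely \<eta> (\<lambda>\<omega>. \<forall>i\<in>insert i I. \<bar>X i m \<omega>\<bar> \<le> B + C)"
    using B(2) C(2)
  proof eventually_elim
    case (elim m)
    show ?case
    proof (rule likely_mono[OF likely_conj[OF elim]])
      fix \<omega> assume *: "(\<forall>i\<in>I. \<bar>X i m \<omega>\<bar> \<le> B) \<and> \<bar>X i m \<omega>\<bar> \<le> C"
      have "\<bar>X j m \<omega>\<bar> \<le> B + C" if "j \<in> insert i I" for j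
      proof (cases "j = i")
        case True
        then show ?thesis using * B(1) by simp
      next
        case False
        then have "\<bar>X j m \<omega>\<bar> \<le> B" using * that by blast
        then show ?thesis using C(1) by simp
      qed
      then show "\<forall>i\<in>insert i I. \<bar>X i m \<omega>\<bar> \<le> B + C" by blast
    qed simp
  qed
  then show ?case using B(1) C(1) by (intro exI[of _ "B + C"]) auto
qed

section \<open>Chaining and tightness of the orthant process\<close>

context orthant_sample
begin

text \<open>The chain starts at level \<open>k\<close> and stops at the level \<open>K\<close> with \<open>2^K\<close> of order \<open>sqrt m\<close>: there
  a bracket has mass of order \<open>1 / sqrt m\<close>, which is negligible for the last step, while the
  exponential bound is still of Gaussian type at all levels up to \<open>K\<close>.\<close>

lemma chaining:
  fixes w :: "'b \<Rightarrow> real"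
  assumes [measurable]: "w \<in> borel_measurable Q" and w: "\<And>z. 0 \<le> w z" "\<And>z. w z \<le> 1"
    and "0 < \<delta>" "0 < \<eta>"
  shows "\<exists>k. \<forall>\<^sub>F m in sequentially. likely \<eta> (\<lambda>\<omega>. \<forall>u.
    \<bar>emp m (\<lambda>z. w z * indicator (orthant u) z) \<omega>
      - emp m (\<lambda>z. w z * indicator (lower k (cell k u)) z) \<omega>\<bar> \<le> \<delta>)"
proof -
  define d where "d = real (CARD('j))"
  \<comment> \<open>The thresholds \<open>x k\<close> sum to at most \<open>4 * c\<close>, that is
    \<open>\<delta> / 4\<close>; the last link adds at most \<open>c\<close>, and the mass in the
    final domination at most \<open>\<delta> / 4\<close>.\<close>
  define c where "c = \<delta> / 16"
  \<comment> \<open>The ratio lies between \<open>1 / sqrt 2\<close> and 1: below 1 the thresholds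
    are summable, and above \<open>1 / sqrt 2\<close> the quotient of \<open>(x k)\<^sup>2\<close>
    by the bound on the link mass still grows, like \<open>(9/8) ^ k\<close>.\<close>
  define x where "x k = c * (3/4) ^ k" for k :: nat
  define W where "W T z = w z * indicator T z" for T z
  have d: "d \<ge> 1" by (simp add: d_def Suc_le_eq)
  have c: "c > 0" using \<open>0 < \<delta>\<close> by (simp add: c_def)
  have x: "x k > 0" "x k \<le> c" for k
    using c power_le_one[of "3/4::real" k] by (auto simp: x_def)
  have mW [measurable]: "W T \<in> borel_measurable Q" if "T \<in> sets Q" for T
    using that unfolding W_def[abs_def] by measurable
  have W: "0 \<le> W T z" "W T z \<le> 1" for T z using w[of z] by (auto simp: W_def indicator_def)
  have iW: "integrable Q (W T)" if "T \<in> sets Q" for T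
    using that W by (intro integrable_bounded[where b = 1]) auto
  have EW: "(\<integral>z. W T z \<partial>Q) \<le> measure Q T" if [measurable]: "T \<in> sets Q" for T
  proof -
    have "(\<integral>z. W T z \<partial>Q) \<le> (\<integral>z. indicator T z \<partial>Q)"
      using w by (intro integral_mono iW that Q.integrable_const_bound[where B = 1])
        (auto simp: W_def indicator_def)
    then show ?thesis using that by simp
  qed
  \<comment> \<open>Union bound for level \<open>k\<close>: the bound on the number of links times
    the tail bound for a single one.\<close>
  define q where "q k = 4 * 16 ^ CARD('j) * ((4 ^ CARD('j)) ^ k * exp (- (c\<^sup>2 / (4 * d) * (9/8) ^ k)))"
    for k :: nat
  have "summable q" unfolding q_def
    by (intro summable_mult summable_geometric_exp) (use c d in auto)
  \<comment> \<open>The starting level makes the summed union bound small for every end level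
    \<open>K\<close>. It does not depend on \<open>m\<close>, so the partition it provides is
    fixed.\<close>
  then obtain k0 where k0: "\<And>K. (\<Sum>k=k0..K. q k) < \<eta>"
  proof -
    from summable_Cauchy[THEN iffD1, OF \<open>summable q\<close>, rule_format, OF \<open>0 < \<eta>\<close>]
    obtain N where N: "\<And>m n. N \<le> m \<Longrightarrow> norm (sum q {m..<n}) < \<eta>" by blast
    have "(\<Sum>k=N..K. q k) < \<eta>" for K
      using N[of N "Suc K"] by (simp add: atLeastLessThanSuc_atLeastAtMost)
    then show thesis by (rule that)
  qed
  have bern: "prob {\<omega>\<in>space M. \<bar>emp m (W T) \<omega>\<bar> > x k} \<le> 2 * exp (- (c\<^sup>2 / (4 * d) * (9/8) ^ k))"
    if T: "T \<in> links k" and le: "x k \<le> 2 * (d / 2 ^ k) * sqrt m" for T k m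
  proof -
    note [measurable] = sets_links[OF T]
    have "(\<integral>z. W T z \<partial>Q) \<le> d / 2 ^ k"
      using EW[OF sets_links[OF T]] measure_links[OF T] by (simp add: d_def)
    then have "prob {\<omega>\<in>space M. \<bar>emp m (W T) \<omega>\<bar> > x k} \<le> 2 * exp (- ((x k)\<^sup>2 / (4 * (d / 2 ^ k))))"
      using d by (intro prob_emp_gt W x le) auto
    also have "(x k)\<^sup>2 / (4 * (d / 2 ^ k)) = c\<^sup>2 / (4 * d) * ((3/4)\<^sup>2 ^ k * 2 ^ k)"
      using d by (simp add: x_def power_mult_distrib mult.commute flip: power_mult)
    also have "(3/4 :: real)\<^sup>2 ^ k * 2 ^ k = (9/8) ^ k"
      by (simp only: power_mult_distrib[symmetric]) (simp add: power2_eq_square)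
    finally show ?thesis .
  qed
  \<comment> \<open>The lower bound on \<open>2 ^ K\<close> makes \<open>sqrt m\<close> times the
    final bracket mass at most \<open>\<delta> / 4\<close>; the upper bound keeps the thresholds of
    all levels in the Gaussian range. A power of two fits because the window has ratio 2.\<close>
  have level: "\<exists>K\<ge>k0. 4 * d * sqrt m / \<delta> \<le> 2 ^ K \<and> 2 ^ K \<le> 8 * d * sqrt m / \<delta>"
    if "2 ^ k0 \<le> 4 * d * sqrt m / \<delta>" for m :: nat
  proof -
    define y where "y = 4 * d * sqrt m / \<delta>"
    have "1 \<le> y" using that one_le_power[of "2::real" k0] unfolding y_def by linarith
    define K where "K = (LEAST n. y \<le> 2 ^ n)"
    have "\<exists>n. y \<le> 2 ^ n" using real_arch_pow[of 2 y] by (auto intro: less_imp_le)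
    then have K: "y \<le> 2 ^ K" unfolding K_def by (rule LeastI_ex)
    have "(2::real) ^ k0 \<le> 2 ^ K" using that K unfolding y_def by (rule order_trans)
    then have "k0 \<le> K" by simp
    moreover have "2 ^ K \<le> 2 * y"
    proof (cases K)
      case 0
      then show ?thesis using \<open>1 \<le> y\<close> by simp
    next
      case (Suc n)
      then have "\<not> y \<le> 2 ^ n" using not_less_Least[of n "\<lambda>n. y \<le> 2 ^ n"] by (simp add: K_def)
      then show ?thesis by (simp add: Suc)
    qed
    ultimately show ?thesis using K by (intro exI[of _ K]) (simp add: y_def)
  qed
  have "\<forall>\<^sub>F m in sequentially. likely \<eta> (\<lambda>\<omega>. \<forall>u.
    \<bar>emp m (W (orthant u)) \<omega> - emp m (W (lower k0 (cell k0 u))) \<omega>\<bar> \<le> \<delta>)"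
  proof -
    define y where "y = 2 ^ k0 * \<delta> / (4 * d)"
    have "\<forall>\<^sub>F m in sequentially. 2 ^ k0 \<le> 4 * d * sqrt (real m) / \<delta>"
      using eventually_ge_at_top[of "nat \<lceil>y\<^sup>2\<rceil>"]
    proof eventually_elim
      case (elim m)
      then have "y\<^sup>2 \<le> m" by linarith
      then have "y \<le> sqrt m" by (rule real_le_rsqrt)
      then show ?case using d \<open>0 < \<delta>\<close> by (simp add: y_def field_simps)
    qed
    then show ?thesis
    proof eventually_elim
      case (elim m)
      from level[OF elim] obtain K where K: "k0 \<le> K" "4 * d * sqrt m / \<delta> \<le> 2 ^ K"
        "2 ^ K \<le> 8 * d * sqrt m / \<delta>" by blast
      have dK: "\<delta> / 8 \<le> d / 2 ^ K * sqrt m" "sqrt m * (d / 2 ^ K) \<le> \<delta> / 4"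
        using K(2,3) \<open>0 < \<delta>\<close> by (simp_all add: field_simps)
      \<comment> \<open>Finitely many sets control all \<open>u\<close> at once, which also makes
        this event measurable.\<close>
      define good where "good \<omega> \<longleftrightarrow> (\<forall>k\<in>{k0..K}. \<forall>T\<in>links k. \<bar>emp m (W T) \<omega>\<bar> \<le> x k)" for \<omega>
      have "likely \<eta> good"
      proof (rule likely_Collect)
        show "{\<omega>\<in>space M. good \<omega>} \<in> events"
          unfolding good_def
          by (intro sets.sets_Collect_finite_All' sets.sets_Collect_finite_All finite_links)
             (use sets_links in \<open>auto simp: links_def intro!: borel_measurable_le\<close>)
        have bad: "{\<omega>\<in>space M. \<not> good \<omega>}
            = (\<Union>k\<in>{k0..K}. \<Union>T\<in>links k. {\<omega>\<in>space M. \<bar>emp m (W T) \<omega>\<bar> > x k})"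
          by (auto simp: good_def not_le)
        have ev: "{\<omega>\<in>space M. \<bar>emp m (W T) \<omega>\<bar> > x k} \<in> events" if "T \<in> links k" for T k
          using sets_links[OF that] by measurable
        have "prob {\<omega>\<in>space M. \<not> good \<omega>}
            \<le> (\<Sum>k\<in>{k0..K}. prob (\<Union>T\<in>links k. {\<omega>\<in>space M. \<bar>emp m (W T) \<omega>\<bar> > x k}))"
          unfolding bad by (rule measure_UNION_le) (auto intro!: sets.finite_UN finite_links ev)
        also have "\<dots> \<le> (\<Sum>k\<in>{k0..K}. q k)"
        proof (rule sum_mono)
          fix k assume k: "k \<in> {k0..K}"
          have "d / 2 ^ K * sqrt m \<le> d / 2 ^ k * sqrt m"
            using d k by (intro mult_right_mono divide_left_mono) auto
          then have le: "x k \<le> 2 * (d / 2 ^ k) * sqrt m"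
            using dK(1) x(2)[of k] c by (simp add: c_def)
          have "prob (\<Union>T\<in>links k. {\<omega>\<in>space M. \<bar>emp m (W T) \<omega>\<bar> > x k})
              \<le> (\<Sum>T\<in>links k. prob {\<omega>\<in>space M. \<bar>emp m (W T) \<omega>\<bar> > x k})"
            by (rule measure_UNION_le) (auto intro!: finite_links ev)
          also have "\<dots> \<le> (\<Sum>T\<in>links k. 2 * exp (- (c\<^sup>2 / (4 * d) * (9/8) ^ k)))"
            by (intro sum_mono bern le)
          also have "\<dots> = real (card (links k)) * (2 * exp (- (c\<^sup>2 / (4 * d) * (9/8) ^ k)))" by simp
          also have "\<dots> \<le> (2 * 16 ^ CARD('j) * (4 ^ CARD('j)) ^ k) * (2 * exp (- (c\<^sup>2 / (4 * d) * (9/8) ^ k)))"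
            by (intro mult_right_mono card_links) simp
          also have "\<dots> = q k" by (simp add: q_def)
          finally show "prob (\<Union>T\<in>links k. {\<omega>\<in>space M. \<bar>emp m (W T) \<omega>\<bar> > x k}) \<le> q k" .
        qed
        also have "\<dots> \<le> \<eta>" using k0[of K] by simp
        finally show "prob {\<omega>\<in>space M. \<not> good \<omega>} \<le> \<eta>" .
      qed
      then show ?case
      proof (rule likely_mono)
        fix \<omega> assume "good \<omega>"
        show "\<forall>u. \<bar>emp m (W (orthant u)) \<omega> - emp m (W (lower k0 (cell k0 u))) \<omega>\<bar> \<le> \<delta>"
        proof
          fix u
          define L where "L k = lower k (cell k u)" for k
          have [measurable]: "L k \<in> sets Q" for k by (simp add: L_def)
          have split: "emp m (W B) \<omega> - emp m (W A) \<omega> = emp m (W (B - A)) \<omega>"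
            if [measurable]: "A \<in> sets Q" "B \<in> sets Q" and "A \<subseteq> B" for A B
          proof -
            have "W (B - A) = (\<lambda>z. W B z - W A z)"
              using \<open>A \<subseteq> B\<close> by (auto simp: fun_eq_iff W_def indicator_def)
            then show ?thesis by (simp add: emp_diff iW that)
          qed
          have "\<bar>emp m (W (L (k0 + n))) \<omega> - emp m (W (L k0)) \<omega>\<bar> \<le> (\<Sum>k=k0..<k0 + n. x k)"
            if "k0 + n \<le> K" for n
            using that
          proof (induction n)
            case (Suc n)
            have "L (Suc (k0 + n)) - L (k0 + n) \<in> links (k0 + n)"
              unfolding links_def L_def by blast
            moreover have "k0 + n \<in> {k0..K}" using Suc.prems by simp
            ultimately have "\<bar>emp m (W (L (Suc (k0 + n)) - L (k0 + n))) \<omega>\<bar> \<le> x (k0 + n)"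
              using \<open>good \<omega>\<close> unfolding good_def by blast
            moreover have "emp m (W (L (Suc (k0 + n)))) \<omega> - emp m (W (L (k0 + n))) \<omega>
                = emp m (W (L (Suc (k0 + n)) - L (k0 + n))) \<omega>"
              using lower_subset_lower_Suc by (intro split) (auto simp: L_def)
            ultimately show ?case using Suc.IH Suc.prems by simp
          qed simp
          from this[of "K - k0"] K(1)
          have chain: "\<bar>emp m (W (L K)) \<omega> - emp m (W (L k0)) \<omega>\<bar> \<le> (\<Sum>k=k0..<K. x k)" by simp
          also have "\<dots> \<le> (\<Sum>k<K. x k)" using x(1) by (intro sum_mono2) (auto intro: less_imp_le)
          also have "\<dots> = c * (\<Sum>k<K. (3/4) ^ k)" by (simp add: x_def sum_distrib_left)
          also have "\<dots> \<le> c * 4" using c by (intro mult_left_mono) (auto simp: sum_gp_strict)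
          finally have chain: "\<bar>emp m (W (L K)) \<omega> - emp m (W (L k0)) \<omega>\<bar> \<le> \<delta> / 4" by (simp add: c_def)
          define T where "T = upper K (cell K u) - L K"
          have T: "T \<in> links K" unfolding T_def L_def links_def by blast
          then have [measurable]: "T \<in> sets Q" by (rule sets_links)
          have sub: "L K \<subseteq> orthant u" "orthant u - L K \<subseteq> T"
            using lower_subset_orthant orthant_subset_upper unfolding L_def T_def by blast+
          have "emp m (W (orthant u)) \<omega> - emp m (W (L K)) \<omega> = emp m (W (orthant u - L K)) \<omega>"
            using sub(1) by (intro split) auto
          also have "\<bar>\<dots>\<bar> \<le> \<bar>emp m (W T) \<omega>\<bar> + sqrt m * (\<integral>z. W T z \<partial>Q)"
            using sub(2) w by (intro emp_dominated W) (auto simp: W_def indicator_def)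
          also have "\<dots> \<le> x K + sqrt m * (d / 2 ^ K)"
          proof (intro add_mono mult_left_mono)
            show "\<bar>emp m (W T) \<omega>\<bar> \<le> x K" using \<open>good \<omega>\<close> T K(1) unfolding good_def by simp
            show "(\<integral>z. W T z \<partial>Q) \<le> d / 2 ^ K"
              using EW[of T] measure_links[OF T] by (simp add: d_def)
          qed simp
          finally show "\<bar>emp m (W (orthant u)) \<omega> - emp m (W (lower k0 (cell k0 u))) \<omega>\<bar> \<le> \<delta>"
            using chain dK(2) x(2)[of K] \<open>0 < \<delta>\<close> unfolding c_def L_def by linarith
        qed
      qed simp
    qed
  qed
  then show ?thesis unfolding W_def by blast
qed

text \<open>Up to a small error the process depends only on the cell of \<open>u\<close> at a fixed
  level, so that level is the partition; boundedness then concerns finitely many lower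
  brackets.\<close>

theorem tight_process_emp:
  assumes [measurable]: "w \<in> borel_measurable Q" and w: "\<And>z. 0 \<le> w z" "\<And>z. w z \<le> 1"
  shows "tight_process (\<lambda>m \<omega> u. emp m (\<lambda>z. w z * indicator (orthant u) z) \<omega>)"
  unfolding tight_process_def
proof safe
  fix \<eta> :: real assume "\<eta> > 0"
  then have \<eta>: "\<eta> / 2 > 0" by simp
  define G where "G m A \<omega> = emp m (\<lambda>z. w z * indicator A z) \<omega>" for m A \<omega>
  obtain k where k: "\<forall>\<^sub>F m in sequentially. likely (\<eta>/2) (\<lambda>\<omega>. \<forall>u.
      \<bar>G m (orthant u) \<omega> - G m (lower k (cell k u)) \<omega>\<bar> \<le> \<eta> / 2)"
    using chaining[OF assms \<eta> \<eta>] unfolding G_def by blast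
  have "big_Op (\<lambda>m. G m (lower k c))" for c
    unfolding G_def by (rule big_Op_emp[where b = 1]) (use w in \<open>auto simp: indicator_def abs_le_iff intro: order_trans[OF _ w(1)]\<close>)
  then obtain B where B: "B > 0" "\<forall>\<^sub>F m in sequentially. likely (\<eta>/2)
      (\<lambda>\<omega>. \<forall>c\<in>range (cell k). \<bar>G m (lower k c) \<omega>\<bar> \<le> B)"
    using big_Op_finite[OF finite_range_cell _ \<eta>, of k "\<lambda>c m. G m (lower k c)"] by blast
  define n where "n u = to_nat (cell k u)" for u
  have "range n = to_nat ` range (cell k)" by (auto simp: n_def)
  then have "finite (range n)" using finite_range_cell by simp
  moreover have "\<forall>\<^sub>F m in sequentially. likely \<eta> (\<lambda>\<omega>. (\<forall>u. \<bar>G m (orthant u) \<omega>\<bar> \<le> B + \<eta> / 2) \<and>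
      (\<forall>u v. n u = n v \<longrightarrow> \<bar>G m (orthant u) \<omega> - G m (orthant v) \<omega>\<bar> \<le> \<eta>))"
    using k B(2)
  proof eventually_elim
    case (elim m)
    from likely_conj[OF this] show ?case
    proof (rule likely_mono)
      fix \<omega>
      assume *: "(\<forall>u. \<bar>G m (orthant u) \<omega> - G m (lower k (cell k u)) \<omega>\<bar> \<le> \<eta> / 2) \<and>
        (\<forall>c\<in>range (cell k). \<bar>G m (lower k c) \<omega>\<bar> \<le> B)"
      have 1: "\<bar>G m (orthant u) \<omega> - G m (lower k (cell k u)) \<omega>\<bar> \<le> \<eta> / 2" for u using * by blast
      have 2: "\<bar>G m (lower k (cell k u)) \<omega>\<bar> \<le> B" for u using * by blast
      have "\<bar>G m (orthant u) \<omega>\<bar> \<le> B + \<eta> / 2" for u using 1[of u] 2[of u] by linarith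
      moreover have "\<bar>G m (orthant u) \<omega> - G m (orthant v) \<omega>\<bar> \<le> \<eta>" if "n u = n v" for u v
      proof -
        have "cell k u = cell k v" using that by (simp add: n_def)
        then show ?thesis using 1[of u] 1[of v] by (simp only:)
      qed
      ultimately show "(\<forall>u. \<bar>G m (orthant u) \<omega>\<bar> \<le> B + \<eta> / 2) \<and>
        (\<forall>u v. n u = n v \<longrightarrow> \<bar>G m (orthant u) \<omega> - G m (orthant v) \<omega>\<bar> \<le> \<eta>)" by blast
    qed simp
  qed
  ultimately show "\<exists>(c::('j \<Rightarrow> real) \<Rightarrow> nat) B. finite (range c) \<and> 0 < B \<and>
     (\<forall>\<^sub>F m in sequentially. likely \<eta> (\<lambda>\<omega>.
        (\<forall>u. \<bar>emp m (\<lambda>z. w z * indicator (orthant u) z) \<omega>\<bar> \<le> B) \<and>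
        (\<forall>u v. c u = c v \<longrightarrow> \<bar>emp m (\<lambda>z. w z * indicator (orthant u) z) \<omega>
          - emp m (\<lambda>z. w z * indicator (orthant v) z) \<omega>\<bar> \<le> \<eta>)))"
    unfolding G_def[symmetric] using B(1) \<eta> by (intro exI[of _ n] exI[of _ "B + \<eta> / 2"]) simp
qed

end

section \<open>Weighted empirical distribution functions\<close>

text \<open>The mass is put on the indices and pushed forward by \<open>v\<close>, so coinciding
  points need no treatment of their own.\<close>

lemma is_cdf_weighted:
  fixes v :: "nat \<Rightarrow> (real^'d::finite) \<times> real"
  assumes w: "\<And>i. i < m \<Longrightarrow> 0 \<le> w i" and S: "(\<Sum>i<m. w i) > 0"
  shows "is_cdf (\<lambda>u. (\<Sum>i<m. w i * delta (v i) u) / (\<Sum>i<m. w i))"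
proof -
  define S where "S = (\<Sum>i<m. w i)"
  define P where "P = point_measure {..<m} (\<lambda>i. ennreal (w i / S))"
  have S: "S > 0" using assms(2) by (simp add: S_def)
  have v: "v \<in> measurable P borel" by (simp add: P_def)
  have em: "emeasure P X = ennreal (\<Sum>i\<in>X. w i / S)" if "X \<subseteq> {..<m}" for X
  proof -
    have "emeasure P X = (\<Sum>i\<in>X. ennreal (w i / S))"
      unfolding P_def using that by (intro emeasure_point_measure_finite) auto
    also have "\<dots> = ennreal (\<Sum>i\<in>X. w i / S)" using that S w by (intro sum_ennreal) auto
    finally show ?thesis .
  qed
  have space: "space P = {..<m}" by (simp add: P_def space_point_measure)
  have "(\<Sum>i<m. w i / S) = 1" using S by (simp add: S_def flip: sum_divide_distrib)
  then have "prob_space P" using em[of "{..<m}"] by (intro prob_spaceI) (simp add: space)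
  then have "prob_space (distr P borel v)" using v by (rule prob_space.prob_space_distr)
  moreover have "measure (distr P borel v) {p. fst p \<le> fst u \<and> snd p \<le> snd u}
      = (\<Sum>i<m. w i * delta (v i) u) / S" for u
  proof -
    define A where "A = {i\<in>{..<m}. fst (v i) \<le> fst u \<and> snd (v i) \<le> snd u}"
    have "{p :: (real^'d) \<times> real. fst p \<le> fst u \<and> snd p \<le> snd u} = {..fst u} \<times> {..snd u}" by auto
    then have [measurable]: "{p :: (real^'d) \<times> real. fst p \<le> fst u \<and> snd p \<le> snd u} \<in> sets borel"
      by (simp add: borel_closed closed_Times closed_atMost)
    have "measure (distr P borel v) {p. fst p \<le> fst u \<and> snd p \<le> snd u} = measure P A"
      by (subst measure_distr[OF v]) (auto simp: A_def space intro!: arg_cong[where f = "measure P"])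
    also have "\<dots> = (\<Sum>i\<in>A. w i / S)"
      using em[of A] w S by (auto simp: A_def intro!: measure_eq_emeasure_eq_ennreal sum_nonneg)
    also have "\<dots> = (\<Sum>i<m. w i / S * delta (v i) u)"
      unfolding A_def delta_def by (subst sum.inter_filter) (auto intro!: sum.cong)
    finally show ?thesis by (simp add: sum_divide_distrib)
  qed
  ultimately show ?thesis unfolding is_cdf_def S_def[symmetric]
    by (intro exI[of _ "distr P borel v"]) (simp add: fun_eq_iff)
qed

lemma borel_delta:
  fixes u :: "(real^'d::finite) \<times> real"
  shows "(\<lambda>p. delta p u) \<in> borel_measurable borel"
proof -
  have "{p :: (real^'d) \<times> real. fst p \<le> fst u \<and> snd p \<le> snd u} = {..fst u} \<times> {..snd u}"
    by auto
  then have "{p :: (real^'d) \<times> real. fst p \<le> fst u \<and> snd p \<le> snd u} \<in> sets borel"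
    by (simp add: borel_closed closed_Times closed_atMost)
  then show ?thesis unfolding delta_def of_bool_def by (intro measurable_If) auto
qed

lemma hadamard_derivative_sum:
  assumes D: "has_hadamard_derivative \<Phi> D F" and h: "\<And>i. bounded (range (h i))"
  shows "D (\<lambda>u. \<Sum>i<(m::nat). a i * h i u) = (\<Sum>i<m. a i * D (h i))"
proof (induction m)
  case 0
  have "bounded (range (\<lambda>_::(real^'a) \<times> real. 0 :: real))" by simp
  from hadamard_derivative_linear[OF D this this, of 0 0] show ?case by simp
next
  case (Suc m)
  have "bounded (range (\<lambda>u. \<Sum>i<m. a i * h i u))"
  proof -
    have "\<exists>b. \<forall>u. \<bar>h i u\<bar> \<le> b" for i
      using h[of i] unfolding bounded_iff by (metis rangeI real_norm_def)
    then obtain b where "\<And>i u. \<bar>h i u\<bar> \<le> b i" by metis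
    then have "\<bar>\<Sum>i<m. a i * h i u\<bar> \<le> (\<Sum>i<m. \<bar>a i\<bar> * b i)" for u
      by (intro order_trans[OF sum_abs] sum_mono) (simp add: abs_mult mult_left_mono)
    then show ?thesis unfolding bounded_iff by auto
  qed
  from hadamard_derivative_linear[OF D this h, of 1 "a m" m] show ?case using Suc by simp
qed

lemma (in prob_space) tight_process_reindex:
  assumes "tight_process H"
  shows "tight_process (\<lambda>m \<omega> u. H m \<omega> (\<kappa> u))"
  unfolding tight_process_def
proof safe
  fix \<eta> :: real assume "\<eta> > 0"
  obtain c :: "'b \<Rightarrow> nat" and B where c: "finite (range c)" "0 < B" and
    ev: "\<forall>\<^sub>F m in sequentially. likely \<eta> (\<lambda>\<omega>. (\<forall>u. \<bar>H m \<omega> u\<bar> \<le> B) \<and>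
        (\<forall>u v. c u = c v \<longrightarrow> \<bar>H m \<omega> u - H m \<omega> v\<bar> \<le> \<eta>))"
    by (rule tight_processE[OF assms \<open>\<eta> > 0\<close> \<open>\<eta> > 0\<close>])
  have "finite (range (\<lambda>u. c (\<kappa> u)))" by (rule finite_subset[OF _ c(1)]) auto
  moreover have "\<forall>\<^sub>F m in sequentially. likely \<eta> (\<lambda>\<omega>. (\<forall>u. \<bar>H m \<omega> (\<kappa> u)\<bar> \<le> B) \<and>
        (\<forall>u v. c (\<kappa> u) = c (\<kappa> v) \<longrightarrow> \<bar>H m \<omega> (\<kappa> u) - H m \<omega> (\<kappa> v)\<bar> \<le> \<eta>))"
    using ev
  proof eventually_elim
    case (elim m)
    then show ?case by (rule likely_mono) auto
  qed
  ultimately show "\<exists>(c::_ \<Rightarrow> nat) B. finite (range c) \<and> 0 < B \<and>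
     (\<forall>\<^sub>F m in sequentially. likely \<eta> (\<lambda>\<omega>. (\<forall>u. \<bar>H m \<omega> (\<kappa> u)\<bar> \<le> B) \<and>
        (\<forall>u v. c u = c v \<longrightarrow> \<bar>H m \<omega> (\<kappa> u) - H m \<omega> (\<kappa> v)\<bar> \<le> \<eta>)))"
    using c(2) by (intro exI[of _ "\<lambda>u. c (\<kappa> u)"] exI[of _ B]) simp
qed

context iid_sample
begin

lemma measurable_delta:
  fixes V :: "'b \<Rightarrow> (real^'d::finite) \<times> real"
  assumes "V \<in> borel_measurable Q"
  shows "(\<lambda>z. delta (V z) u) \<in> borel_measurable Q"
  by (rule measurable_compose[OF assms borel_delta])

text \<open>The componentwise order on a pair becomes a single orthant over the index type
  \<open>'d option\<close>, with \<open>None\<close> for the last coordinate.\<close>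

lemma tight_process_emp_delta:
  fixes V :: "'b \<Rightarrow> (real^'d::finite) \<times> real"
  assumes space: "space Q = UNIV"
    and V: "V \<in> borel_measurable Q" and w: "w \<in> borel_measurable Q" "\<And>z. 0 \<le> w z" "\<And>z. w z \<le> 1"
  shows "tight_process (\<lambda>m \<omega> u. emp m (\<lambda>z. w z * delta (V z) u) \<omega>)"
proof -
  define g where "g j z = (case j of None \<Rightarrow> snd (V z) | Some i \<Rightarrow> fst (V z) $ i)" for j z
  have g: "g j \<in> borel_measurable Q" for j
  proof (cases j)
    case None
    have "(\<lambda>p :: (real^'d) \<times> real. snd p) \<in> borel_measurable borel"
      by (intro borel_measurable_continuous_onI continuous_intros)
    from measurable_compose[OF V this] show ?thesis by (simp add: g_def[abs_def] None)
  next
    case (Some i)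
    have "(\<lambda>p :: (real^'d) \<times> real. fst p $ i) \<in> borel_measurable borel"
      by (intro borel_measurable_continuous_onI continuous_intros)
    from measurable_compose[OF V this] show ?thesis by (simp add: g_def[abs_def] Some)
  qed
  interpret orthant_sample M Q Z g by unfold_locales (rule g)
  define \<kappa> where "\<kappa> u j = (case j of None \<Rightarrow> snd u | Some i \<Rightarrow> fst u $ i)"
    for u :: "(real^'d) \<times> real" and j
  have delta: "delta (V z) u = indicator (orthant (\<kappa> u)) z" for z u
    unfolding delta_def orthant_def g_def \<kappa>_def
    by (auto simp: space indicator_def less_eq_vec_def split: option.splits)
  show "tight_process (\<lambda>m \<omega> u. emp m (\<lambda>z. w z * delta (V z) u) \<omega>)"
    unfolding delta by (rule tight_process_reindex[OF tight_process_emp[OF w]])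
qed

lemma emp_eq: "m > 0 \<Longrightarrow> (\<Sum>i<m. g (Z i \<omega>)) = sqrt m * emp m g \<omega> + m * (\<integral>z. g z \<partial>Q)"
  by (simp add: emp_def sum_subtractf)

text \<open>That the influence function has mean zero is a consequence of the uniform law of large
  numbers: \<open>D\<close> need not commute with integration.\<close>

lemma weighted_edf_expansion_aux:
  fixes V :: "'b \<Rightarrow> (real^'d::finite) \<times> real" and D :: "'d dfun \<Rightarrow> real"
  assumes space: "space Q = UNIV"
    and [measurable]: "V \<in> borel_measurable Q" "w \<in> borel_measurable Q" "\<psi> \<in> borel_measurable Q"
    and w: "\<And>z. 0 \<le> w z" "\<And>z. w z \<le> 1"
    and p: "p = (\<integral>z. w z \<partial>Q)" "p > 0"
    and F: "\<And>u. F u = (\<integral>z. w z * delta (V z) u \<partial>Q) / p"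
    and D: "has_hadamard_derivative \<Phi> D F"
    and \<psi>: "\<And>z. \<psi> z = D (\<lambda>u. delta (V z) u - F u)"
  shows "small_op (\<lambda>m \<omega>. sqrt m *
      (\<Phi> (\<lambda>u. (\<Sum>i<m. w (Z i \<omega>) * delta (V (Z i \<omega>)) u) / (\<Sum>i<m. w (Z i \<omega>))) - \<Phi> F)
      - emp m (\<lambda>z. w z * \<psi> z) \<omega> / p)"
proof -
  define Fm where
    "Fm m \<omega> u = (\<Sum>i<m. w (Z i \<omega>) * delta (V (Z i \<omega>)) u) / (\<Sum>i<m. w (Z i \<omega>))" for m \<omega> u
  define Wbar where "Wbar m \<omega> = p + emp m w \<omega> / sqrt m" for m \<omega>
  \<comment> \<open>Fluctuation of the numerator minus the part explained by the denominator. With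
    this choice \<open>F + H / sqrt m\<close> equals the weighted distribution function exactly
    whenever the total weight is positive; no second-order remainder arises.\<close>
  define H where "H m \<omega> u = inverse (Wbar m \<omega>) *
      (emp m (\<lambda>z. w z * delta (V z) u) \<omega> - emp m w \<omega> * F u)" for m \<omega> u
  have [measurable]: "(\<lambda>z. delta (V z) u) \<in> borel_measurable Q" for u
    by (rule measurable_delta) simp
  have delta01: "0 \<le> delta q u" "delta q u \<le> 1" for q and u :: "(real^'d) \<times> real"
    by (auto simp: delta_def)
  have wd: "0 \<le> w z * delta (V z) u" "w z * delta (V z) u \<le> w z" for z u
    using w[of z] delta01[of "V z" u] by (auto simp: mult_left_le)
  have iw: "integrable Q w" using w by (intro integrable_bounded[where b = 1]) auto
  have iwd: "integrable Q (\<lambda>z. w z * delta (V z) u)" for u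
  proof (rule integrable_bounded)
    show "\<bar>w z * delta (V z) u\<bar> \<le> 1" for z
      using wd(1)[of z u] order_trans[OF wd(2)[of z u] w(2)[of z]] by simp
  qed simp
  have F01: "0 \<le> F u" "F u \<le> 1" for u
  proof -
    have "0 \<le> (\<integral>z. w z * delta (V z) u \<partial>Q)" using wd(1) by simp
    then show "0 \<le> F u" using p by (simp add: F)
    have "(\<integral>z. w z * delta (V z) u \<partial>Q) \<le> p" unfolding p(1) by (intro integral_mono iw iwd wd)
    then show "F u \<le> 1" using p by (simp add: F)
  qed
  have bw: "big_Op (\<lambda>m. emp m w)" using w by (intro big_Op_emp[where b = 1]) auto
  have s0: "(\<lambda>m. inverse (sqrt (real m))) \<longlonglongrightarrow> 0"
    by (intro tendsto_inverse_0_at_top filterlim_compose[OF sqrt_at_top] filterlim_real_sequentially)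
  have Wsmall: "small_op (\<lambda>m \<omega>. Wbar m \<omega> - p)"
    using small_op_mult[OF small_op_seq[OF s0] bw] by (simp add: Wbar_def field_simps)
  have inv: "small_op (\<lambda>m \<omega>. inverse (Wbar m \<omega>) - inverse p)"
    by (rule small_op_continuous[OF Wsmall DERIV_isCont[OF DERIV_inverse]]) (use p(2) in simp)
  have invO: "big_Op (\<lambda>m \<omega>. inverse (Wbar m \<omega>))"
    using big_Op_add[OF small_op_imp_big_Op[OF inv] big_Op_const[of "inverse p"]] by simp
  have WO: "big_Op Wbar"
    using big_Op_add[OF small_op_imp_big_Op[OF Wsmall] big_Op_const[of p]] by simp
  have tight: "tight_process H"
    unfolding H_def
    by (intro tight_process_scale invO tight_process_diff tight_process_emp_delta[OF space] bw
        tight_process_const w F01) auto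
  have good: "whp (\<lambda>m \<omega>. 0 < Wbar m \<omega> \<and> 0 < m)"
  proof (rule whp_eventually)
    show "whp (\<lambda>m \<omega>. \<bar>Wbar m \<omega> - p\<bar> \<le> p / 2)" using small_opD[OF Wsmall, of "p / 2"] p by simp
    show "\<forall>\<^sub>F m in sequentially. \<forall>\<omega>\<in>space M. \<bar>Wbar m \<omega> - p\<bar> \<le> p / 2 \<longrightarrow> 0 < Wbar m \<omega> \<and> 0 < m"
      using eventually_gt_at_top[of 0] by eventually_elim (use p(2) in \<open>safe, linarith+\<close>)
  qed
  have sumw: "(\<Sum>i<m. w (Z i \<omega>)) = m * Wbar m \<omega>" if "m > 0" for m \<omega>
  proof -
    have "sqrt m * emp m w \<omega> = m * (emp m w \<omega> / sqrt m)" using that by (simp add: field_simps)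
    then show ?thesis using emp_eq[OF that, of w \<omega>] p by (simp add: Wbar_def algebra_simps)
  qed
  have Fm: "Fm m \<omega> u = F u + H m \<omega> u / sqrt m" if m: "m > 0" and W: "Wbar m \<omega> > 0" for m \<omega> u
  proof -
    define s where "s = sqrt m"
    have s: "s > 0" "real m = s * s" using m by (simp_all add: s_def)
    define G where "G = emp m (\<lambda>z. w z * delta (V z) u) \<omega>"
    have EF: "(\<integral>z. w z * delta (V z) u \<partial>Q) = p * F u" using p by (simp add: F)
    have "(\<Sum>i<m. w (Z i \<omega>) * delta (V (Z i \<omega>)) u) = s * G + real m * (p * F u)"
      using emp_eq[OF m, of "\<lambda>z. w z * delta (V z) u" \<omega>] unfolding EF G_def s_def .
    then have "Fm m \<omega> u = (s * G + s * s * (p * F u)) / (s * s * Wbar m \<omega>)"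
      unfolding Fm_def sumw[OF m] s(2) by simp
    also have "\<dots> = F u + (G - emp m w \<omega> * F u) / (Wbar m \<omega> * s)"
    proof -
      have e: "emp m w \<omega> = (Wbar m \<omega> - p) * s" using s(1) by (simp add: Wbar_def flip: s_def)
      show ?thesis unfolding e using s W by (simp add: field_simps)
    qed
    finally show ?thesis by (simp add: H_def G_def s_def field_simps)
  qed
  have "whp (\<lambda>m \<omega>. is_cdf (\<lambda>u. F u + H m \<omega> u / sqrt m))"
  proof (rule whp_mono[OF good])
    fix m \<omega> assume "0 < Wbar m \<omega> \<and> 0 < m"
    then have W: "0 < Wbar m \<omega>" and m: "0 < m" by auto
    have "is_cdf (Fm m \<omega>)"
      unfolding Fm_def by (rule is_cdf_weighted) (use w sumw[OF m] W m in auto)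
    moreover have "Fm m \<omega> = (\<lambda>u. F u + H m \<omega> u / sqrt m)" using Fm[OF m W] by (simp add: fun_eq_iff)
    ultimately show "is_cdf (\<lambda>u. F u + H m \<omega> u / sqrt m)" by simp
  qed
  from functional_delta_method[OF D tight this]
  have delta_m: "small_op (\<lambda>m \<omega>. sqrt m * (\<Phi> (\<lambda>u. F u + H m \<omega> u / sqrt m) - \<Phi> F) - D (H m \<omega>))" .
  obtain K where K: "K > 0" "\<And>h b. (\<And>u. \<bar>h u\<bar> \<le> b) \<Longrightarrow> \<bar>D h\<bar> \<le> K * b"
    using hadamard_derivative_bound[OF D] by blast
  have db: "\<bar>delta q u - F u\<bar> \<le> 1" for q u using delta01[of q u] F01[of u] by linarith
  have db': "bounded (range (\<lambda>u. delta q u - F u))" for q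
    unfolding bounded_iff real_norm_def using db[of q] by blast
  have \<psi>b: "\<bar>\<psi> z\<bar> \<le> K" for z using K(2)[of _ 1, OF db] by (simp add: \<psi>)
  have w\<psi>: "\<bar>w z * \<psi> z\<bar> \<le> K" for z
    unfolding abs_mult using w[of z] \<psi>b[of z] K(1) mult_mono[of "\<bar>w z\<bar>" 1 "\<bar>\<psi> z\<bar>" K] by simp
  define \<mu> where "\<mu> = (\<integral>z. w z * \<psi> z \<partial>Q)"
  have bO: "big_Op (\<lambda>m. emp m (\<lambda>z. w z * \<psi> z))" by (rule big_Op_emp[OF _ w\<psi>]) simp
  \<comment> \<open>The paths are finite combinations of centred point indicators, so linearity
    alone evaluates \<open>D\<close> at them. A nonzero mean \<open>\<mu>\<close> would show up with
    the factor \<open>sqrt m\<close>.\<close>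
  have DH: "D (H m \<omega>) = inverse (Wbar m \<omega>) * (emp m (\<lambda>z. w z * \<psi> z) \<omega> + sqrt m * \<mu>)"
    if m: "m > 0" and W: "Wbar m \<omega> > 0" for m \<omega>
  proof -
    have S: "(\<Sum>i<m. w (Z i \<omega>)) > 0" using sumw[OF m] m W by simp
    have "H m \<omega> = (\<lambda>u. \<Sum>i<m. (sqrt m / (\<Sum>i<m. w (Z i \<omega>)) * w (Z i \<omega>)) *
        (delta (V (Z i \<omega>)) u - F u))"
    proof
      fix u
      have "H m \<omega> u = sqrt m * (Fm m \<omega> u - F u)" using Fm[OF m W, of u] m by simp
      also have "Fm m \<omega> u - F u
          = (\<Sum>i<m. w (Z i \<omega>) * (delta (V (Z i \<omega>)) u - F u)) / (\<Sum>i<m. w (Z i \<omega>))"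
        using S by (simp add: Fm_def right_diff_distrib sum_subtractf diff_divide_distrib
            flip: sum_distrib_right)
      finally show "H m \<omega> u = (\<Sum>i<m. (sqrt m / (\<Sum>i<m. w (Z i \<omega>)) * w (Z i \<omega>)) *
          (delta (V (Z i \<omega>)) u - F u))"
        by (simp add: sum_distrib_left sum_divide_distrib mult_ac)
    qed
    then have "D (H m \<omega>) = (\<Sum>i<m. (sqrt m / (\<Sum>i<m. w (Z i \<omega>)) * w (Z i \<omega>)) * \<psi> (Z i \<omega>))"
      by (simp only: hadamard_derivative_sum[OF D db'] \<psi>)
    also have "\<dots> = sqrt m / (\<Sum>i<m. w (Z i \<omega>)) * (\<Sum>i<m. w (Z i \<omega>) * \<psi> (Z i \<omega>))"
      by (simp add: sum_distrib_left mult.assoc)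
    also have "\<dots> = sqrt m / (m * Wbar m \<omega>) * (sqrt m * emp m (\<lambda>z. w z * \<psi> z) \<omega> + m * \<mu>)"
      unfolding sumw[OF m] using emp_eq[OF m, of "\<lambda>z. w z * \<psi> z" \<omega>] by (simp add: \<mu>_def)
    also have "\<dots> = inverse (Wbar m \<omega>) * (emp m (\<lambda>z. w z * \<psi> z) \<omega> + sqrt m * \<mu>)"
    proof -
      define s where "s = sqrt m"
      have s: "s > 0" "real m = s * s" using m by (simp_all add: s_def)
      show ?thesis unfolding s_def[symmetric] s(2) using s(1) W by (simp add: field_simps)
    qed
    finally show ?thesis .
  qed
  have "\<mu> = 0"
  proof -
    have "big_Op (\<lambda>m \<omega>. D (H m \<omega>))"
      unfolding big_Op_def
    proof safe
      fix \<eta> :: real assume "\<eta> > 0"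
      then obtain B where B: "0 < B" "\<forall>\<^sub>F m in sequentially. likely \<eta> (\<lambda>\<omega>. \<forall>u. \<bar>H m \<omega> u\<bar> \<le> B)"
      proof -
        obtain c :: "(real^'d) \<times> real \<Rightarrow> nat" and B where "0 < B" and
          ev: "\<forall>\<^sub>F m in sequentially. likely \<eta> (\<lambda>\<omega>. (\<forall>u. \<bar>H m \<omega> u\<bar> \<le> B) \<and>
            (\<forall>u v. c u = c v \<longrightarrow> \<bar>H m \<omega> u - H m \<omega> v\<bar> \<le> \<eta>))"
          by (rule tight_processE[OF tight \<open>\<eta> > 0\<close> \<open>\<eta> > 0\<close>])
        have "\<forall>\<^sub>F m in sequentially. likely \<eta> (\<lambda>\<omega>. \<forall>u. \<bar>H m \<omega> u\<bar> \<le> B)"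
          using ev by (rule eventually_mono) (erule likely_mono, simp_all)
        then show thesis using that \<open>0 < B\<close> by blast
      qed
      have "\<forall>\<^sub>F m in sequentially. likely \<eta> (\<lambda>\<omega>. \<bar>D (H m \<omega>)\<bar> \<le> K * B)"
        using B(2) by (rule eventually_mono) (erule likely_mono, auto intro: K(2))
      then show "\<exists>B>0. \<forall>\<^sub>F m in sequentially. likely \<eta> (\<lambda>\<omega>. \<bar>D (H m \<omega>)\<bar> \<le> B)"
        using K(1) B(1) by (intro exI[of _ "K * B"]) simp
    qed
    \<comment> \<open>With high probability this expression equals \<open>\<mu>\<close>, while both
      of its terms vanish: the values of \<open>D\<close> and the centred sum are bounded in
      probability and are divided by \<open>sqrt m\<close>.\<close>
    then have "small_op (\<lambda>m \<omega>. inverse (sqrt m) * D (H m \<omega>) * Wbar m \<omega>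
        + (-1) * (inverse (sqrt m) * emp m (\<lambda>z. w z * \<psi> z) \<omega>))"
      by (intro small_op_add small_op_mult[OF small_op_mult[OF small_op_seq[OF s0]] WO]
          small_op_mult[OF small_op_mult[OF small_op_seq[OF s0] bO] big_Op_const, of "-1", simplified mult.commute[of _ "-1"]])
    then have "small_op (\<lambda>_ _. \<mu>)"
      by (rule small_op_cong) (rule whp_mono[OF good], simp add: DH field_simps)
    then show ?thesis by (rule small_op_const_zero)
  qed
  \<comment> \<open>Adding the second term trades the random normalisation in
    \<open>D (H m \<omega>)\<close> for the constant \<open>p\<close>.\<close>
  have "small_op (\<lambda>m \<omega>. (sqrt m * (\<Phi> (\<lambda>u. F u + H m \<omega> u / sqrt m) - \<Phi> F) - D (H m \<omega>))
      + (inverse (Wbar m \<omega>) - inverse p) * emp m (\<lambda>z. w z * \<psi> z) \<omega>)"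
    by (intro small_op_add delta_m small_op_mult[OF inv bO])
  then have "small_op (\<lambda>m \<omega>. sqrt m * (\<Phi> (Fm m \<omega>) - \<Phi> F) - emp m (\<lambda>z. w z * \<psi> z) \<omega> / p)"
  proof (rule small_op_cong, intro whp_mono[OF good])
    fix m \<omega> assume "0 < Wbar m \<omega> \<and> 0 < m"
    then have W: "0 < Wbar m \<omega>" and m: "0 < m" by auto
    have "Fm m \<omega> = (\<lambda>u. F u + H m \<omega> u / sqrt m)" using Fm[OF m W] by (simp add: fun_eq_iff)
    then show "(sqrt m * (\<Phi> (\<lambda>u. F u + H m \<omega> u / sqrt m) - \<Phi> F) - D (H m \<omega>))
      + (inverse (Wbar m \<omega>) - inverse p) * emp m (\<lambda>z. w z * \<psi> z) \<omega>
      = sqrt m * (\<Phi> (Fm m \<omega>) - \<Phi> F) - emp m (\<lambda>z. w z * \<psi> z) \<omega> / p"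
      using DH[OF m W] \<open>\<mu> = 0\<close> by (simp add: algebra_simps divide_inverse)
  qed
  then show ?thesis by (simp add: Fm_def[abs_def])
qed

text \<open>Passes from pointwise to almost everywhere bounds on the weights: truncation to [0, 1]
  changes neither the integrals nor, almost surely, the weights along the whole sample.\<close>

lemma weighted_edf_expansion:
  fixes V :: "'b \<Rightarrow> (real^'d::finite) \<times> real" and D :: "'d dfun \<Rightarrow> real"
  assumes space: "space Q = UNIV"
    and [measurable]: "V \<in> borel_measurable Q" "w \<in> borel_measurable Q" "\<psi> \<in> borel_measurable Q"
    and w: "AE z in Q. 0 \<le> w z \<and> w z \<le> 1"
    and p: "p = (\<integral>z. w z \<partial>Q)" "p > 0"
    and F: "\<And>u. F u = (\<integral>z. w z * delta (V z) u \<partial>Q) / p"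
    and D: "has_hadamard_derivative \<Phi> D F"
    and \<psi>: "\<And>z. \<psi> z = D (\<lambda>u. delta (V z) u - F u)"
  shows "small_op (\<lambda>m \<omega>. sqrt m *
      (\<Phi> (\<lambda>u. (\<Sum>i<m. w (Z i \<omega>) * delta (V (Z i \<omega>)) u) / (\<Sum>i<m. w (Z i \<omega>))) - \<Phi> F)
      - emp m (\<lambda>z. w z * \<psi> z) \<omega> / p)"
proof -
  define w' where "w' z = max 0 (min 1 (w z))" for z
  have [measurable]: "w' \<in> borel_measurable Q" by (simp add: w'_def[abs_def])
  have w'01: "0 \<le> w' z" "w' z \<le> 1" for z by (auto simp: w'_def)
  have [measurable]: "(\<lambda>z. delta (V z) u) \<in> borel_measurable Q" for u
    by (rule measurable_delta) simp
  have eq: "AE z in Q. w' z = w z" using w by eventually_elim (simp add: w'_def)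
  have p': "p = (\<integral>z. w' z \<partial>Q)"
    unfolding p(1) by (rule integral_cong_AE) (use eq in \<open>auto elim: eventually_mono\<close>)
  have F': "F u = (\<integral>z. w' z * delta (V z) u \<partial>Q) / p" for u
    unfolding F by (intro arg_cong2[where f = "(/)"] integral_cong_AE refl)
      (use eq in \<open>auto elim: eventually_mono\<close>)
  have "AE \<omega> in M. \<forall>i. w' (Z i \<omega>) = w (Z i \<omega>)"
    using AE_sample[OF eq] by (simp add: AE_all_countable)
  moreover have "AE \<omega> in M. emp m (\<lambda>z. w' z * \<psi> z) \<omega> = emp m (\<lambda>z. w z * \<psi> z) \<omega>" for m
    by (rule emp_AE_cong) (use eq in \<open>auto elim: eventually_mono\<close>)
  ultimately have "AE \<omega> in M. sqrt m *
      (\<Phi> (\<lambda>u. (\<Sum>i<m. w' (Z i \<omega>) * delta (V (Z i \<omega>)) u) / (\<Sum>i<m. w' (Z i \<omega>))) - \<Phi> F)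
      - emp m (\<lambda>z. w' z * \<psi> z) \<omega> / p = sqrt m *
      (\<Phi> (\<lambda>u. (\<Sum>i<m. w (Z i \<omega>) * delta (V (Z i \<omega>)) u) / (\<Sum>i<m. w (Z i \<omega>))) - \<Phi> F)
      - emp m (\<lambda>z. w z * \<psi> z) \<omega> / p" for m
    by (rule eventually_elim2) (use p in simp)
  then show ?thesis
    by (intro small_op_cong[OF weighted_edf_expansion_aux[OF space _ _ _ w'01 p' p(2) F' D \<psi>]] whp_AE) auto
qed

end

section \<open>The augmented estimator\<close>

lemma covariance_AE_cong:
  assumes "AE z in N. U z = U' z" "AE z in N. V z = V' z"
    and [measurable]: "U \<in> borel_measurable N" "U' \<in> borel_measurable N"
      "V \<in> borel_measurable N" "V' \<in> borel_measurable N"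
  shows "covariance N U V = covariance N U' V'"
proof -
  have "(\<integral>z. U z \<partial>N) = (\<integral>z. U' z \<partial>N)" "(\<integral>z. V z \<partial>N) = (\<integral>z. V' z \<partial>N)"
    by (rule integral_cong_AE; use assms in simp)+
  then show ?thesis unfolding covariance_def
    by (intro integral_cong_AE) (use assms(1,2) in \<open>auto elim: eventually_elim2\<close>)
qed

lemma variance_eq_covariance: "prob_space.variance N U = covariance N U U"
  by (simp add: covariance_def power2_eq_square)

lemma covariance_uminus_right: "covariance N U (\<lambda>z. - V z) = - covariance N U V"
proof -
  have "(U z - (\<integral>w. U w \<partial>N)) * (- V z - (\<integral>w. - V w \<partial>N))
      = - ((U z - (\<integral>w. U w \<partial>N)) * (V z - (\<integral>w. V w \<partial>N)))" for z
    by (simp add: algebra_simps)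
  then show ?thesis by (simp add: covariance_def)
qed

lemma (in prob_space) variance_linear_combination:
  assumes [measurable]: "U \<in> borel_measurable M" "V \<in> borel_measurable M"
    and b: "\<And>z. \<bar>U z\<bar> \<le> b" "\<And>z. \<bar>V z\<bar> \<le> b"
  shows "variance (\<lambda>z. (U z + c * V z) / p)
    = (variance U + 2 * c * covariance M U V + c\<^sup>2 * variance V) / p\<^sup>2"
proof -
  define u where "u z = U z - expectation U" for z
  define v where "v z = V z - expectation V" for z
  have i: "integrable M U" "integrable M V"
    using b by (auto intro!: integrable_const_bound[where B = b])
  have [measurable]: "u \<in> borel_measurable M" "v \<in> borel_measurable M"
    by (simp_all add: u_def[abs_def] v_def[abs_def])
  define B where "B = b + \<bar>expectation U\<bar> + \<bar>expectation V\<bar>"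
  have uv: "\<bar>u z\<bar> \<le> B" "\<bar>v z\<bar> \<le> B" for z
    using b[of z] by (auto simp: u_def v_def B_def)
  have int: "integrable M (\<lambda>z. x z * y z)"
    if [measurable]: "x \<in> borel_measurable M" "y \<in> borel_measurable M"
      and "\<And>z. \<bar>x z\<bar> \<le> B" "\<And>z. \<bar>y z\<bar> \<le> B" for x y :: "'a \<Rightarrow> real"
  proof (rule integrable_const_bound[where B = "B * B"], rule AE_I2)
    fix z
    have "\<bar>x z\<bar> * \<bar>y z\<bar> \<le> B * B" by (rule mult_mono') (use that in auto)
    then show "norm (x z * y z) \<le> B * B" by (simp only: real_norm_def abs_mult)
  qed measurable
  have ii: "integrable M (\<lambda>z. u z * u z)" "integrable M (\<lambda>z. u z * v z)" "integrable M (\<lambda>z. v z * v z)"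
    by (intro int uv; measurable)+
  have E: "expectation (\<lambda>z. (U z + c * V z) / p) = (expectation U + c * expectation V) / p"
    using i by simp
  have "((U z + c * V z) / p - (expectation U + c * expectation V) / p)\<^sup>2
      = (u z * u z + 2 * c * (u z * v z) + c\<^sup>2 * (v z * v z)) / p\<^sup>2" for z
  proof -
    have "(U z + c * V z) / p - (expectation U + c * expectation V) / p = (u z + c * v z) / p"
      by (simp add: u_def v_def algebra_simps flip: diff_divide_distrib)
    moreover have "(u z + c * v z)\<^sup>2 = u z * u z + 2 * c * (u z * v z) + c\<^sup>2 * (v z * v z)"
      by (simp add: power2_eq_square algebra_simps)
    ultimately show ?thesis by (simp add: power_divide)
  qed
  then have "variance (\<lambda>z. (U z + c * V z) / p)
      = expectation (\<lambda>z. (u z * u z + 2 * c * (u z * v z) + c\<^sup>2 * (v z * v z)) / p\<^sup>2)"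
    unfolding E by simp
  also have "\<dots> = (expectation (\<lambda>z. u z * u z) + 2 * c * expectation (\<lambda>z. u z * v z)
      + c\<^sup>2 * expectation (\<lambda>z. v z * v z)) / p\<^sup>2"
    using ii by simp
  finally show ?thesis by (simp add: u_def v_def covariance_def power2_eq_square)
qed

lemma real_distribution_normal_law:
  assumes "0 \<le> v"
  shows "real_distribution (normal_law \<mu> v)"
proof (cases "v = 0")
  case True
  interpret prob_space "return borel \<mu>" by (rule prob_space_return) simp
  show ?thesis using True by (simp add: normal_law_def) (unfold_locales, simp_all)
next
  case False
  then have "prob_space (density lborel (normal_density \<mu> (sqrt v)))"
    using assms by (intro prob_space_normal_density) simp
  then interpret prob_space "density lborel (normal_density \<mu> (sqrt v))" .
  show ?thesis using False by (simp add: normal_law_def) (unfold_locales, simp_all)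
qed

section \<open>Labelled observations and the propensity identity\<close>

locale observations = prob_space Q for Q :: "'d::finite obs measure" +
  assumes sets_Q: "sets Q = sets borel"
    and binary_C: "AE z in Q. obsC z \<in> {0, 1}"
begin

lemma space_Q: "space Q = UNIV"
  using sets_eq_imp_space_eq[OF sets_Q] by simp

lemma measurable_borel_Q: "g \<in> borel_measurable borel \<Longrightarrow> g \<in> borel_measurable Q"
  by (simp add: measurable_cong_sets[OF sets_Q refl])

lemma measurable_obs [measurable]:
  "obsX \<in> borel_measurable Q" "obsC \<in> borel_measurable Q" "obsY \<in> borel_measurable Q"
  by (intro measurable_borel_Q borel_measurable_continuous_onI continuous_intros)+

text \<open>A version of \<open>obsC\<close> with values in {0, 1} everywhere and not only almost
  everywhere, as the pointwise bounds on the summands require.\<close>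

definition labeled :: "'d obs \<Rightarrow> real" where "labeled z = indicator {z. obsC z = 1} z"

lemma measurable_labeled [measurable]: "labeled \<in> borel_measurable Q"
  unfolding labeled_def[abs_def] by measurable

lemma labeled_bounds: "0 \<le> labeled z" "labeled z \<le> 1"
  by (simp_all add: labeled_def)

lemma AE_labeled: "AE z in Q. labeled z = obsC z"
  using binary_C by eventually_elim (auto simp: labeled_def)

lemma integral_obsC_indicator:
  assumes "{z. P z} \<in> sets Q"
  shows "(\<integral>z. obsC z * of_bool (P z) \<partial>Q) = prob {z\<in>space Q. P z \<and> obsC z = 1}"
proof -
  have [measurable]: "Measurable.pred Q P" using assms by (simp add: pred_def space_Q)
  have "(\<integral>z. obsC z * of_bool (P z) \<partial>Q) = (\<integral>z. indicator {z\<in>space Q. P z \<and> obsC z = 1} z \<partial>Q)"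
    by (rule integral_cong_AE, measurable)
      (use binary_C in \<open>auto simp: space_Q indicator_def elim!: eventually_mono\<close>)
  then show ?thesis by simp
qed

lemma integral_obsC: "(\<integral>z. obsC z \<partial>Q) = prob {z\<in>space Q. obsC z = 1}"
  using integral_obsC_indicator[of "\<lambda>_. True"] sets.top[of Q] by (simp add: space_Q)

lemma sets_delta:
  assumes "(\<lambda>z. delta (V z) u) \<in> borel_measurable Q"
  shows "{z. fst (V z) \<le> fst u \<and> snd (V z) \<le> snd u} \<in> sets Q"
proof -
  have "{z. fst (V z) \<le> fst u \<and> snd (V z) \<le> snd u} = {z\<in>space Q. delta (V z) u = 1}"
    by (auto simp: space_Q delta_def)
  also have "\<dots> \<in> sets Q" using assms by measurable
  finally show ?thesis .
qed

text \<open>Brings the conditional distribution functions into the weighted form of the expansion,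
  with weight \<open>C\<close>.\<close>

lemma cond_cdf_eq:
  assumes "(\<lambda>z. delta (V z) u) \<in> borel_measurable Q"
  shows "\<P>(z in Q. fst (V z) \<le> fst u \<and> snd (V z) \<le> snd u \<bar> obsC z = 1)
    = (\<integral>z. obsC z * delta (V z) u \<partial>Q) / (\<integral>z. obsC z \<partial>Q)"
  unfolding cond_prob_def integral_obsC delta_def integral_obsC_indicator[OF sets_delta[OF assms]] ..

lemma cond_prob_le_1: "\<P>(z in Q. P z \<bar> obsC z = 1) \<le> 1"
proof -
  have "prob {z\<in>space Q. P z \<and> obsC z = 1} \<le> prob {z\<in>space Q. obsC z = 1}"
    by (rule finite_measure_mono) auto
  then show ?thesis unfolding cond_prob_def by (intro divide_le_eq_1[THEN iffD2]) (auto simp: zero_less_measure_iff)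
qed

text \<open>The defining property of conditional expectation, tested against bounded functions of
  \<open>X\<close>. It makes the weights \<open>C\<close> and \<open>\<pi>(X)\<close>
  interchangeable in population quantities of \<open>(X, f(X))\<close>.\<close>

lemma integral_propensity:
  assumes \<pi>: "is_propensity Q \<pi>"
    and h: "h \<in> borel_measurable borel" "\<And>x. \<bar>h x\<bar> \<le> b"
  shows "(\<integral>z. \<pi> (obsX z) * h (obsX z) \<partial>Q) = (\<integral>z. obsC z * h (obsX z) \<partial>Q)"
proof -
  have [measurable]: "\<pi> \<in> borel_measurable borel" using \<pi> by (simp add: is_propensity_def)
  note [measurable] = h(1)
  have X: "obsX \<in> measurable (sigmaX Q) borel"
    unfolding sigmaX_def by (rule measurable_vimage_algebra1) simp
  have "sets (sigmaX Q) \<subseteq> sets Q"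
    unfolding sigmaX_def using measurable_sets[OF measurable_obs(1)]
    by (subst sets_vimage_algebra2) auto
  then have "subalgebra Q (sigmaX Q)" by (simp add: subalgebra_def sigmaX_def)
  then interpret S: finite_measure_subalgebra Q "sigmaX Q" by unfold_locales
  have C1: "{z. obsC z = 1} \<in> sets Q"
  proof -
    have "{z\<in>space Q. obsC z = 1} \<in> sets Q" by measurable
    then show ?thesis by (simp add: space_Q)
  qed
  then have ind [measurable]: "indicat_real {z. obsC z = 1} \<in> borel_measurable Q" by simp
  have hX: "(\<lambda>z. h (obsX z)) \<in> borel_measurable (sigmaX Q)"
    by (rule measurable_compose[OF X h(1)])
  have "integrable Q (\<lambda>z. h (obsX z) * indicator {z. obsC z = 1} z)"
    by (rule integrable_const_bound[where B = b]) (use h(2) in \<open>auto simp: indicator_def intro: order_trans[OF abs_ge_zero]\<close>)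
  from S.real_cond_exp_intg(2)[OF this hX ind]
  have "(\<integral>z. h (obsX z) * real_cond_exp Q (sigmaX Q) (indicator {z. obsC z = 1}) z \<partial>Q)
      = (\<integral>z. h (obsX z) * indicator {z. obsC z = 1} z \<partial>Q)" .
  also have "(\<integral>z. h (obsX z) * real_cond_exp Q (sigmaX Q) (indicator {z. obsC z = 1}) z \<partial>Q)
      = (\<integral>z. \<pi> (obsX z) * h (obsX z) \<partial>Q)"
    by (rule integral_cong_AE)
      (use \<pi> in \<open>auto simp: is_propensity_def elim!: eventually_mono\<close>)
  also have "(\<integral>z. h (obsX z) * indicator {z. obsC z = 1} z \<partial>Q) = (\<integral>z. obsC z * h (obsX z) \<partial>Q)"
    by (rule integral_cong_AE) (use AE_labeled in \<open>auto simp: labeled_def elim!: eventually_mono\<close>)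
  finally show ?thesis .
qed

end

theorem theorem3p3:
  fixes Q :: "'d::finite obs measure"
    and M :: "'w measure"
    and Z :: "nat \<Rightarrow> 'w \<Rightarrow> 'd obs"
    and \<pi> f :: "real^'d \<Rightarrow> real"
    and \<Phi> :: "'d dfun \<Rightarrow> real"
    and d\<Phi> :: "'d dfun \<Rightarrow> 'd dfun \<Rightarrow> real"
    and omega_hat :: "nat \<Rightarrow> 'w \<Rightarrow> real"
  assumes "prob_space Q" and "sets Q = sets borel"
    and "AE z in Q. obsC z \<in> {0, 1}"
    and "is_propensity Q \<pi>"
    and "f \<in> borel_measurable borel"
    and "has_hadamard_derivative \<Phi> (d\<Phi> (F0 Q)) (F0 Q)"
    and "has_hadamard_derivative \<Phi> (d\<Phi> (F0f Q f)) (F0f Q f)"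
    and "phi d\<Phi> Q \<in> borel_measurable borel" and "phif d\<Phi> Q f \<in> borel_measurable borel"
    and "prob_space.variance Q (\<lambda>z. (\<pi> (obsX z) - obsC z) * phif d\<Phi> Q f (obsX z)) > 0"
    and "prob_space M"
    and "prob_space.indep_vars M (\<lambda>_. borel) Z UNIV" and "\<And>i. distr M borel (Z i) = Q"
    and "cond_indep_given Q (sigmaX Q) obsC obsY"
    and "\<exists>\<epsilon>>0. AE z in Q. \<epsilon> < \<pi> (obsX z) \<and> \<pi> (obsX z) < 1 - \<epsilon>"
    and "\<And>m. (\<lambda>\<omega>. \<Phi> (FC m (\<lambda>i. Z i \<omega>))) \<in> borel_measurable M"
    and "\<And>m. (\<lambda>\<omega>. \<Phi> (FCf f m (\<lambda>i. Z i \<omega>))) \<in> borel_measurable M"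
    and "\<And>m. (\<lambda>\<omega>. \<Phi> (F\<pi>f \<pi> f m (\<lambda>i. Z i \<omega>))) \<in> borel_measurable M"
    and "\<And>m. omega_hat m \<in> borel_measurable M"
    and "tendsto_in_prob M omega_hat (omegaC d\<Phi> Q \<pi> f)"
  shows "weak_conv_m
           (\<lambda>m. distr M borel
              (\<lambda>\<omega>. sqrt (real m) * (theta_hat \<Phi> \<pi> f (omega_hat m \<omega>) m (\<lambda>i. Z i \<omega>) - \<Phi> (F0 Q))))
           (normal_law 0 (sigma2C d\<Phi> Q \<pi> f))"
proof -
  interpret prob_space M by fact
  interpret Q: observations Q by (intro observations.intro observations_axioms.intro) fact+
  interpret iid_sample M Q Z
  proof unfold_locales
    show "indep_vars (\<lambda>_. Q) Z UNIV"
      by (rule indep_vars_compose2[OF assms(12), of "\<lambda>_ x. x"]) (simp add: measurable_ident_sets assms(2))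
    show "distr M Q (Z i) = Q" for i
      using assms(13)[of i] distr_cong[of M M Q borel "Z i" "Z i"] assms(2) by simp
  qed
  have \<pi>_borel: "\<pi> \<in> borel_measurable borel" using assms(4) by (simp add: is_propensity_def)
  define \<phi> where "\<phi> z = phi d\<Phi> Q (obsX z, obsY z)" for z :: "'d obs"
  define \<phi>f where "\<phi>f z = phif d\<Phi> Q f (obsX z)" for z :: "'d obs"
  define \<pi>' where "\<pi>' z = max 0 (min 1 (\<pi> (obsX z)))" for z :: "'d obs"
  define p where "p = (\<integral>z. obsC z \<partial>Q)"
  have [measurable]: "(\<lambda>z. (obsX z, obsY z)) \<in> borel_measurable Q"
    by (intro Q.measurable_borel_Q borel_measurable_continuous_onI continuous_intros)
  have fX: "(\<lambda>x. (x, f x)) \<in> borel_measurable borel"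
    using assms(5) by (intro borel_measurable_Pair) auto
  have [measurable]: "(\<lambda>z. (obsX z, f (obsX z))) \<in> borel_measurable Q"
    by (rule measurable_compose[OF Q.measurable_obs(1) fX])
  have [measurable]: "\<phi> \<in> borel_measurable Q"
    unfolding \<phi>_def[abs_def] by (rule measurable_compose[OF _ assms(8)]) measurable
  have [measurable]: "\<phi>f \<in> borel_measurable Q"
    unfolding \<phi>f_def[abs_def] by (rule measurable_compose[OF _ assms(9)]) measurable
  have [measurable]: "(\<lambda>z. \<pi> (obsX z)) \<in> borel_measurable Q"
    by (rule measurable_compose[OF _ \<pi>_borel]) measurable
  have [measurable]: "\<pi>' \<in> borel_measurable Q" unfolding \<pi>'_def[abs_def] by measurable
  obtain \<epsilon> where \<epsilon>: "\<epsilon> > 0" "AE z in Q. \<epsilon> < \<pi> (obsX z) \<and> \<pi> (obsX z) < 1 - \<epsilon>"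
    using assms(15) by blast
  have \<pi>01: "AE z in Q. 0 \<le> \<pi> (obsX z) \<and> \<pi> (obsX z) \<le> 1"
    using \<epsilon>(2) by eventually_elim (use \<epsilon>(1) in simp)
  have C01: "AE z in Q. 0 \<le> obsC z \<and> obsC z \<le> 1"
    using assms(3) by eventually_elim auto
  have AE_\<pi>': "AE z in Q. \<pi>' z = \<pi> (obsX z)" using \<pi>01 by eventually_elim (simp add: \<pi>'_def)
  have p\<pi>: "p = (\<integral>z. \<pi> (obsX z) \<partial>Q)"
    using Q.integral_propensity[OF assms(4), of "\<lambda>_. 1" 1] by (simp add: p_def)
  \<comment> \<open>The labelled fraction is the mean propensity, which the overlap condition bounds
    below.\<close>
  have "p > 0"
  proof -
    have "\<epsilon> \<le> (\<integral>z. \<pi> (obsX z) \<partial>Q)"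
    proof (rule Q.integral_ge_const)
      have "AE z in Q. norm (\<pi> (obsX z)) \<le> 1" using \<pi>01 by eventually_elim simp
      then show "integrable Q (\<lambda>z. \<pi> (obsX z))" by (rule Q.integrable_const_bound) measurable
      show "AE z in Q. \<epsilon> \<le> \<pi> (obsX z)" using \<epsilon>(2) by eventually_elim simp
    qed
    then show ?thesis using \<epsilon>(1) p\<pi> by simp
  qed
  have F0: "F0 Q u = (\<integral>z. obsC z * delta (obsX z, obsY z) u \<partial>Q) / p" for u
    using Q.cond_cdf_eq[OF measurable_delta[of "\<lambda>z. (obsX z, obsY z)" u]] by (simp add: F0_def p_def)
  have F0f: "F0f Q f u = (\<integral>z. obsC z * delta (obsX z, f (obsX z)) u \<partial>Q) / p" for u
    using Q.cond_cdf_eq[OF measurable_delta[of "\<lambda>z. (obsX z, f (obsX z))" u]]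
    by (simp add: F0f_def p_def)
  \<comment> \<open>The propensity-weighted estimator is centred at the same distribution function
    as the labelled one, so their difference has no asymptotic bias.\<close>
  have F0f\<pi>: "F0f Q f u = (\<integral>z. \<pi> (obsX z) * delta (obsX z, f (obsX z)) u \<partial>Q) / p" for u
  proof -
    have "(\<lambda>q. delta q u) \<in> borel_measurable borel"
      by (rule borel_delta)
    then have "(\<lambda>x. delta (x, f x) u) \<in> borel_measurable borel"
      by (rule measurable_compose[OF fX])
    from Q.integral_propensity[OF assms(4) this, of 1] show ?thesis by (simp add: F0f delta_def)
  qed
  obtain K where K: "\<And>z. \<bar>\<phi> z\<bar> \<le> K" "\<And>z. \<bar>\<phi>f z\<bar> \<le> K"
  proof -
    have d: "\<bar>delta q u - F u\<bar> \<le> 1" if "0 \<le> F u" "F u \<le> 1" for q u and F :: "'d dfun"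
      using that by (auto simp: delta_def)
    have F01: "0 \<le> F0 Q u" "F0 Q u \<le> 1" "0 \<le> F0f Q f u" "F0f Q f u \<le> 1" for u
      unfolding F0_def F0f_def by (rule Q.cond_prob_le_1 | simp add: cond_prob_def)+
    obtain A where A: "A > 0" "\<And>h b. (\<And>u. \<bar>h u\<bar> \<le> b) \<Longrightarrow> \<bar>d\<Phi> (F0 Q) h\<bar> \<le> A * b"
      using hadamard_derivative_bound[OF assms(6)] by blast
    obtain B where B: "B > 0" "\<And>h b. (\<And>u. \<bar>h u\<bar> \<le> b) \<Longrightarrow> \<bar>d\<Phi> (F0f Q f) h\<bar> \<le> B * b"
      using hadamard_derivative_bound[OF assms(7)] by blast
    have "\<bar>\<phi> z\<bar> \<le> A * 1" for z unfolding \<phi>_def phi_def by (intro A d F01)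
    then have 1: "\<bar>\<phi> z\<bar> \<le> A + B" for z
      by (rule order_trans) (use B(1) in simp)
    have "\<bar>\<phi>f z\<bar> \<le> B * 1" for z unfolding \<phi>f_def phif_def by (intro B d F01)
    then have 2: "\<bar>\<phi>f z\<bar> \<le> A + B" for z
      by (rule order_trans) (use A(1) in simp)
    show thesis by (rule that[OF 1 2])
  qed
  have bdd: "\<bar>a * b\<bar> \<le> K" if "\<bar>a\<bar> \<le> 1" "\<bar>b\<bar> \<le> K" for a b :: real
    unfolding abs_mult using mult_mono[OF that] by simp
  have l1: "\<bar>Q.labeled z\<bar> \<le> 1" "\<bar>\<pi>' z\<bar> \<le> 1" "\<bar>\<pi>' z - Q.labeled z\<bar> \<le> 1" for z
    using Q.labeled_bounds[of z] by (auto simp: \<pi>'_def)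
  \<comment> \<open>\<open>A\<close> and \<open>B\<close> are everywhere bounded versions of the two
    variables in the variance formula; they agree with them almost everywhere, so variances and the
    covariance are unchanged.\<close>
  define A where "A z = Q.labeled z * \<phi> z" for z
  define B where "B z = (\<pi>' z - Q.labeled z) * \<phi>f z" for z
  have [measurable]: "A \<in> borel_measurable Q" "B \<in> borel_measurable Q"
    unfolding A_def[abs_def] B_def[abs_def] by measurable
  have AB: "\<bar>A z\<bar> \<le> K" "\<bar>B z\<bar> \<le> K" for z unfolding A_def B_def by (intro bdd l1 K)+
  have AE_A: "AE z in Q. A z = obsC z * \<phi> z" using Q.AE_labeled by eventually_elim (simp add: A_def)
  have AE_B: "AE z in Q. B z = (\<pi> (obsX z) - obsC z) * \<phi>f z"
    using Q.AE_labeled AE_\<pi>' by eventually_elim (simp add: B_def)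
  have intAB: "integrable Q A" "integrable Q B"
    by (rule integrable_bounded[OF _ AB(1)], simp, rule integrable_bounded[OF _ AB(2)], simp)

  define R1 where "R1 m \<omega> = sqrt m * (\<Phi> (FC m (\<lambda>i. Z i \<omega>)) - \<Phi> (F0 Q)) - emp m A \<omega> / p" for m \<omega>
  define R2 where "R2 m \<omega> = sqrt m * (\<Phi> (FCf f m (\<lambda>i. Z i \<omega>)) - \<Phi> (F0f Q f))
      - emp m (\<lambda>z. Q.labeled z * \<phi>f z) \<omega> / p" for m \<omega>
  define R3 where "R3 m \<omega> = sqrt m * (\<Phi> (F\<pi>f \<pi> f m (\<lambda>i. Z i \<omega>)) - \<Phi> (F0f Q f))
      - emp m (\<lambda>z. \<pi>' z * \<phi>f z) \<omega> / p" for m \<omega>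
  have R1: "small_op R1"
  proof (rule small_op_cong[OF weighted_edf_expansion[OF Q.space_Q, where w = obsC
          and V = "\<lambda>z. (obsX z, obsY z)" and \<psi> = \<phi> and p = p, OF _ _ _ C01 p_def \<open>p > 0\<close> F0 assms(6)]])
    have ae: "AE \<omega> in M. emp m A \<omega> = emp m (\<lambda>z. obsC z * \<phi> z) \<omega>" for m
      by (rule emp_AE_cong[OF AE_A]) measurable
    show "whp (\<lambda>m \<omega>. sqrt m * (\<Phi> (\<lambda>u. (\<Sum>i<m. obsC (Z i \<omega>) * delta (obsX (Z i \<omega>), obsY (Z i \<omega>)) u)
          / (\<Sum>i<m. obsC (Z i \<omega>))) - \<Phi> (F0 Q)) - emp m (\<lambda>z. obsC z * \<phi> z) \<omega> / p = R1 m \<omega>)"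
      (is "whp (\<lambda>m \<omega>. ?L m \<omega> = _)")
    proof (rule whp_AE)
      fix m
      show "AE \<omega> in M. ?L m \<omega> = R1 m \<omega>"
        using ae[of m] by eventually_elim (simp add: R1_def FC_def[abs_def])
    qed
  qed (simp_all add: \<phi>_def phi_def)
  have R2: "small_op R2"
  proof (rule small_op_cong[OF weighted_edf_expansion[OF Q.space_Q, where w = obsC
          and V = "\<lambda>z. (obsX z, f (obsX z))" and \<psi> = \<phi>f and p = p, OF _ _ _ C01 p_def \<open>p > 0\<close> F0f assms(7)]])
    have ae: "AE \<omega> in M. emp m (\<lambda>z. Q.labeled z * \<phi>f z) \<omega> = emp m (\<lambda>z. obsC z * \<phi>f z) \<omega>" for m
      by (rule emp_AE_cong) (use Q.AE_labeled in \<open>auto elim!: eventually_mono\<close>)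
    show "whp (\<lambda>m \<omega>. sqrt m * (\<Phi> (\<lambda>u. (\<Sum>i<m. obsC (Z i \<omega>) * delta (obsX (Z i \<omega>), f (obsX (Z i \<omega>))) u)
          / (\<Sum>i<m. obsC (Z i \<omega>))) - \<Phi> (F0f Q f)) - emp m (\<lambda>z. obsC z * \<phi>f z) \<omega> / p = R2 m \<omega>)"
      (is "whp (\<lambda>m \<omega>. ?L m \<omega> = _)")
    proof (rule whp_AE)
      fix m
      show "AE \<omega> in M. ?L m \<omega> = R2 m \<omega>"
        using ae[of m] by eventually_elim (simp add: R2_def FCf_def[abs_def])
    qed
  qed (simp_all add: \<phi>f_def phif_def)
  have R3: "small_op R3"
  proof (rule small_op_cong[OF weighted_edf_expansion[OF Q.space_Q, where w = "\<lambda>z. \<pi> (obsX z)"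
          and V = "\<lambda>z. (obsX z, f (obsX z))" and \<psi> = \<phi>f and p = p, OF _ _ _ \<pi>01 p\<pi> \<open>p > 0\<close> F0f\<pi> assms(7)]])
    have ae: "AE \<omega> in M. emp m (\<lambda>z. \<pi>' z * \<phi>f z) \<omega> = emp m (\<lambda>z. \<pi> (obsX z) * \<phi>f z) \<omega>" for m
      by (rule emp_AE_cong) (use AE_\<pi>' in \<open>auto elim!: eventually_mono\<close>)
    show "whp (\<lambda>m \<omega>. sqrt m * (\<Phi> (\<lambda>u. (\<Sum>i<m. \<pi> (obsX (Z i \<omega>)) * delta (obsX (Z i \<omega>), f (obsX (Z i \<omega>))) u)
          / (\<Sum>i<m. \<pi> (obsX (Z i \<omega>)))) - \<Phi> (F0f Q f)) - emp m (\<lambda>z. \<pi> (obsX z) * \<phi>f z) \<omega> / p = R3 m \<omega>)"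
      (is "whp (\<lambda>m \<omega>. ?L m \<omega> = _)")
    proof (rule whp_AE)
      fix m
      show "AE \<omega> in M. ?L m \<omega> = R3 m \<omega>"
        using ae[of m] by eventually_elim (simp add: R3_def F\<pi>f_def[abs_def])
    qed
  qed (simp_all add: \<phi>f_def phif_def)

  define c where "c = omegaC d\<Phi> Q \<pi> f"
  \<comment> \<open>Influence function of the augmented estimator, with the limiting weight in place
    of the estimated one.\<close>
  define g where "g z = (A z + c * B z) / p" for z
  have [measurable]: "g \<in> borel_measurable Q" unfolding g_def[abs_def] by measurable
  have gb: "\<bar>g z\<bar> \<le> (K + \<bar>c\<bar> * K) / p" for z
  proof -
    have "\<bar>A z + c * B z\<bar> \<le> K + \<bar>c\<bar> * K"
      using AB[of z] mult_left_mono[OF AB(2), of "\<bar>c\<bar>" z] abs_triangle_ineq[of "A z" "c * B z"]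
      by (simp add: abs_mult)
    then show ?thesis using \<open>p > 0\<close> by (simp add: g_def divide_right_mono)
  qed
  have emp_g: "emp m g \<omega> = (emp m A \<omega> + c * emp m B \<omega>) / p" for m \<omega>
  proof -
    have "emp m g \<omega> = emp m (\<lambda>z. inverse p * (A z + c * B z)) \<omega>" by (simp add: g_def[abs_def] field_simps)
    also have "\<dots> = inverse p * (emp m A \<omega> + c * emp m B \<omega>)"
      unfolding emp_cmult by (subst emp_add) (simp_all add: intAB emp_cmult)
    finally show ?thesis by (simp add: field_simps)
  qed
  have emp_B: "emp m B \<omega> = emp m (\<lambda>z. \<pi>' z * \<phi>f z) \<omega> - emp m (\<lambda>z. Q.labeled z * \<phi>f z) \<omega>" for m \<omega>
  proof -
    have "integrable Q (\<lambda>z. \<pi>' z * \<phi>f z)"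
      by (rule integrable_bounded[OF _ bdd[OF l1(2) K(2)]]) measurable
    moreover have "integrable Q (\<lambda>z. Q.labeled z * \<phi>f z)"
      by (rule integrable_bounded[OF _ bdd[OF l1(1) K(2)]]) measurable
    ultimately show ?thesis by (simp add: B_def[abs_def] left_diff_distrib emp_diff)
  qed
  define S where "S m \<omega> = sqrt m * (theta_hat \<Phi> \<pi> f (omega_hat m \<omega>) m (\<lambda>i. Z i \<omega>) - \<Phi> (F0 Q))"
    for m \<omega>
  have om: "small_op (\<lambda>m \<omega>. omega_hat m \<omega> - c)"
    unfolding c_def by (rule tendsto_in_prob_imp_small_op[OF assms(20,19)])
  have omO: "big_Op omega_hat"
    using big_Op_add[OF small_op_imp_big_Op[OF om] big_Op_const[of c]] by simp
  have bB: "big_Op (\<lambda>m \<omega>. emp m B \<omega> * inverse p)"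
  proof -
    have "big_Op (\<lambda>m. emp m (\<lambda>z. inverse p * B z))"
      by (rule big_Op_emp[where b = "inverse p * K"]) (use AB \<open>p > 0\<close> in \<open>auto simp: abs_mult\<close>)
    then show ?thesis unfolding emp_cmult[abs_def] by (simp only: mult.commute)
  qed
  have R23: "small_op (\<lambda>m \<omega>. R3 m \<omega> + R2 m \<omega> * (-1))"
    by (intro small_op_add R3 small_op_mult[OF R2] big_Op_const)
  \<comment> \<open>The common centre \<open>\<Phi> (F0f Q f)\<close> cancels between the two added
    estimators; the estimated weight leaves only its error times a quantity bounded in
    probability.\<close>
  have "small_op (\<lambda>m \<omega>. R1 m \<omega> + ((R3 m \<omega> + R2 m \<omega> * (-1)) * omega_hat m \<omega>
      + (omega_hat m \<omega> - c) * (emp m B \<omega> * inverse p)))"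
    by (intro small_op_add R1 small_op_mult[OF R23 omO] small_op_mult[OF om bB])
  also have "(\<lambda>m \<omega>. R1 m \<omega> + ((R3 m \<omega> + R2 m \<omega> * (-1)) * omega_hat m \<omega>
      + (omega_hat m \<omega> - c) * (emp m B \<omega> * inverse p))) = (\<lambda>m \<omega>. S m \<omega> - emp m g \<omega>)"
    using \<open>p > 0\<close>
    by (simp add: fun_eq_iff S_def emp_g emp_B R1_def R2_def R3_def theta_hat_def divide_inverse algebra_simps)
  finally have ST: "small_op (\<lambda>m \<omega>. S m \<omega> - emp m g \<omega>)" .
  have S_meas: "S m \<in> borel_measurable M" for m
    unfolding S_def[abs_def] theta_hat_def using assms(16-19) by measurable
  have var: "Q.variance g = sigma2C d\<Phi> Q \<pi> f"
  proof -
    have CA: "(\<lambda>z. obsC z * \<phi> z) \<in> borel_measurable Q"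
      "(\<lambda>z. (\<pi> (obsX z) - obsC z) * \<phi>f z) \<in> borel_measurable Q" by measurable
    have 1: "Q.variance (\<lambda>z. obsC z * \<phi> z) = Q.variance A"
      unfolding variance_eq_covariance by (rule sym, intro covariance_AE_cong AE_A CA) measurable
    have 2: "Q.variance (\<lambda>z. (\<pi> (obsX z) - obsC z) * \<phi>f z) = Q.variance B"
      unfolding variance_eq_covariance by (rule sym, intro covariance_AE_cong AE_B CA) measurable
    have 3: "covariance Q (\<lambda>z. obsC z * \<phi> z) (\<lambda>z. (\<pi> (obsX z) - obsC z) * \<phi>f z) = covariance Q A B"
      by (rule sym, intro covariance_AE_cong AE_A AE_B CA) measurable
    \<comment> \<open>The numerator of the weight is built with \<open>C - \<pi>(X)\<close>, the
      variance formula with \<open>\<pi>(X) - C\<close>; hence the sign of \<open>c\<close>.\<close>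
    have "(\<lambda>z. (obsC z - \<pi> (obsX z)) * \<phi>f z) = (\<lambda>z. - ((\<pi> (obsX z) - obsC z) * \<phi>f z))"
      by (simp add: fun_eq_iff algebra_simps)
    then have 4: "covariance Q (\<lambda>z. obsC z * \<phi> z) (\<lambda>z. (obsC z - \<pi> (obsX z)) * \<phi>f z) = - covariance Q A B"
      using 3 by (simp only: covariance_uminus_right)
    have pos: "Q.variance B > 0" using assms(10) 2 by (simp add: \<phi>f_def)
    have c: "c = - covariance Q A B / Q.variance B"
      using 2 4 by (simp add: c_def omegaC_def \<phi>_def \<phi>f_def)
    have s: "sigma2C d\<Phi> Q \<pi> f = Q.variance A / p\<^sup>2 - (covariance Q A B)\<^sup>2 / (p\<^sup>2 * Q.variance B)"
      using 1 2 3 by (simp add: sigma2C_def \<phi>_def \<phi>f_def p_def Q.integral_obsC)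
    \<comment> \<open>\<open>c\<close> minimises the variance of \<open>A + c * B\<close>: its cross
      term contributes minus twice, its square once, the squared covariance over the variance of
      \<open>B\<close>.\<close>
    have alg: "(a + 2 * (- k / b) * k + (- k / b)\<^sup>2 * b) / p\<^sup>2 = a / p\<^sup>2 - k\<^sup>2 / (p\<^sup>2 * b)"
      if "b > 0" for a b k :: real
      using that \<open>p > 0\<close> by (simp add: field_simps power2_eq_square)
    have "Q.variance g = (Q.variance A + 2 * c * covariance Q A B + c\<^sup>2 * Q.variance B) / p\<^sup>2"
      unfolding g_def by (rule Q.variance_linear_combination[OF _ _ AB]) measurable
    then show ?thesis unfolding s c by (simp only: alg[OF pos])
  qed
  have "weak_conv_m (\<lambda>m. distr M borel (S m)) (normal_law 0 (sigma2C d\<Phi> Q \<pi> f))"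
  proof (rule weak_conv_small_op[OF S_meas _ ST])
    show "real_distribution (normal_law 0 (sigma2C d\<Phi> Q \<pi> f))"
      unfolding var[symmetric] by (rule real_distribution_normal_law) (rule Q.variance_positive)
    show "weak_conv_m (\<lambda>m. distr M borel (emp m g)) (normal_law 0 (sigma2C d\<Phi> Q \<pi> f))"
      unfolding var[symmetric] by (rule emp_clt[OF _ gb]) measurable
  qed measurable
  then show ?thesis by (simp add: S_def[abs_def])
qed

end
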